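(* For $u\in Z$ the following assertions are equivalent. (1) The map $u$ is a weak solution of $(\partial_t^2+\Delta^2)u\perp T_uS^l$. (2) The map $u$ is a weak solution of $$(\partial_t^2+\Delta^2)u=\big[\,|\Delta u|^2-|\partial_t u|^2-\Delta|\nabla u|^2-2\,\mathrm{div}\langle\Delta u,\nabla u\rangle\big]\,u.$$ (3) For all skew-symmetric matrices $\Lambda\in\mathbb{R}^{(l+1)\times(l+1)}$ the map $u$ is a weak solution of $$0=\partial_t\langle\partial_t u,\Lambda u\rangle+\Delta\langle\Delta u,\Lambda u\rangle-2\,\mathrm{div}\langle\Delta u,\Lambda\nabla u\rangle$$ on $\mathbb{R}\times\mathbb{R}^n$ with test functions in $W_s$.
   Context: Here $S^l$ is the $l$-dimensional unit sphere in $\mathbb{R}^{l+1}$, $T_yS^l=\{\xi\in\mathbb{R}^{l+1}:\langle\xi,y\rangle=0\}$, $\langle\cdot,\cdot\rangle$ is the scalar product of $\mathbb{R}^{l+1}$, $|\cdot|$ denotes Euclidean norms, and $\Delta,\nabla,\mathrm{div}$ act in the space variable $x\in\mathbb{R}^n$ only (componentwise on $\mathbb{R}^{l+1}$-valued maps). All derivatives are understood in the distributional sense. For a matrix $A\in\mathbb{R}^{(l+1)\times(l+1)}$, $\mathrm{div}\langle\Delta u,A\nabla u\rangle=\sum_{i=1}^n\partial_i\langle\Delta u,A\partial_i u\rangle$, and for a scalar function $\psi$, $\nabla\psi\,\langle\Delta u,A\nabla u\rangle=\sum_{i=1}^n\partial_i\psi\,\langle\Delta u,A\partial_i u\rangle$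 (with $A$ omitted when it is the identity). Function spaces ($\mathrm{supp}_t\,v$ denotes the support of $t\mapsto v(t,\cdot)$ as a map from $\mathbb{R}$ into $L^\infty$ in $x$): $$Z=\{u\in L^\infty(\mathbb{R}\times\mathbb{R}^n,\mathbb{R}^{l+1})\,|\,u(t,x)\in S^l\text{ a.e.},\ \partial_t u,\Delta u\in L^2_{\mathrm{loc}}(\mathbb{R};L^2(\mathbb{R}^n,\mathbb{R}^{l+1}))\},$$ $$W=\{v\in L^\infty(\mathbb{R}\times\mathbb{R}^n,\mathbb{R}^{l+1})\,|\,|\partial_t v|,|\nabla v|^2,|\Delta v|\in L^2(\mathbb{R}\times\mathbb{R}^n);\ \mathrm{supp}_t\,v\text{ compact}\},$$ $$V=\{v\in W\,|\,v(t,x)\in T_{u(t,x)}S^l\text{ for a.e. }(t,x)\in\mathbb{R}\times\mathbb{R}^n\},$$ $$W_s=\{v\in L^\infty(\mathbb{R}\times\mathbb{R}^n)\text{ (scalar, real-valued)}\,|\,|\partial_t v|,|\nabla v|^2,|\Delta v|\in L^2(\mathbb{R}\times\mathbb{R}^n);\ \mathrm{supp}_t\,v\text{ compact}\}.$$ Each $u\in Z$ satisfies $|\nabla u|^2\le|\Delta u|$ and hence $|\nabla u|\in L^4_{\mathrm{loc}}(\mathbb{R};L^4(\mathbb{R}^n))$. Weak solutions, for $u\in Z$: - $u$ is a weak solution of $(\partial_t^2+\Delta^2)u\perp T_uS^l$ if $\int_{\mathbb{R}\times\mathbb{R}^n}\big(-\langle\partial_t u,\partial_t v\rangle+\langle\Delta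 u,\Delta v\rangle\big)\,dt\,dx=0$ for all $v\in V$. - $u$ is a weak solution of the equation in (2) if for all $\phi\in W$ $$\int_{\mathbb{R}\times\mathbb{R}^n}\big(-\langle\partial_t u,\partial_t\phi\rangle+\langle\Delta u,\Delta\phi\rangle\big)\,dt\,dx=\int_{\mathbb{R}\times\mathbb{R}^n}\Big((|\Delta u|^2-|\partial_t u|^2)\langle u,\phi\rangle-|\nabla u|^2\,\Delta\langle u,\phi\rangle+2\langle\Delta u,\nabla u\rangle\,\nabla\langle u,\phi\rangle\Big)\,dt\,dx.$$ - $u$ is a weak solution of the equation in (3) with test functions in $W_s$ if for all $\varphi\in W_s$ $$\int_{\mathbb{R}\times\mathbb{R}^n}\Big(-\partial_t\varphi\,\langle\partial_t u,\Lambda u\rangle+\Delta\varphi\,\langle\Delta u,\Lambda u\rangle+2\nabla\varphi\,\langle\Delta u,\Lambda\nabla u\rangle\Big)\,dt\,dx=0.$$ *)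

theory Defs
  imports "HOL-Analysis.Analysis"
begin

text \<open>
  Space-time is \<open>real \<times> (real ^ 'n)\<close> with \<open>n = CARD('n)\<close>, and the target
  \<open>real ^ 'm\<close> has \<open>CARD('m) = l + 1\<close>, so that the unit sphere is \<open>sphere 0 1\<close>.
  Elements of the function spaces are represented by Borel measurable functions; every
  Lebesgue class has such a representative, and all notions below are invariant under
  modification on null sets.
\<close>

subsection \<open>Distributional derivatives\<close>

primrec C_k :: "nat \<Rightarrow> ('a::euclidean_space \<Rightarrow> real) \<Rightarrow> bool" where
  "C_k 0 f \<longleftrightarrow> continuous_on UNIV f"
| "C_k (Suc k) f \<longleftrightarrow>
     (\<forall>z. f differentiable (at z)) \<and> (\<forall>b\<in>Basis. C_k k (\<lambda>z. frechet_derivative f (at z) b))"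

definition test_fun :: "('a::euclidean_space \<Rightarrow> real) \<Rightarrow> bool" where
  "test_fun \<eta> \<longleftrightarrow> (\<forall>k. C_k k \<eta>) \<and> compact (closure {z. \<eta> z \<noteq> 0})"

definition loc_integrable :: "('a::euclidean_space \<Rightarrow> 'b::euclidean_space) \<Rightarrow> bool" where
  "loc_integrable f \<longleftrightarrow> (\<forall>K. compact K \<longrightarrow> set_integrable lborel K f)"

definition has_weak_deriv ::
  "('a::euclidean_space \<Rightarrow> 'b::euclidean_space) \<Rightarrow> 'a \<Rightarrow> ('a \<Rightarrow> 'b) \<Rightarrow> bool" where
  "has_weak_deriv f e g \<longleftrightarrow> loc_integrable f \<and> loc_integrable g \<and>
     (\<forall>\<eta>. test_fun \<eta> \<longrightarrow>
        (\<integral>z. frechet_derivative \<eta> (at z) e *\<^sub>R f z \<partial>lborel) = - (\<integral>z. \<eta> z *\<^sub>R g z \<partial>lborel))"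

definition weak_deriv ::
  "'a \<Rightarrow> ('a::euclidean_space \<Rightarrow> 'b::euclidean_space) \<Rightarrow> ('a \<Rightarrow> 'b)" where
  "weak_deriv e f = (SOME g. has_weak_deriv f e g)"

definition t_dir :: "real \<times> (real ^ 'n)" where
  "t_dir = (1, 0)"

definition x_dir :: "'n \<Rightarrow> real \<times> (real ^ 'n)" where
  "x_dir i = (0, axis i 1)"

definition laplace_x :: "(real \<times> (real ^ 'n) \<Rightarrow> real) \<Rightarrow> real \<times> (real ^ 'n) \<Rightarrow> real" where
  "laplace_x \<eta> z = (\<Sum>i\<in>UNIV.
     frechet_derivative (\<lambda>y. frechet_derivative \<eta> (at y) (x_dir i)) (at z) (x_dir i))"

text \<open>
  The distributional Laplacian in \<open>x\<close> only has to be a function as a whole; the individual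
  second derivatives, or even the first ones, are not assumed to be functions.
\<close>

definition has_weak_laplacian ::
  "(real \<times> (real ^ 'n) \<Rightarrow> 'b::euclidean_space) \<Rightarrow> (real \<times> (real ^ 'n) \<Rightarrow> 'b) \<Rightarrow> bool" where
  "has_weak_laplacian f g \<longleftrightarrow> loc_integrable f \<and> loc_integrable g \<and>
     (\<forall>\<eta>. test_fun \<eta> \<longrightarrow>
        (\<integral>z. laplace_x \<eta> z *\<^sub>R f z \<partial>lborel) = (\<integral>z. \<eta> z *\<^sub>R g z \<partial>lborel))"

definition weak_laplacian ::
  "(real \<times> (real ^ 'n) \<Rightarrow> 'b::euclidean_space) \<Rightarrow> (real \<times> (real ^ 'n) \<Rightarrow> 'b)" where
  "weak_laplacian f = (SOME g. has_weak_laplacian f g)"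

text \<open>
  The chosen representatives are meaningful (and then unique almost everywhere) only where the
  distributional derivative is a locally integrable function.
\<close>

abbreviation dt :: "(real \<times> (real ^ 'n) \<Rightarrow> 'b::euclidean_space) \<Rightarrow> (real \<times> (real ^ 'n) \<Rightarrow> 'b)" where
  "dt f \<equiv> weak_deriv t_dir f"

abbreviation dx :: "'n \<Rightarrow> (real \<times> (real ^ 'n) \<Rightarrow> 'b::euclidean_space) \<Rightarrow> (real \<times> (real ^ 'n) \<Rightarrow> 'b)" where
  "dx i f \<equiv> weak_deriv (x_dir i) f"

abbreviation lap :: "(real \<times> (real ^ 'n) \<Rightarrow> 'b::euclidean_space) \<Rightarrow> (real \<times> (real ^ 'n) \<Rightarrow> 'b)" where
  "lap f \<equiv> weak_laplacian f"

definition norm_grad_sq :: "(real \<times> (real ^ 'n) \<Rightarrow> 'b::euclidean_space) \<Rightarrow> real \<times> (real ^ 'n) \<Rightarrow> real" where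
  "norm_grad_sq f z = (\<Sum>i\<in>UNIV. (norm (dx i f z))\<^sup>2)"


subsection \<open>Function spaces\<close>

definition Linf :: "(real \<times> (real ^ 'n) \<Rightarrow> 'b::euclidean_space) set" where
  "Linf = {f \<in> borel_measurable lborel. \<exists>C. AE z in lborel. norm (f z) \<le> C}"

definition L2 :: "(real \<times> (real ^ 'n) \<Rightarrow> 'b::euclidean_space) set" where
  "L2 = {f \<in> borel_measurable lborel. integrable lborel (\<lambda>z. (norm (f z))\<^sup>2)}"

text \<open>\<open>L\<^sup>2\<^sub>l\<^sub>o\<^sub>c(\<real>; L\<^sup>2(\<real>\<^sup>n))\<close>: local in time, global in space.\<close>

definition L2_loc_t :: "(real \<times> (real ^ 'n) \<Rightarrow> 'b::euclidean_space) set" where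
  "L2_loc_t = {f \<in> borel_measurable lborel.
     \<forall>K. compact K \<longrightarrow> set_integrable lborel (K \<times> UNIV) (\<lambda>z. (norm (f z))\<^sup>2)}"

text \<open>
  The support of \<open>t \<mapsto> v(t, \<cdot>)\<close> as a map into \<open>L\<^sup>\<infinity>\<close>: the complement of the largest open set of
  times on which \<open>v(t, \<cdot>)\<close> vanishes as an \<open>L\<^sup>\<infinity>\<close> class for almost every \<open>t\<close>.
\<close>

definition supp_t :: "(real \<times> (real ^ 'n) \<Rightarrow> 'b::euclidean_space) \<Rightarrow> real set" where
  "supp_t v = - \<Union>{U. open U \<and> (AE z in lborel. fst z \<in> U \<longrightarrow> v z = 0)}"

definition tangent_sphere :: "'b::euclidean_space \<Rightarrow> 'b set" where
  "tangent_sphere y = {\<xi>. \<xi> \<bullet> y = 0}"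

definition Z_space :: "(real \<times> (real ^ 'n) \<Rightarrow> real ^ 'm) set" where
  "Z_space = {u \<in> Linf. (AE z in lborel. u z \<in> sphere 0 1) \<and>
     has_weak_deriv u t_dir (dt u) \<and> dt u \<in> L2_loc_t \<and>
     has_weak_laplacian u (lap u) \<and> lap u \<in> L2_loc_t}"

definition W_space :: "(real \<times> (real ^ 'n) \<Rightarrow> 'b::euclidean_space) set" where
  "W_space = {v \<in> Linf.
     has_weak_deriv v t_dir (dt v) \<and> dt v \<in> L2 \<and>
     (\<forall>i. has_weak_deriv v (x_dir i) (dx i v)) \<and> norm_grad_sq v \<in> L2 \<and>
     has_weak_laplacian v (lap v) \<and> lap v \<in> L2 \<and>
     compact (supp_t v)}"

definition V_space :: "(real \<times> (real ^ 'n) \<Rightarrow> real ^ 'm) \<Rightarrow> (real \<times> (real ^ 'n) \<Rightarrow> real ^ 'm) set" where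
  "V_space u = {v \<in> W_space. AE z in lborel. v z \<in> tangent_sphere (u z)}"

definition Ws_space :: "(real \<times> (real ^ 'n) \<Rightarrow> real) set" where
  "Ws_space = W_space"


subsection \<open>Weak solutions\<close>

text \<open>
  For \<open>u \<in> Z_space\<close> and test functions in the given spaces all integrands below are
  integrable, so the convention that the integral of a non-integrable function is \<open>0\<close>
  is not used.
\<close>

definition weak_sol_perp :: "(real \<times> (real ^ 'n) \<Rightarrow> real ^ 'm) \<Rightarrow> bool" where
  "weak_sol_perp u \<longleftrightarrow> (\<forall>v \<in> V_space u.
     (\<integral>z. - (dt u z \<bullet> dt v z) + lap u z \<bullet> lap v z \<partial>lborel) = 0)"

definition weak_sol_biharm :: "(real \<times> (real ^ 'n) \<Rightarrow> real ^ 'm) \<Rightarrow> bool" where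
  "weak_sol_biharm u \<longleftrightarrow> (\<forall>\<phi> \<in> W_space.
     (\<integral>z. - (dt u z \<bullet> dt \<phi> z) + lap u z \<bullet> lap \<phi> z \<partial>lborel) =
     (\<integral>z. ((norm (lap u z))\<^sup>2 - (norm (dt u z))\<^sup>2) * (u z \<bullet> \<phi> z)
           - norm_grad_sq u z * lap (\<lambda>y. u y \<bullet> \<phi> y) z
           + 2 * (\<Sum>i\<in>UNIV. (lap u z \<bullet> dx i u z) * dx i (\<lambda>y. u y \<bullet> \<phi> y) z) \<partial>lborel))"

definition weak_sol_conservation ::
  "real ^ 'm ^ 'm \<Rightarrow> (real \<times> (real ^ 'n) \<Rightarrow> real ^ 'm) \<Rightarrow> bool" where
  "weak_sol_conservation \<Lambda> u \<longleftrightarrow> (\<forall>\<phi> \<in> Ws_space.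
     (\<integral>z. - dt \<phi> z * (dt u z \<bullet> (\<Lambda> *v u z))
           + lap \<phi> z * (lap u z \<bullet> (\<Lambda> *v u z))
           + 2 * (\<Sum>i\<in>UNIV. dx i \<phi> z * (lap u z \<bullet> (\<Lambda> *v dx i u z))) \<partial>lborel) = 0)"

end

theory Submission
  imports Defs
begin

text \<open>
  With \<open>\<psi> = \<langle>u, \<phi>\<rangle>\<close>, the right-hand side of (2) is pointwise the integrand of the weak form of (1)
  tested with \<open>\<psi> u\<close>, and \<open>\<phi> - \<psi> u\<close> is tangential; in (3) the test map is \<open>\<phi> \<Lambda> u\<close>, and every
  tangential \<open>v\<close> equals \<open>(v u\<^sup>T - u v\<^sup>T) u\<close>, a sum of such maps. So no integration by parts is
  needed beyond the product rules for \<open>\<partial>\<^sub>t\<close> and \<open>\<Delta>\<close> and the identities \<open>\<langle>\<partial>\<^sub>t u, u\<rangle> = 0\<close> and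
  \<open>\<langle>\<Delta>u, u\<rangle> = - |\<nabla>u|\<^sup>2\<close>, which differentiate \<open>|u|\<^sup>2 = 1\<close>.

  The point is that a bounded \<open>f\<close> with \<open>\<Delta>f\<close> locally integrable has a gradient in \<open>L\<^sup>2\<^sub>l\<^sub>o\<^sub>c\<close>: for the
  mollifications \<open>f\<^sub>n\<close> and \<open>w = f\<^sub>n - f\<^sub>m\<close> one has
  \<open>\<integral> \<eta> |\<nabla>w|\<^sup>2 = \<integral> \<Delta>\<eta> w\<^sup>2 / 2 - \<integral> \<eta> w \<Delta>w\<close>, which tends to \<open>0\<close> because \<open>w\<close> is bounded while \<open>w\<close> and
  \<open>\<Delta>w\<close> tend to \<open>0\<close> in \<open>L\<^sup>1\<^sub>l\<^sub>o\<^sub>c\<close>. This gives \<open>\<Delta>(f\<^sup>2) = 2 f \<Delta>f + 2 |\<nabla>f|\<^sup>2\<close>, and polarization the product rule.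
\<close>

subsection \<open>Smooth functions and test functions\<close>

text \<open>Membership in Z provides no first derivatives in x, and \<Delta>u only as one function;
  yet a test map multiplied by u has the cross term of the two gradients in its Laplacian, which
  must be square integrable. Two facts supply it. The mollified gradients are shown to converge
  strongly in local L2, because a mere bound on them would not let their squares pass to the limit.
  Then <\<Delta>u, u> = - |\<nabla>u|^2 together with |u| = 1 gives |\<nabla>u|^2 \<le> |\<Delta>u|,
  so that the gradient of u is in L4 locally in time, just as the gradients of test maps are. Hence
  u and the test maps lie in one class \<open>tame\<close> that is closed under bounded bilinear
  maps, and compact support in time is all that singles out W in it. The functions
  \<open>dt f\<close>, \<open>dx i f\<close> and \<open>lap f\<close> are arbitrary representatives;
  formulas are therefore proved for \<open>has_jet\<close>, where the derivatives are named, and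
  carried over to the representatives by uniqueness almost everywhere.\<close>

abbreviation pd :: "'a::euclidean_space \<Rightarrow> ('a \<Rightarrow> real) \<Rightarrow> 'a \<Rightarrow> real" where
  "pd b f \<equiv> \<lambda>z. frechet_derivative f (at z) b"

lemma pd_eq: "(f has_derivative f') (at z) \<Longrightarrow> pd b f z = f' b"
  by (drule frechet_derivative_at) simp

lemma has_derivative_frechet:
  "f differentiable (at z) \<Longrightarrow> (f has_derivative frechet_derivative f (at z)) (at z)"
  using frechet_derivative_works by blast

lemma pd_add:
  fixes f g :: "'a::euclidean_space \<Rightarrow> real"
  assumes "f differentiable (at z)" "g differentiable (at z)"
  shows "pd b (\<lambda>z. f z + g z) z = pd b f z + pd b g z"
  by (rule pd_eq[OF has_derivative_add[OF assms[THEN has_derivative_frechet]]])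

lemma pd_mult:
  fixes f g :: "'a::euclidean_space \<Rightarrow> real"
  assumes "f differentiable (at z)" "g differentiable (at z)"
  shows "pd b (\<lambda>z. f z * g z) z = f z * pd b g z + pd b f z * g z"
  by (rule pd_eq[OF has_derivative_mult[OF assms[THEN has_derivative_frechet]]])

lemma pd_cmult:
  fixes f :: "'a::euclidean_space \<Rightarrow> real"
  assumes "f differentiable (at z)"
  shows "pd b (\<lambda>z. c * f z) z = c * pd b f z"
  by (rule pd_eq[OF has_derivative_mult_right[OF has_derivative_frechet[OF assms]]])

text \<open>\<open>C_k (Suc k)\<close> does not mention continuity of the function itself, so the
  levels are not nested by definition; at the bottom, differentiability supplies continuity.\<close>

lemma C_k_SucD: "C_k (Suc k) f \<Longrightarrow> C_k k f"
proof (induction k arbitrary: f)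
  case 0
  then show ?case
    by (auto simp: continuous_on_eq_continuous_at intro: differentiable_imp_continuous_within)
next
  case (Suc k)
  show ?case
    unfolding C_k.simps(2)[of k] using Suc.prems Suc.IH unfolding C_k.simps(2)[of "Suc k"] by blast
qed

lemma C_k_const: "C_k k (\<lambda>z. c)"
proof (induction k arbitrary: c)
  case (Suc k)
  then show ?case by auto
qed simp

lemma C_k_add: "C_k k f \<Longrightarrow> C_k k g \<Longrightarrow> C_k k (\<lambda>z. f z + g z)"
proof (induction k arbitrary: f g)
  case (Suc k)
  then show ?case by (auto simp: pd_add)
qed (auto intro: continuous_intros)

lemma C_k_mult: "C_k k f \<Longrightarrow> C_k k g \<Longrightarrow> C_k k (\<lambda>z. f z * g z)"
proof (induction k arbitrary: f g)
  case (Suc k)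
  have "C_k k f" "C_k k g" using Suc.prems by (auto intro: C_k_SucD simp del: C_k.simps)
  then show ?case using Suc by (auto simp: pd_mult intro!: C_k_add)
qed (auto intro: continuous_intros)

lemma C_k_reflect: "C_k k f \<Longrightarrow> C_k k (\<lambda>y. f (z - y))"
  and pd_reflect: "f differentiable (at (z - y)) \<Longrightarrow> pd b (\<lambda>y. f (z - y)) y = - pd b f (z - y)"
proof -
  have D: "((\<lambda>y. f (z - y)) has_derivative (\<lambda>h. frechet_derivative f (at (z - y)) (0 - h))) (at y)"
    if "f differentiable (at (z - y))" for f :: "'a \<Rightarrow> real" and y
  proof -
    have "((\<lambda>y. z - y) has_derivative (\<lambda>h. 0 - h)) (at y)"
      by (intro has_derivative_diff has_derivative_const has_derivative_ident)
    from has_derivative_compose[OF this, of f, OF has_derivative_frechet[OF that]] show ?thesis .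
  qed
  have P: "pd b (\<lambda>y. f (z - y)) y = - pd b f (z - y)"
    if "f differentiable (at (z - y))" for f :: "'a \<Rightarrow> real" and y b
  proof -
    have "linear (frechet_derivative f (at (z - y)))" using that linear_frechet_derivative by blast
    then show ?thesis using pd_eq[OF D[OF that], of b] by (simp add: linear_neg)
  qed
  show "f differentiable (at (z - y)) \<Longrightarrow> pd b (\<lambda>y. f (z - y)) y = - pd b f (z - y)"
    by (rule P)
  show "C_k k f \<Longrightarrow> C_k k (\<lambda>y. f (z - y))"
  proof (induction k arbitrary: f)
    case 0
    then show ?case by (auto intro!: continuous_intros continuous_on_compose2[of UNIV f])
  next
    case (Suc k)
    then have d: "f differentiable (at y)" for y by auto
    have "(\<lambda>y. f (z - y)) differentiable (at y)" for y
      using D[OF d] differentiable_def by blast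
    moreover have "C_k k (\<lambda>y. - 1 * pd b f (z - y))" if "b \<in> Basis" for b
      using Suc that by (intro C_k_mult C_k_const Suc.IH[of "pd b f"]) auto
    ultimately show ?case using P[OF d] by (simp add: d)
  qed
qed

definition smooth :: "('a::euclidean_space \<Rightarrow> real) \<Rightarrow> bool" where
  "smooth f \<longleftrightarrow> (\<forall>k. C_k k f)"

lemma smooth_differentiable: "smooth f \<Longrightarrow> f differentiable (at z)"
  using C_k.simps(2)[of 0 f] by (auto simp: smooth_def)

lemma smooth_continuous: "smooth f \<Longrightarrow> continuous_on S f"
  using C_k.simps(1)[of f] by (auto simp: smooth_def intro: continuous_on_subset)

lemma smooth_pd: "smooth f \<Longrightarrow> b \<in> Basis \<Longrightarrow> smooth (pd b f)"
  unfolding smooth_def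
  by (intro allI) (use C_k.simps(2)[of _ f] in blast)

lemma smooth_const: "smooth (\<lambda>z. c)" by (simp add: smooth_def C_k_const)
lemma smooth_add: "smooth f \<Longrightarrow> smooth g \<Longrightarrow> smooth (\<lambda>z. f z + g z)"
  by (simp add: smooth_def C_k_add)
lemma smooth_mult: "smooth f \<Longrightarrow> smooth g \<Longrightarrow> smooth (\<lambda>z. f z * g z)"
  by (simp add: smooth_def C_k_mult)
lemma smooth_reflect: "smooth f \<Longrightarrow> smooth (\<lambda>y. f (z - y))"
  by (simp add: smooth_def C_k_reflect)
lemma smooth_diff: "smooth f \<Longrightarrow> smooth g \<Longrightarrow> smooth (\<lambda>z. f z - g z)"
  using smooth_add[of f "\<lambda>z. - 1 * g z"] smooth_mult[OF smooth_const, of g "-1"] by simp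
lemma smooth_power: "smooth f \<Longrightarrow> smooth (\<lambda>z. f z ^ k)"
  by (induction k) (auto intro: smooth_const smooth_mult)
lemma smooth_sum: "(\<And>i. i \<in> I \<Longrightarrow> smooth (f i)) \<Longrightarrow> smooth (\<lambda>z. \<Sum>i\<in>I. f i z)"
  by (induction I rule: infinite_finite_induct) (auto intro: smooth_const smooth_add)

lemma smooth_inner: "smooth (\<lambda>z. z \<bullet> c)"
proof -
  have D: "((\<lambda>z. z \<bullet> c) has_derivative (\<lambda>h. h \<bullet> c)) (at z)" for z
    by (auto intro!: derivative_eq_intros)
  have "C_k k (\<lambda>z. z \<bullet> c)" for k
  proof (cases k)
    case 0 then show ?thesis by (auto intro!: continuous_intros)
  next
    case (Suc j)
    have "pd b (\<lambda>z. z \<bullet> c) = (\<lambda>z. b \<bullet> c)" for b using pd_eq[OF D] by auto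
    then show ?thesis using Suc D by (auto simp: C_k_const differentiable_def)
  qed
  then show ?thesis by (simp add: smooth_def)
qed

lemma smooth_norm_sq: "smooth (\<lambda>z::'a::euclidean_space. (norm z)\<^sup>2)"
proof -
  have "(\<lambda>z::'a. (norm z)\<^sup>2) = (\<lambda>z. \<Sum>b\<in>Basis. (z \<bullet> b)^2)"
    unfolding power2_norm_eq_inner by (intro ext, subst euclidean_inner) (simp add: power2_eq_square)
  then show ?thesis by (auto intro!: smooth_sum smooth_power smooth_inner)
qed

text \<open>The flat functions \<open>x\<^sup>-\<^sup>k exp (-1/x)\<close> are closed under differentiation up to linear
  combinations, which gives their smoothness by induction on the order.\<close>

definition flat :: "nat \<Rightarrow> real \<Rightarrow> real" where
  "flat k x = (if x > 0 then inverse x ^ k * exp (- inverse x) else 0)"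

text \<open>From the right, y = 1/x turns the claim into the decay of \<open>y ^ k / exp y\<close>
  at infinity; from the left the function is zero.\<close>

lemma flat_tendsto_0: "(flat k \<longlongrightarrow> 0) (at 0)"
proof -
  have "((\<lambda>y. y ^ k / exp y) \<longlongrightarrow> (0::real)) at_top" by (rule tendsto_power_div_exp_0)
  then have "((\<lambda>x. inverse x ^ k / exp (inverse x)) \<longlongrightarrow> (0::real)) (at_right 0)"
    by (rule filterlim_compose) (rule filterlim_inverse_at_top_right)
  then have R: "(flat k \<longlongrightarrow> 0) (at_right 0)"
    by (rule Lim_transform_eventually)
       (auto simp: flat_def exp_minus divide_inverse eventually_at_filter)
  have L: "(flat k \<longlongrightarrow> 0) (at_left 0)"
    by (rule Lim_transform_eventually[OF tendsto_const])
       (auto simp: flat_def eventually_at_filter)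
  show ?thesis using L R filterlim_split_at by blast
qed

lemma flat_has_deriv: "(flat k has_real_derivative (- real k * flat (Suc k) x + flat (k + 2) x)) (at x)"
proof -
  consider "x > 0" | "x < 0" | "x = 0" by linarith
  then show ?thesis
  proof cases
    case 1
    have "((\<lambda>x. inverse x ^ k * exp (- inverse x)) has_real_derivative
       (- real k * flat (Suc k) x + flat (k + 2) x)) (at x)"
    proof -
      have "((\<lambda>x. inverse x ^ k) has_real_derivative - real k * inverse x ^ Suc k) (at x)"
      proof (cases k)
        case (Suc m)
        have "(inverse has_real_derivative - (inverse x ^ 2)) (at x)"
          using DERIV_inverse[of x UNIV] 1 by (simp add: numeral_2_eq_2)
        from DERIV_power[OF this, of k] show ?thesis
          by (simp add: Suc power2_eq_square algebra_simps)
      qed simp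
      then have "((\<lambda>x. inverse x ^ k * exp (- inverse x)) has_real_derivative
         (- real k * inverse x ^ Suc k) * exp (- inverse x)
           + (exp (- inverse x) * (inverse x ^ 2)) * inverse x ^ k) (at x)"
        using 1 by (intro DERIV_mult) (auto intro!: derivative_eq_intros simp: power2_eq_square)
      then show ?thesis using 1 by (simp add: flat_def power_add power2_eq_square mult_ac)
    qed
    then show ?thesis
      by (rule has_field_derivative_transform_within_open[of _ _ _ "{0<..}"])
         (use 1 in \<open>auto simp: flat_def\<close>)
  next
    case 2
    have "((\<lambda>x. 0) has_real_derivative (- real k * flat (Suc k) x + flat (k + 2) x)) (at x)"
      using 2 by (auto simp: flat_def)
    then show ?thesis
      by (rule has_field_derivative_transform_within_open[of _ _ _ "{..<0}"])
         (use 2 in \<open>auto simp: flat_def\<close>)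
  next
    case 3
    \<comment> \<open>At the origin the difference quotient is itself flat, with exponent one
      higher; at y = 0 both sides are 0 because division by zero gives 0.\<close>
    have "(\<lambda>y. (flat k y - flat k 0) / (y - 0)) = flat (Suc k)"
      by (auto simp: flat_def fun_eq_iff field_simps)
    then have "(flat k has_real_derivative 0) (at 0)"
      unfolding has_field_derivative_iff using flat_tendsto_0[of "Suc k"] by simp
    then show ?thesis using 3 by (simp add: flat_def)
  qed
qed

lemma smooth_flat:
  assumes p: "smooth p"
  shows "smooth (\<lambda>z. flat j (p z))"
proof -
  have "C_k k (\<lambda>z. flat j (p z))" for k
  proof (induction k arbitrary: j)
    case 0
    have "continuous_on UNIV (flat j)"
      by (intro continuous_at_imp_continuous_on ballI DERIV_isCont[OF flat_has_deriv])
    then show ?case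
      using continuous_on_compose2[OF _ smooth_continuous[OF p]] by auto
  next
    case (Suc k)
    have D: "((\<lambda>z. flat j (p z)) has_derivative
        (\<lambda>h. (- real j * flat (Suc j) (p z) + flat (j + 2) (p z)) * frechet_derivative p (at z) h)) (at z)" for z
    proof -
      have "(flat j has_derivative (*) (- real j * flat (Suc j) (p z) + flat (j + 2) (p z))) (at (p z))"
        using flat_has_deriv by (simp only: has_field_derivative_def)
      from has_derivative_compose[OF has_derivative_frechet[OF smooth_differentiable[OF p]] this]
      show ?thesis .
    qed
    have "pd b (\<lambda>z. flat j (p z)) =
        (\<lambda>z. (- real j * flat (Suc j) (p z) + flat (j + 2) (p z)) * pd b p z)" for b
      using pd_eq[OF D] by auto
    moreover have "C_k k (pd b p)" if "b \<in> Basis" for b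
      using smooth_pd[OF p that] by (simp add: smooth_def)
    moreover have "C_k k (\<lambda>z. - real j * flat (Suc j) (p z) + flat (j + 2) (p z))"
      by (intro C_k_add C_k_mult C_k_const Suc)
    moreover have "(\<lambda>z. flat j (p z)) differentiable (at z)" for z
      using D differentiable_def by blast
    ultimately show ?case by (simp add: C_k_mult)
  qed
  then show ?thesis by (simp add: smooth_def)
qed

text \<open>Vanishing beyond a radius is easier to carry through sums, products and reflections than
  compactness of the closed support.\<close>

lemma test_fun_iff: "test_fun \<eta> \<longleftrightarrow> smooth \<eta> \<and> (\<exists>R. \<forall>z. R < norm z \<longrightarrow> \<eta> z = 0)"
proof -
  have "compact (closure {z. \<eta> z \<noteq> 0}) \<longleftrightarrow> (\<exists>R. \<forall>z. R < norm z \<longrightarrow> \<eta> z = 0)"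
    unfolding compact_closure bounded_iff by (metis (mono_tags, lifting) mem_Collect_eq not_le)
  then show ?thesis by (auto simp: test_fun_def smooth_def)
qed

lemma test_fun_smooth: "test_fun \<eta> \<Longrightarrow> smooth \<eta>" by (simp add: test_fun_iff)

lemma pd_eq_0:
  assumes "open S" "z \<in> S" "\<And>y. y \<in> S \<Longrightarrow> f y = 0"
  shows "pd b f z = 0"
proof -
  have "(f has_derivative (\<lambda>h. 0)) (at z)"
    using assms by (intro has_derivative_transform_within_open[OF has_derivative_const[of 0]]) auto
  then show ?thesis by (rule pd_eq)
qed

lemma pd_outside: 
  assumes "\<forall>z. R < norm z \<longrightarrow> f z = 0" "R < norm z"
  shows "pd b f z = 0"
proof (rule pd_eq_0)
  show "open {z::'a. R < norm z}" by (intro open_Collect_less continuous_intros)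
qed (use assms in auto)

lemma test_fun_pd:
  assumes "test_fun \<eta>" "b \<in> Basis"
  shows "test_fun (pd b \<eta>)"
proof -
  obtain R where R: "\<forall>z. R < norm z \<longrightarrow> \<eta> z = 0"
    using assms by (auto simp: test_fun_iff)
  then have "\<exists>R. \<forall>z. R < norm z \<longrightarrow> pd b \<eta> z = 0" using pd_outside[OF R] by blast
  then show ?thesis using smooth_pd[OF test_fun_smooth assms(2)] assms(1) by (simp add: test_fun_iff)
qed

lemma test_fun_mult: "test_fun \<eta> \<Longrightarrow> smooth f \<Longrightarrow> test_fun (\<lambda>z. \<eta> z * f z)"
  by (simp add: test_fun_iff smooth_mult) (metis mult_zero_left)

lemma test_fun_add:
  assumes "test_fun \<eta>" "test_fun \<theta>"
  shows "test_fun (\<lambda>z. \<eta> z + \<theta> z)"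
proof -
  obtain R R' where "\<forall>z. R < norm z \<longrightarrow> \<eta> z = 0" "\<forall>z. R' < norm z \<longrightarrow> \<theta> z = 0"
    using assms by (auto simp: test_fun_iff)
  then have "\<forall>z. max R R' < norm z \<longrightarrow> \<eta> z + \<theta> z = 0" by auto
  then have "\<exists>R. \<forall>y. R < norm y \<longrightarrow> \<eta> y + \<theta> y = 0" by blast
  then show ?thesis using smooth_add[OF assms[THEN test_fun_smooth]] by (simp add: test_fun_iff)
qed

text \<open>The kernel of a convolution, as a function of the integration variable, thereby becomes
  admissible in weak identities. This is how weak derivatives and Laplacians commute with
  mollification.\<close>

lemma test_fun_reflect:
  assumes "test_fun \<eta>"
  shows "test_fun (\<lambda>y. \<eta> (z - y))"
proof -
  obtain R where R: "\<forall>z. R < norm z \<longrightarrow> \<eta> z = 0"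
    using assms by (auto simp: test_fun_iff)
  have "\<eta> (z - y) = 0" if "norm z + R < norm y" for y
    using R that norm_triangle_ineq2[of y z] by (simp add: norm_minus_commute)
  then have "\<exists>R. \<forall>y. R < norm y \<longrightarrow> \<eta> (z - y) = 0" by blast
  then show ?thesis using smooth_reflect[OF test_fun_smooth[OF assms]] by (simp add: test_fun_iff)
qed

lemma test_fun_0: "test_fun (\<lambda>z. 0)" by (simp add: test_fun_iff smooth_const)

lemma test_fun_sum: "(\<And>i. i \<in> I \<Longrightarrow> test_fun (f i)) \<Longrightarrow> test_fun (\<lambda>z. \<Sum>i\<in>I. f i z)"
  by (induction I rule: infinite_finite_induct) (auto intro: test_fun_0 test_fun_add)

text \<open>The argument of \<open>flat\<close> is positive exactly inside the ball. The norm is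
  squared because the norm itself is not differentiable at the origin.\<close>

lemma test_fun_bump:
  assumes "r > 0"
  shows "test_fun (\<lambda>z. flat 0 (r\<^sup>2 - (norm z)\<^sup>2))"
proof -
  have "flat 0 (r\<^sup>2 - (norm z)\<^sup>2) = 0" if "r < norm z" for z :: 'a
  proof -
    have "r\<^sup>2 < (norm z)\<^sup>2" using that assms by (simp add: power_strict_mono)
    then show ?thesis by (simp add: flat_def)
  qed
  then show ?thesis
    unfolding test_fun_iff
    by (intro conjI smooth_flat[of "\<lambda>z. r\<^sup>2 - (norm z)\<^sup>2"] smooth_diff smooth_const smooth_norm_sq) blast
qed

lemma test_fun_bounded:
  assumes "test_fun \<eta>"
  obtains M where "M > 0" "\<And>z. \<bar>\<eta> z\<bar> \<le> M"
proof -
  obtain R where R: "\<And>z. R < norm z \<Longrightarrow> \<eta> z = 0"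
    using assms by (auto simp: test_fun_iff)
  have "bounded (\<eta> ` cball 0 R)"
    using smooth_continuous[OF test_fun_smooth[OF assms]] compact_continuous_image compact_imp_bounded compact_cball by blast
  then obtain M where M: "M > 0" "\<forall>x\<in>cball 0 R. \<bar>\<eta> x\<bar> \<le> M" unfolding bounded_pos by auto
  have "\<bar>\<eta> z\<bar> \<le> M" for z using M R[of z] by (cases "norm z \<le> R") auto
  with M(1) show ?thesis using that by blast
qed

subsection \<open>Convolution\<close>

lemma loc_integrable_iff:
  "loc_integrable f \<longleftrightarrow> (\<forall>R. integrable lborel (\<lambda>z. indicator (cball 0 R) z *\<^sub>R f z))"
proof
  assume R: "\<forall>R. integrable lborel (\<lambda>z. indicator (cball 0 R) z *\<^sub>R f z)"
  show "loc_integrable f" unfolding loc_integrable_def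
  proof (intro allI impI)
    fix K :: "'a set" assume K: "compact K"
    then obtain R where "K \<subseteq> cball 0 R"
      by (meson bounded_subset_ballD ball_subset_cball compact_imp_bounded subset_trans)
    moreover have "set_integrable lborel (cball 0 R) f" using R by (simp add: set_integrable_def)
    ultimately show "set_integrable lborel K f"
      using K by (intro set_integrable_subset[of lborel "cball 0 R" f K]) (auto intro: borel_compact)
  qed
qed (auto simp: loc_integrable_def set_integrable_def)

lemma loc_integrable_cball:
  "loc_integrable f \<Longrightarrow> integrable lborel (\<lambda>z. indicator (cball 0 R) z *\<^sub>R f z)"
  by (simp add: loc_integrable_iff)

text \<open>The function is the pointwise limit of its truncations to balls of integer radius, each
  of which is integrable.\<close>

lemma loc_integrable_measurable [measurable_dest]:
  assumes "loc_integrable f"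
  shows "f \<in> borel_measurable borel"
proof -
  have "(\<lambda>z. indicator (cball 0 (real n)) z *\<^sub>R f z) \<in> borel_measurable borel" for n
    using borel_measurable_integrable[OF loc_integrable_cball[OF assms]] by simp
  moreover have "(\<lambda>n. indicator (cball 0 (real n)) z *\<^sub>R f z) \<longlonglongrightarrow> f z" for z
  proof (rule tendsto_eventually)
    obtain N where "norm z \<le> real N" using real_arch_simple by blast
    then show "\<forall>\<^sub>F n in sequentially. indicator (cball 0 (real n)) z *\<^sub>R f z = f z"
      by (intro eventually_sequentiallyI[of N]) auto
  qed
  ultimately show ?thesis by (rule borel_measurable_LIMSEQ_metric)
qed

lemma loc_integrable_bound:
  fixes f :: "'a::euclidean_space \<Rightarrow> 'b::euclidean_space" and g :: "'a \<Rightarrow> 'c::euclidean_space"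
  assumes "loc_integrable g" "f \<in> borel_measurable borel" "AE z in lborel. norm (f z) \<le> norm (g z)"
  shows "loc_integrable f"
  unfolding loc_integrable_iff
proof
  fix R
  show "integrable lborel (\<lambda>z. indicator (cball 0 R) z *\<^sub>R f z)"
    using loc_integrable_cball[OF assms(1), of R]
  proof (rule Bochner_Integration.integrable_bound)
    show "AE z in lborel. norm (indicator (cball 0 R) z *\<^sub>R f z) \<le> norm (indicator (cball 0 R) z *\<^sub>R g z)"
      using assms(3) by eventually_elim (simp add: mult_left_mono)
  qed (use assms in \<open>auto intro!: borel_measurable_scaleR borel_measurable_indicator\<close>)
qed

lemma loc_integrable_cong_AE:
  assumes "loc_integrable g" "f \<in> borel_measurable borel" "AE z in lborel. f z = g z"
  shows "loc_integrable f"
  using assms by (intro loc_integrable_bound[OF assms(1,2)]) auto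

lemma loc_integrable_continuous:
  fixes f :: "'a::euclidean_space \<Rightarrow> 'b::euclidean_space"
  assumes "continuous_on UNIV f"
  shows "loc_integrable f"
  unfolding loc_integrable_def set_integrable_def
  using assms by (auto intro!: borel_integrable_compact continuous_on_subset[OF assms])

lemma loc_integrable_const: "loc_integrable (\<lambda>z. c)"
  by (rule loc_integrable_continuous) auto

lemma loc_integrable_add:
  "loc_integrable f \<Longrightarrow> loc_integrable g \<Longrightarrow> loc_integrable (\<lambda>z. f z + g z)"
  unfolding loc_integrable_iff by (simp add: scaleR_add_right)

lemma loc_integrable_linear:
  assumes "bounded_linear L" "loc_integrable f"
  shows "loc_integrable (\<lambda>z. L (f z))"
proof -
  interpret bounded_linear L by fact
  show ?thesis
    using integrable_bounded_linear[OF assms(1) loc_integrable_cball[OF assms(2)]]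
    by (simp add: loc_integrable_iff scaleR)
qed

lemma loc_integrable_cmult:
  fixes f :: "'a::euclidean_space \<Rightarrow> real"
  shows "loc_integrable f \<Longrightarrow> loc_integrable (\<lambda>z. c * f z)"
  by (rule loc_integrable_linear[OF bounded_linear_mult_right])

lemma loc_integrable_mult_bounded:
  fixes f g :: "'a::euclidean_space \<Rightarrow> real"
  assumes "loc_integrable g" "f \<in> borel_measurable borel" "AE z in lborel. \<bar>f z\<bar> \<le> C"
  shows "loc_integrable (\<lambda>z. f z * g z)"
proof (rule loc_integrable_bound[OF loc_integrable_cmult[OF assms(1), of C]])
  show "AE z in lborel. norm (f z * g z) \<le> norm (C * g z)"
    using assms(3) by eventually_elim (auto simp: abs_mult intro!: mult_right_mono)
qed (use assms in measurable)

lemma integrable_bounded_support: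
  fixes f :: "'a::euclidean_space \<Rightarrow> 'b::euclidean_space"
  assumes "loc_integrable f" "\<phi> \<in> borel_measurable borel" "\<And>z. \<bar>\<phi> z\<bar> \<le> M"
    "\<And>z. R < norm z \<Longrightarrow> \<phi> z = 0"
  shows "integrable lborel (\<lambda>z. \<phi> z *\<^sub>R f z)"
proof (rule Bochner_Integration.integrable_bound)
  show "integrable lborel (\<lambda>z. M *\<^sub>R (indicator (cball 0 R) z *\<^sub>R f z))"
    by (intro integrable_scaleR_right loc_integrable_cball assms)
  show "AE z in lborel. norm (\<phi> z *\<^sub>R f z) \<le> norm (M *\<^sub>R (indicator (cball 0 R) z *\<^sub>R f z))"
  proof (intro AE_I2)
    fix z
    have "\<bar>\<phi> z\<bar> \<le> \<bar>M\<bar> * indicator (cball 0 R) z"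
      using assms(3)[of z] assms(4)[of z] by (auto simp: indicator_def)
    then show "norm (\<phi> z *\<^sub>R f z) \<le> norm (M *\<^sub>R (indicator (cball 0 R) z *\<^sub>R f z))"
      by (simp add: mult.assoc[symmetric] mult_right_mono)
  qed
qed (use assms in measurable)

lemma smooth_measurable [measurable_dest]: "smooth \<eta> \<Longrightarrow> \<eta> \<in> borel_measurable borel"
  by (simp add: borel_measurable_continuous_onI smooth_continuous)

lemma test_fun_measurable [measurable_dest]: "test_fun \<eta> \<Longrightarrow> \<eta> \<in> borel_measurable borel"
  by (rule smooth_measurable[OF test_fun_smooth])

lemma test_fun_bounds:
  assumes "test_fun \<eta>"
  obtains M R where "M > 0" "R > 0" "\<And>z. \<bar>\<eta> z\<bar> \<le> M * indicator (cball 0 R) z"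
proof -
  obtain M where M: "M > 0" "\<And>z. \<bar>\<eta> z\<bar> \<le> M" by (rule test_fun_bounded[OF assms]) blast
  obtain R where R: "\<And>z. R < norm z \<Longrightarrow> \<eta> z = 0" using assms by (auto simp: test_fun_iff)
  have "\<bar>\<eta> z\<bar> \<le> M * indicator (cball 0 (max R 1)) z" for z
    using M(2)[of z] R[of z] by (auto simp: indicator_def)
  then show ?thesis using that[of M "max R 1"] M(1) by auto
qed

lemma integrable_test:
  fixes f :: "'a::euclidean_space \<Rightarrow> 'b::euclidean_space"
  assumes "test_fun \<eta>" "loc_integrable f"
  shows "integrable lborel (\<lambda>z. \<eta> z *\<^sub>R f z)"
proof -
  obtain M where M: "\<And>z. \<bar>\<eta> z\<bar> \<le> M" by (rule test_fun_bounded[OF assms(1)]) blast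
  obtain R where "\<And>z. R < norm z \<Longrightarrow> \<eta> z = 0" using assms by (auto simp: test_fun_iff)
  then show ?thesis
    by (rule integrable_bounded_support[OF assms(2) test_fun_measurable[OF assms(1)] M])
qed

lemma integrable_test_real:
  fixes f :: "'a::euclidean_space \<Rightarrow> real"
  shows "test_fun \<eta> \<Longrightarrow> loc_integrable f \<Longrightarrow> integrable lborel (\<lambda>z. \<eta> z * f z)"
  using integrable_test[of \<eta> f] by simp

lemma integrable_test_fun: "test_fun \<eta> \<Longrightarrow> integrable lborel \<eta>"
  using integrable_test_real[OF _ loc_integrable_const[of 1]] by simp

text \<open>A normalised bump. Its integral is positive because the bump is positive on a ball,
  which has positive measure.\<close>

lemma mollifier_exists:
  assumes "r > 0"
  obtains \<rho> :: "'a::euclidean_space \<Rightarrow> real" where "test_fun \<rho>" "\<And>z. \<rho> z \<ge> 0"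
    "\<And>z. r < norm z \<Longrightarrow> \<rho> z = 0" "(LBINT z. \<rho> z) = 1"
proof -
  define \<beta> where "\<beta> = (\<lambda>z::'a. flat 0 (r\<^sup>2 - (norm z)\<^sup>2))"
  have t: "test_fun \<beta>" unfolding \<beta>_def using assms by (rule test_fun_bump)
  have i: "integrable lborel \<beta>" by (rule integrable_test_fun[OF t])
  have n: "\<beta> z \<ge> 0" for z by (simp add: \<beta>_def flat_def)
  have p: "\<beta> z > 0 \<longleftrightarrow> norm z < r" for z
  proof -
    have "(norm z)\<^sup>2 < r\<^sup>2 \<longleftrightarrow> norm z < r"
      using assms power2_less_imp_less[of "norm z" r] power_strict_mono[of "norm z" r 2] by auto
    then show ?thesis by (simp add: \<beta>_def flat_def)
  qed
  have "(LBINT z. \<beta> z) \<noteq> 0"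
  proof
    assume "(LBINT z. \<beta> z) = 0"
    then have "AE z in lborel. \<beta> z = 0"
      using integral_nonneg_eq_0_iff_AE[OF i] n by simp
    then have "AE z in lborel. (z::'a) \<notin> ball 0 r"
      by eventually_elim (use p in \<open>auto simp: less_le\<close>)
    then have "emeasure lborel (ball (0::'a) r) = 0"
      using AE_iff_measurable[of "ball (0::'a) r" lborel "\<lambda>z. z \<notin> ball 0 r"] by (simp add: ball_def)
    moreover have "emeasure lborel (ball (0::'a) r) > 0"
      using assms by (simp add: emeasure_ball unit_ball_vol_pos)
    ultimately show False by simp
  qed
  moreover have "(LBINT z. \<beta> z) \<ge> 0" by (rule integral_nonneg_AE) (use n in auto)
  ultimately have c: "(LBINT z. \<beta> z) > 0" by simp
  define c where "c = inverse (LBINT z. \<beta> z)"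
  have "test_fun (\<lambda>z. \<beta> z * c)" by (rule test_fun_mult[OF t smooth_const])
  moreover have "\<beta> z * c \<ge> 0" for z using n c by (simp add: c_def)
  moreover have "\<beta> z * c = 0" if "r < norm z" for z
    using p[of z] n[of z] that by auto
  moreover have "(LBINT z. \<beta> z * c) = 1" using c by (simp add: c_def)
  ultimately show ?thesis using that[of "\<lambda>z. \<beta> z * c"] by blast
qed

section \<open>Convolution with test functions and its derivatives\<close>

definition conv :: "('a::euclidean_space \<Rightarrow> real) \<Rightarrow> ('a \<Rightarrow> real) \<Rightarrow> 'a \<Rightarrow> real" where
  "conv \<rho> f z = (LBINT y. \<rho> (z - y) * f y)"

lemma conv_integrable:
  "test_fun \<rho> \<Longrightarrow> loc_integrable f \<Longrightarrow> integrable lborel (\<lambda>y. \<rho> (z - y) * f y)"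
  by (rule integrable_test_real[OF test_fun_reflect])

lemma frechet_basis:
  fixes f :: "'a::euclidean_space \<Rightarrow> real"
  assumes "f differentiable (at z)"
  shows "frechet_derivative f (at z) h = (\<Sum>b\<in>Basis. (h \<bullet> b) * pd b f z)"
proof -
  have l: "linear (frechet_derivative f (at z))" by (rule linear_frechet_derivative[OF assms])
  have "frechet_derivative f (at z) h = frechet_derivative f (at z) (\<Sum>b\<in>Basis. (h \<bullet> b) *\<^sub>R b)"
    unfolding euclidean_representation ..
  also have "\<dots> = (\<Sum>b\<in>Basis. (h \<bullet> b) * pd b f z)"
    unfolding linear_sum[OF l] linear_cmul[OF l] real_scaleR_def ..
  finally show ?thesis .
qed

text \<open>Provides the bound on the difference quotients of the kernel, uniform in the point, that
  dominated convergence requires when a convolution is differentiated.\<close>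

lemma test_fun_lipschitz:
  fixes \<rho> :: "'a::euclidean_space \<Rightarrow> real"
  assumes "test_fun \<rho>"
  obtains L where "L > 0" "\<And>x h. \<bar>frechet_derivative \<rho> (at x) h\<bar> \<le> L * norm h"
    "\<And>x y. \<bar>\<rho> x - \<rho> y\<bar> \<le> L * norm (x - y)"
proof -
  have "\<exists>M. \<forall>z. \<bar>pd b \<rho> z\<bar> \<le> M \<and> M > 0" if "b \<in> Basis" for b
    using test_fun_bounded[OF test_fun_pd[OF assms that]] by metis
  then obtain M where M: "\<And>b z. b \<in> Basis \<Longrightarrow> \<bar>pd b \<rho> z\<bar> \<le> M b" "\<And>b. b \<in> Basis \<Longrightarrow> M b > 0"
    by metis
  define L where "L = (\<Sum>b\<in>Basis. M b)"
  have d: "\<rho> differentiable (at x)" for x by (rule smooth_differentiable[OF test_fun_smooth[OF assms]])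
  have B: "\<bar>frechet_derivative \<rho> (at x) h\<bar> \<le> L * norm h" for x h
  proof -
    have "\<bar>frechet_derivative \<rho> (at x) h\<bar> \<le> (\<Sum>b\<in>Basis. \<bar>(h \<bullet> b) * pd b \<rho> x\<bar>)"
      by (subst frechet_basis[OF d]) (rule sum_abs)
    also have "\<dots> \<le> (\<Sum>b\<in>Basis. M b * norm h)"
      by (rule sum_mono) (auto simp: abs_mult mult.commute[of "M _"] intro!: mult_mono M Basis_le_norm)
    finally show ?thesis by (simp add: L_def sum_distrib_right)
  qed
  have "\<bar>\<rho> x - \<rho> y\<bar> \<le> L * norm (x - y)" for x y
  proof -
    have "norm (\<rho> x - \<rho> y) \<le> L * norm (x - y)"
      by (rule differentiable_bound[where f' = "\<lambda>x. frechet_derivative \<rho> (at x)" and S = UNIV])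
         (use B in \<open>auto intro!: has_derivative_frechet d onorm_le\<close>)
    then show ?thesis by simp
  qed
  moreover have "L > 0" unfolding L_def by (rule sum_pos) (use M in auto)
  ultimately show ?thesis using that B by blast
qed

text \<open>Differentiation under the integral sign. The normalised remainder \<open>q\<close> of
  the kernel tends to 0 at each point and is bounded on a fixed ball, so |f| on that ball, times a
  constant, dominates.\<close>

lemma conv_has_derivative:
  fixes f :: "'a::euclidean_space \<Rightarrow> real"
  assumes \<rho>: "test_fun \<rho>" and f: "loc_integrable f"
  shows "(conv \<rho> f has_derivative (\<lambda>h. \<Sum>b\<in>Basis. (h \<bullet> b) * conv (pd b \<rho>) f z)) (at z)"
proof -
  obtain L where L: "L > 0" "\<And>x h. \<bar>frechet_derivative \<rho> (at x) h\<bar> \<le> L * norm h"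
    "\<And>x y. \<bar>\<rho> x - \<rho> y\<bar> \<le> L * norm (x - y)" by (rule test_fun_lipschitz[OF \<rho>]) blast
  obtain R where R: "\<forall>z. R < norm z \<longrightarrow> \<rho> z = 0" using \<rho> by (auto simp: test_fun_iff)
  have d: "\<rho> differentiable (at x)" for x by (rule smooth_differentiable[OF test_fun_smooth[OF \<rho>]])
  define D where "D = (\<lambda>y h. frechet_derivative \<rho> (at (z - y)) h)"
  define Lh where "Lh = (\<lambda>h. \<Sum>b\<in>Basis. (h \<bullet> b) * conv (pd b \<rho>) f z)"
  have Di: "integrable lborel (\<lambda>y. D y h * f y)" and Lh: "Lh h = (LBINT y. D y h * f y)" for h
  proof -
    have i: "integrable lborel (\<lambda>y. (h \<bullet> b) * (pd b \<rho> (z - y) * f y))" if "b \<in> Basis" for b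
      using conv_integrable[OF test_fun_pd[OF \<rho> that] f] by simp
    have e: "D y h * f y = (\<Sum>b\<in>Basis. (h \<bullet> b) * (pd b \<rho> (z - y) * f y))" for y
      unfolding D_def by (subst frechet_basis[OF d]) (simp add: sum_distrib_right mult.assoc)
    show "integrable lborel (\<lambda>y. D y h * f y)"
      unfolding e by (intro Bochner_Integration.integrable_sum i)
    show "Lh h = (LBINT y. D y h * f y)"
      unfolding e Lh_def conv_def
      by (subst Bochner_Integration.integral_sum[OF i]) auto
  qed
  define q where "q = (\<lambda>h y. (\<rho> (z + h - y) - \<rho> (z - y) - D y h) / norm h)"
  \<comment> \<open>The increment and the linear term contribute \<open>L * norm h\<close> each,
    hence the 2. For |h| \<le> 1 everything vanishes once |y| exceeds |z| + R + 1.\<close>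
  have qb: "\<bar>q h y\<bar> \<le> 2 * L * indicator (cball 0 (norm z + R + 1)) y" if "h \<noteq> 0" "norm h \<le> 1" for h y
  proof (cases "norm y \<le> norm z + R + 1")
    case True
    have "\<bar>\<rho> (z + h - y) - \<rho> (z - y) - D y h\<bar> \<le> \<bar>\<rho> (z + h - y) - \<rho> (z - y)\<bar> + \<bar>D y h\<bar>" by simp
    also have "\<dots> \<le> L * norm h + L * norm h"
      using L(2)[of "z - y" h] L(3)[of "z + h - y" "z - y"] by (simp add: D_def)
    finally show ?thesis using that True by (simp add: q_def divide_le_eq)
  next
    case False
    have "R < norm (z - y)" using False norm_triangle_ineq2[of y z] by (simp add: norm_minus_commute)
    moreover have "R < norm (z + h - y)"
      using False that norm_triangle_ineq2[of y "z + h"] norm_triangle_ineq[of z h] by (simp add: norm_minus_commute)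
    ultimately have "\<rho> (z + h - y) = 0" "\<rho> (z - y) = 0" "D y h = 0"
      using R pd_outside[OF R] by (auto simp: D_def)
    then show ?thesis using L(1) by (simp add: q_def)
  qed
  have fm [measurable]: "f \<in> borel_measurable borel" using f by measurable
  have lim: "((\<lambda>h. (conv \<rho> f (z + h) - conv \<rho> f z - Lh h) / norm h) \<longlongrightarrow> 0) (at 0)"
    unfolding tendsto_at_iff_sequentially comp_def
  proof (intro allI impI)
    fix X :: "nat \<Rightarrow> 'a"
    assume X: "\<forall>i. X i \<in> UNIV - {0}" and X0: "X \<longlonglongrightarrow> 0"
    obtain N where N: "\<And>n. n \<ge> N \<Longrightarrow> norm (X n) \<le> 1"
      using X0 unfolding LIMSEQ_iff by (metis diff_zero less_eq_real_def zero_less_one)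
    \<comment> \<open>Dropping the first N members makes |Y n| \<le> 1 hold for all n, as the
      dominating bound demands.\<close>
    define Y where "Y = (\<lambda>n. X (n + N))"
    have Y0: "Y \<longlonglongrightarrow> 0" unfolding Y_def by (rule LIMSEQ_ignore_initial_segment[OF X0])
    have Y: "Y n \<noteq> 0" "norm (Y n) \<le> 1" for n using X N by (auto simp: Y_def)
    have e: "(conv \<rho> f (z + Y n) - conv \<rho> f z - Lh (Y n)) / norm (Y n)
      = (LBINT y. q (Y n) y * f y)" for n
    proof -
      have "conv \<rho> f (z + Y n) - conv \<rho> f z - Lh (Y n) =
         (LBINT y. \<rho> (z + Y n - y) * f y - \<rho> (z - y) * f y - D y (Y n) * f y)"
        unfolding conv_def Lh using conv_integrable[OF \<rho> f] Di by simp
      then show ?thesis by (simp add: q_def algebra_simps diff_divide_distrib flip: integral_divide_zero)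
    qed
    have "(\<lambda>n. LBINT y. q (Y n) y * f y) \<longlonglongrightarrow> (\<integral>y. 0 \<partial>(lborel::'a measure))"
    proof (rule integral_dominated_convergence)
      show "integrable lborel (\<lambda>y. 2 * L * norm (indicator (cball 0 (norm z + R + 1)) y *\<^sub>R f y))"
        by (intro integrable_mult_right integrable_norm loc_integrable_cball f)
      show "(\<lambda>y. q (Y n) y * f y) \<in> borel_measurable lborel" for n
      proof -
        have "(\<lambda>y. q (Y n) y * f y) = (\<lambda>y. (\<rho> (z + Y n - y) * f y - \<rho> (z - y) * f y - D y (Y n) * f y) / norm (Y n))"
          by (auto simp: q_def algebra_simps diff_divide_distrib)
        moreover have "\<dots> \<in> borel_measurable lborel"
          using conv_integrable[OF \<rho> f] Di by (intro borel_measurable_integrable) simp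
        ultimately show ?thesis by simp
      qed
      show "AE y in lborel. norm (q (Y n) y * f y) \<le> 2 * L * norm (indicator (cball 0 (norm z + R + 1)) y *\<^sub>R f y)" for n
        using mult_right_mono[OF qb[OF Y[of n]] abs_ge_zero] by (auto simp: abs_mult mult_ac)
      show "AE y in lborel. (\<lambda>n. q (Y n) y * f y) \<longlonglongrightarrow> 0"
      proof (intro AE_I2)
        fix y
        have "(\<rho> has_derivative D y) (at (z - y))" unfolding D_def by (rule has_derivative_frechet[OF d])
        then have "((\<lambda>h. norm (\<rho> (z - y + h) - \<rho> (z - y) - D y h) / norm h) \<longlongrightarrow> 0) (at 0)"
          by (simp add: has_derivative_at)
        then have "(\<lambda>n. norm (\<rho> (z - y + Y n) - \<rho> (z - y) - D y (Y n)) / norm (Y n)) \<longlonglongrightarrow> 0"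
          unfolding tendsto_at_iff_sequentially comp_def using Y Y0 by blast
        then have "(\<lambda>n. norm (q (Y n) y)) \<longlonglongrightarrow> 0" by (simp add: q_def algebra_simps)
        then have "(\<lambda>n. q (Y n) y) \<longlonglongrightarrow> 0" by (rule tendsto_norm_zero_cancel)
        then show "(\<lambda>n. q (Y n) y * f y) \<longlonglongrightarrow> 0" by (rule tendsto_mult_left_zero)
      qed
    qed simp
    then have "(\<lambda>n. (conv \<rho> f (z + Y n) - conv \<rho> f z - Lh (Y n)) / norm (Y n)) \<longlonglongrightarrow> 0"
      unfolding e by simp
    then show "(\<lambda>n. (conv \<rho> f (z + X n) - conv \<rho> f z - Lh (X n)) / norm (X n)) \<longlonglongrightarrow> 0"
      unfolding Y_def by (rule LIMSEQ_offset)
  qed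
  have "bounded_linear Lh"
    unfolding Lh_def by (intro bounded_linear_sum bounded_linear_mult_const bounded_linear_inner_left)
  then show ?thesis
    using tendsto_norm_zero[OF lim] unfolding has_derivative_at Lh_def[symmetric]
    by (simp add: norm_divide)
qed

lemma pd_conv:
  assumes "test_fun \<rho>" "loc_integrable f" "b \<in> Basis"
  shows "pd b (conv \<rho> f) = conv (pd b \<rho>) f"
proof
  fix z
  show "pd b (conv \<rho> f) z = conv (pd b \<rho>) f z"
    using pd_eq[OF conv_has_derivative[OF assms(1,2)], where b = b] assms(3)
    by (simp add: inner_Basis if_distrib[of "\<lambda>x. x * _"] cong: if_cong)
qed

text \<open>Every derivative falls on the kernel, which remains a test function; the induction
  therefore keeps the kernel arbitrary.\<close>

lemma smooth_conv:
  assumes "test_fun \<rho>" "loc_integrable f"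
  shows "smooth (conv \<rho> f)"
proof -
  have "C_k k (conv \<rho> f)" for k using assms(1)
  proof (induction k arbitrary: \<rho>)
    case 0
    then show ?case using has_derivative_continuous[OF conv_has_derivative[OF 0 assms(2)]]
      by (simp add: continuous_on_eq_continuous_at)
  next
    case (Suc k)
    then show ?case using conv_has_derivative[OF Suc.prems assms(2)]
      by (auto simp: pd_conv[OF Suc.prems assms(2)] differentiable_def intro!: Suc.IH test_fun_pd)
  qed
  then show ?thesis by (simp add: smooth_def)
qed

lemma integral_lborel_translate:
  fixes f :: "'a::euclidean_space \<Rightarrow> real"
  assumes "f \<in> borel_measurable borel"
  shows "(LBINT y. f (z - y)) = (LBINT y. f y)"
proof -
  have "(LBINT y. f y) = (\<integral>y. f y \<partial>(density (distr lborel borel (\<lambda>x. z + (-1) *\<^sub>R x)) (\<lambda>_. \<bar>-1::real\<bar>^DIM('a))))"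
    using lborel_affine[of "-1" z] by simp
  also have "\<dots> = (LBINT y. f (z - y))"
    using assms by (simp add: density_1 integral_distr)
  finally show ?thesis by simp
qed

lemma conv_1:
  assumes "test_fun \<rho>"
  shows "conv \<rho> (\<lambda>_. 1) z = (LBINT y. \<rho> y)"
  unfolding conv_def using integral_lborel_translate[of \<rho> z] assms by simp

text \<open>Convolution with the constant 1 yields a constant function, so its derivative vanishes;
  but that derivative is the convolution of 1 with the differentiated kernel, which is the integral
  in question.\<close>

lemma integral_pd_test:
  assumes "test_fun \<rho>" "b \<in> Basis"
  shows "(LBINT z. pd b \<rho> z) = 0"
proof -
  have "(LBINT z. pd b \<rho> z) = conv (pd b \<rho>) (\<lambda>_. 1) 0"
    by (simp add: conv_1[OF test_fun_pd[OF assms]])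
  also have "\<dots> = pd b (conv \<rho> (\<lambda>_. 1)) 0"
    by (rule fun_cong[OF pd_conv[OF assms(1) loc_integrable_const assms(2), symmetric]])
  also have "conv \<rho> (\<lambda>_. 1) = (\<lambda>z. LBINT y. \<rho> y)"
    using conv_1[OF assms(1)] by auto
  finally show ?thesis by simp
qed

subsection \<open>Mollification\<close>

lemma cball_measurable [measurable]: "cball x r \<in> sets borel"
  by (rule borel_closed[OF closed_cball])

section \<open>Continuity of translations in the L1 norm\<close>

lemma integral_lborel_shift:
  fixes f :: "'a::euclidean_space \<Rightarrow> real"
  assumes "integrable lborel f"
  shows "integrable lborel (\<lambda>z. f (z - h))" "(LBINT z. f (z - h)) = (LBINT z. f z)"
proof -
  have d: "distr lborel borel ((+) (- h)) = (lborel :: 'a measure)" by (rule lborel_distr_plus)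
  have f: "f \<in> borel_measurable borel" using assms by auto
  have "integrable (distr lborel borel ((+) (- h))) f" using assms by (simp add: d)
  then show "integrable lborel (\<lambda>z. f (z - h))"
    using f by (subst (asm) integrable_distr_eq) auto
  have "(LBINT z. f z) = (\<integral>z. f z \<partial>(distr lborel borel ((+) (- h))))" by (simp add: d)
  also have "\<dots> = (LBINT z. f (z - h))" using f by (subst integral_distr) auto
  finally show "(LBINT z. f (z - h)) = (LBINT z. f z)" by simp
qed

lemma integrable_lborel_reflect:
  fixes f :: "'a::euclidean_space \<Rightarrow> real"
  assumes "integrable lborel f"
  shows "integrable lborel (\<lambda>y. f (z - y))"
proof -
  have d: "distr lborel borel (\<lambda>x. z + (-1) *\<^sub>R x) = (lborel :: 'a measure)"
    using lborel_affine[of "-1" z] by (simp add: density_1)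
  have f: "f \<in> borel_measurable borel" using assms by auto
  have "integrable (distr lborel borel (\<lambda>x. z + (-1) *\<^sub>R x)) f" using assms by (simp only: d)
  then show ?thesis
    using f by (subst (asm) integrable_distr_eq) auto
qed

definition shift_dist :: "('a::euclidean_space \<Rightarrow> real) \<Rightarrow> 'a \<Rightarrow> real" where
  "shift_dist f h = (LBINT z. \<bar>f (z - h) - f z\<bar>)"

text \<open>The error f - g enters once translated and once untranslated; translation invariance
  makes both contributions equal, hence the factor 2.\<close>

lemma shift_dist_triangle:
  assumes f: "integrable lborel f" and g: "integrable lborel g"
  shows "shift_dist f h \<le> shift_dist g h + 2 * (LBINT z. \<bar>f z - g z\<bar>)"
proof -
  have i: "integrable lborel (\<lambda>z. \<bar>f z - g z\<bar>)" using f g by auto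
  have "shift_dist f h \<le> (LBINT z. (\<bar>g (z - h) - g z\<bar> + \<bar>f (z - h) - g (z - h)\<bar>) + \<bar>f z - g z\<bar>)"
    unfolding shift_dist_def
    by (rule integral_mono)
       (use f g i integral_lborel_shift(1)[OF i] integral_lborel_shift(1)[OF f] integral_lborel_shift(1)[OF g] in auto)
  also have "\<dots> = shift_dist g h + (LBINT z. \<bar>f (z - h) - g (z - h)\<bar>) + (LBINT z. \<bar>f z - g z\<bar>)"
    unfolding shift_dist_def
    using f g i integral_lborel_shift(1)[OF i] integral_lborel_shift(1)[OF f] integral_lborel_shift(1)[OF g]
    by (subst Bochner_Integration.integral_add, simp, simp)+ simp
  also have "(LBINT z. \<bar>f (z - h) - g (z - h)\<bar>) = (LBINT z. \<bar>f z - g z\<bar>)"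
    by (rule integral_lborel_shift(2)[OF i])
  finally show ?thesis by simp
qed

lemma shift_dist_nonneg: "shift_dist f h \<ge> 0"
  by (simp add: shift_dist_def)

text \<open>The functions with this continuity form a closed subset of L1. It serves twice: to pass
  from open to Borel sets, and from simple to integrable functions.\<close>

lemma shift_dist_approx:
  assumes f: "integrable lborel f"
    and g: "\<And>e. e > 0 \<Longrightarrow> \<exists>g. integrable lborel g \<and> (shift_dist g \<longlongrightarrow> 0) (at 0) \<and> (LBINT z. \<bar>f z - g z\<bar>) < e"
  shows "(shift_dist f \<longlongrightarrow> 0) (at 0)"
  unfolding tendsto_iff
proof (intro allI impI)
  fix e :: real assume "e > 0"
  then obtain g where g: "integrable lborel g" "(shift_dist g \<longlongrightarrow> 0) (at 0)"
    "(LBINT z. \<bar>f z - g z\<bar>) < e / 4" using g[of "e / 4"] by auto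
  have "\<forall>\<^sub>F h in at 0. dist (shift_dist g h) 0 < e / 2"
    using g(2) \<open>e > 0\<close> unfolding tendsto_iff by (meson half_gt_zero)
  then show "\<forall>\<^sub>F h in at 0. dist (shift_dist f h) 0 < e"
  proof eventually_elim
    case (elim h)
    then show ?case
      using shift_dist_triangle[OF f g(1), of h] g(3) shift_dist_nonneg[of f h] shift_dist_nonneg[of g h] by simp
  qed
qed

text \<open>For open sets only one half of the symmetric difference with a translate has to be
  estimated, since both halves have the same measure.\<close>

lemma shift_dist_open:
  fixes U :: "'a::euclidean_space set"
  assumes U: "open U" "emeasure lborel U < \<infinity>"
  shows "(shift_dist (indicator U) \<longlongrightarrow> 0) (at 0)"
proof -
  let ?f = "indicator U :: 'a \<Rightarrow> real"
  have i: "integrable lborel ?f" using U by auto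
  have j: "integrable lborel (\<lambda>z. max 0 (?f z - ?f (z - h)))" for h
    using i integral_lborel_shift(1)[OF i] by auto
  have e: "shift_dist ?f h = 2 * (LBINT z. max 0 (?f z - ?f (z - h)))" for h
  proof -
    have "\<bar>?f (z - h) - ?f z\<bar> = (?f (z - h) - ?f z) + 2 * max 0 (?f z - ?f (z - h))" for z
      by (simp add: indicator_def)
    then have "shift_dist ?f h = (LBINT z. (?f (z - h) - ?f z) + 2 * max 0 (?f z - ?f (z - h)))"
      by (simp add: shift_dist_def)
    also have "\<dots> = (LBINT z. ?f (z - h)) - (LBINT z. ?f z) + 2 * (LBINT z. max 0 (?f z - ?f (z - h)))"
      using i j integral_lborel_shift(1)[OF i] by simp
    finally show ?thesis using integral_lborel_shift(2)[OF i] by simp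
  qed
  show ?thesis unfolding tendsto_at_iff_sequentially comp_def
  proof (intro allI impI)
    fix X :: "nat \<Rightarrow> 'a" assume X: "X \<longlonglongrightarrow> 0"
    have "(\<lambda>n. (LBINT z. max 0 (?f z - ?f (z - X n)))) \<longlonglongrightarrow> (\<integral>z. 0 \<partial>(lborel::'a measure))"
    proof (rule integral_dominated_convergence[OF _ _ i])
      show "AE z in lborel. (\<lambda>n. max 0 (?f z - ?f (z - X n))) \<longlonglongrightarrow> 0"
      proof (intro AE_I2 tendsto_eventually)
        fix z
        show "\<forall>\<^sub>F n in sequentially. max 0 (?f z - ?f (z - X n)) = 0"
        proof (cases "z \<in> U")
          case True
          have "(\<lambda>n. z - X n) \<longlonglongrightarrow> z - 0" by (intro tendsto_intros X)
          then have "\<forall>\<^sub>F n in sequentially. z - X n \<in> U"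
            using True U(1) topological_tendstoD by fastforce
          then show ?thesis by eventually_elim (use True in auto)
        qed auto
      qed
      show "(\<lambda>z. max 0 (?f z - ?f (z - X n))) \<in> borel_measurable lborel" for n
        using j by blast
    qed (auto simp: indicator_def)
    then show "(\<lambda>n. shift_dist ?f (X n)) \<longlonglongrightarrow> 0"
      unfolding e using tendsto_mult_right_zero by simp
  qed
qed

text \<open>Induction over integrable functions: outer regularity approximates a Borel set of finite
  measure by open sets, sums follow from the triangle inequality, limits from approximation in
  L1.\<close>

lemma shift_dist_tendsto:
  fixes f :: "'a::euclidean_space \<Rightarrow> real"
  assumes "integrable lborel f"
  shows "(shift_dist f \<longlongrightarrow> 0) (at 0)"
  using assms
proof (induction rule: integrable_induct)
  case (base A c)
  have A: "A \<in> sets borel" "emeasure lborel A < \<infinity>" using base by auto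
  have iA: "integrable lborel (indicator A :: 'a \<Rightarrow> real)" using base by auto
  have "(shift_dist (indicator A) \<longlongrightarrow> 0) (at 0)"
  proof (rule shift_dist_approx[OF iA])
    fix e :: real assume e: "e > 0"
    obtain U where U: "open U" "A \<subseteq> U" "emeasure lborel (U - A) < ennreal e"
      using outer_regular_lborel[OF A(1) e] by blast
    have "emeasure lborel U = emeasure lborel A + emeasure lborel (U - A)"
      using U A by (subst plus_emeasure) (auto intro!: arg_cong[of _ _ "emeasure lborel"])
    then have fin: "emeasure lborel U < \<infinity>" using U(3) A(2)
      by (metis ennreal_less_top ennreal_add_less_top order_less_trans infinity_ennreal_def)
    have iU: "integrable lborel (indicator U :: 'a \<Rightarrow> real)" using fin U by auto
    have "(LBINT z. \<bar>indicator A z - indicator U z\<bar>) = (LBINT z. (indicator (U - A) z :: real))"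
      using U(2) by (intro Bochner_Integration.integral_cong) (auto simp: indicator_def)
    also have "\<dots> = measure lborel (U - A)" using U A by simp
    also have "\<dots> < e"
      using U(3) e unfolding measure_def by (cases "emeasure lborel (U - A)") (auto simp: ennreal_less_iff)
    finally show "\<exists>g. integrable lborel g \<and> (shift_dist g \<longlongrightarrow> 0) (at 0) \<and> (LBINT z. \<bar>indicator A z - g z\<bar>) < e"
      using shift_dist_open[OF U(1) fin] iU by blast
  qed
  from tendsto_mult_right_zero[OF this, of "\<bar>c\<bar>"]
  have "((\<lambda>h. \<bar>c\<bar> * shift_dist (indicator A) h) \<longlongrightarrow> 0) (at 0)" .
  moreover have "\<bar>c\<bar> * shift_dist (indicator A) h = shift_dist (\<lambda>z. indicator A z *\<^sub>R c) h" for h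
    unfolding shift_dist_def by (subst integral_mult_right_zero[symmetric])
      (auto simp: abs_mult simp flip: left_diff_distrib)
  ultimately show ?case by simp
next
  case (add f g)
  have "shift_dist (\<lambda>z. f z + g z) h \<le> shift_dist f h + shift_dist g h" for h
  proof -
    note i = add(1,2) integral_lborel_shift(1)[OF add(1)] integral_lborel_shift(1)[OF add(2)]
    have "shift_dist (\<lambda>z. f z + g z) h \<le> (LBINT z. \<bar>f (z - h) - f z\<bar> + \<bar>g (z - h) - g z\<bar>)"
      unfolding shift_dist_def by (rule integral_mono) (use i in auto)
    also have "\<dots> = shift_dist f h + shift_dist g h"
      unfolding shift_dist_def by (rule Bochner_Integration.integral_add) (use i in auto)
    finally show ?thesis .
  qed
  then show ?case
    using tendsto_add[OF add(3,4)]
    by (intro tendsto_sandwich[OF _ _ tendsto_const, of 0 "shift_dist (\<lambda>z. f z + g z)" "at 0" "\<lambda>h. shift_dist f h + shift_dist g h"])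
       (auto simp: shift_dist_nonneg)
next
  case (lim f s)
  show ?case
  proof (rule shift_dist_approx[OF lim(4)])
    fix e :: real assume e: "e > 0"
    have "(\<lambda>n. LBINT z. \<bar>f z - s n z\<bar>) \<longlonglongrightarrow> (\<integral>z. 0 \<partial>(lborel::'a measure))"
    proof (rule integral_dominated_convergence)
      \<comment> \<open>The 3 adds |f| itself to the bound |s n| \<le> 2 |f| that the induction rule
        provides.\<close>
      show "integrable lborel (\<lambda>z. 3 * norm (f z))" using lim(4) by auto
      show "AE z in lborel. (\<lambda>n. \<bar>f z - s n z\<bar>) \<longlonglongrightarrow> 0"
      proof (intro AE_I2)
        fix z :: 'a
        have "(\<lambda>n. \<bar>f z - s n z\<bar>) \<longlonglongrightarrow> \<bar>f z - f z\<bar>" by (intro tendsto_intros lim(2)) simp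
        then show "(\<lambda>n. \<bar>f z - s n z\<bar>) \<longlonglongrightarrow> 0" by simp
      qed
      show "AE z in lborel. norm (\<bar>f z - s n z\<bar>) \<le> 3 * norm (f z)" for n
      proof (intro AE_I2)
        fix z :: 'a
        have "norm (s n z) \<le> 2 * norm (f z)" by (rule lim(3)) simp
        then show "norm (\<bar>f z - s n z\<bar>) \<le> 3 * norm (f z)" by simp
      qed
    qed (use lim in \<open>auto dest: borel_measurable_integrable\<close>)
    then have "\<forall>\<^sub>F n in sequentially. dist (LBINT z. \<bar>f z - s n z\<bar>) 0 < e"
      using e unfolding tendsto_iff by simp
    then obtain n where "(LBINT z. \<bar>f z - s n z\<bar>) < e"
      unfolding eventually_sequentially by fastforce
    then show "\<exists>g. integrable lborel g \<and> (shift_dist g \<longlongrightarrow> 0) (at 0) \<and> (LBINT z. \<bar>f z - g z\<bar>) < e"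
      using lim(1,5) by blast
  qed
qed

text \<open>As the kernel has mass 1, the error at z is a mean of f(z - y) - f(z) with weights
  \<open>\<rho> y\<close>. Exchanging the integrals leaves a mean of \<open>shift_dist f y\<close>
  over the support of the kernel. With nonnegative integrals this does not presuppose integrability
  of the convolution.\<close>

lemma conv_L1_estimate:
  fixes f :: "'a::euclidean_space \<Rightarrow> real"
  assumes f: "integrable lborel f" and \<rho>: "test_fun \<rho>" "\<And>z. \<rho> z \<ge> 0" "\<And>z. r < norm z \<Longrightarrow> \<rho> z = 0" "(LBINT z. \<rho> z) = 1"
    and e: "\<And>h. norm h \<le> r \<Longrightarrow> shift_dist f h \<le> e"
  shows "(\<integral>\<^sup>+z. ennreal \<bar>conv \<rho> f z - f z\<bar> \<partial>lborel) \<le> ennreal e"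
proof -
  have \<rho>i: "integrable lborel \<rho>" by (rule integrable_test_fun[OF \<rho>(1)])
  have fm [measurable]: "f \<in> borel_measurable borel" using f by auto
  have \<rho>m [measurable]: "\<rho> \<in> borel_measurable borel" using \<rho> by measurable
  have lf: "loc_integrable f"
    unfolding loc_integrable_iff using f
    by (auto intro!: integrable_mult_indicator[of _ lborel f, simplified])
  have "ennreal \<bar>conv \<rho> f z - f z\<bar> \<le> (\<integral>\<^sup>+y. ennreal (\<rho> y * \<bar>f (z - y) - f z\<bar>) \<partial>lborel)" for z
  proof -
    have i: "integrable lborel (\<lambda>y. \<rho> y * f (z - y))"
      using integrable_lborel_reflect[OF conv_integrable[OF \<rho>(1) lf], of z z] by simp
    have "conv \<rho> f z = (LBINT y. \<rho> y * f (z - y))"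
      unfolding conv_def using integral_lborel_translate[of "\<lambda>y. \<rho> y * f (z - y)" z] by simp
    also have "\<dots> - f z = (LBINT y. \<rho> y * f (z - y) - \<rho> y * f z)"
      using i \<rho>i \<rho>(4) by simp
    finally have "conv \<rho> f z - f z = (LBINT y. \<rho> y * (f (z - y) - f z))" by (simp add: algebra_simps)
    moreover have "integrable lborel (\<lambda>y. \<rho> y * (f (z - y) - f z))"
      using i \<rho>i by (simp add: right_diff_distrib)
    ultimately show ?thesis
      using integral_norm_bound_ennreal[of lborel "\<lambda>y. \<rho> y * (f (z - y) - f z)"] \<rho>(2) by (simp add: abs_mult)
  qed
  then have "(\<integral>\<^sup>+z. ennreal \<bar>conv \<rho> f z - f z\<bar> \<partial>lborel) \<le> (\<integral>\<^sup>+z. (\<integral>\<^sup>+y. ennreal (\<rho> y * \<bar>f (z - y) - f z\<bar>) \<partial>lborel) \<partial>lborel)"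
    by (rule nn_integral_mono)
  also have "\<dots> = (\<integral>\<^sup>+y. (\<integral>\<^sup>+z. ennreal (\<rho> y * \<bar>f (z - y) - f z\<bar>) \<partial>lborel) \<partial>lborel)"
    by (rule lborel_pair.Fubini') measurable
  also have "\<dots> \<le> (\<integral>\<^sup>+y. ennreal (\<rho> y) * ennreal e \<partial>lborel)"
  proof (rule nn_integral_mono)
    fix y
    have i: "integrable lborel (\<lambda>z. \<bar>f (z - y) - f z\<bar>)" using f integral_lborel_shift(1)[OF f] by auto
    have "(\<integral>\<^sup>+z. ennreal (\<rho> y * \<bar>f (z - y) - f z\<bar>) \<partial>lborel) = ennreal (\<rho> y) * (\<integral>\<^sup>+z. ennreal \<bar>f (z - y) - f z\<bar> \<partial>lborel)"
      using \<rho>(2) by (simp add: ennreal_mult nn_integral_cmult)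
    also have "(\<integral>\<^sup>+z. ennreal \<bar>f (z - y) - f z\<bar> \<partial>lborel) = ennreal (shift_dist f y)"
      unfolding shift_dist_def by (rule nn_integral_eq_integral[OF i]) auto
    also have "ennreal (\<rho> y) * \<dots> \<le> ennreal (\<rho> y) * ennreal e"
      using e[of y] \<rho>(3)[of y] by (cases "norm y \<le> r") (auto intro!: mult_left_mono ennreal_leI)
    finally show "(\<integral>\<^sup>+z. ennreal (\<rho> y * \<bar>f (z - y) - f z\<bar>) \<partial>lborel) \<le> ennreal (\<rho> y) * ennreal e" .
  qed
  also have "\<dots> = ennreal e"
    using nn_integral_eq_integral[OF \<rho>i] \<rho> by (simp add: nn_integral_multc)
  finally show ?thesis .
qed

section \<open>A sequence of mollifiers and the local L1 convergence of mollifications\<close>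

abbreviation ball_int :: "real \<Rightarrow> ('a::euclidean_space \<Rightarrow> real) \<Rightarrow> real" where
  "ball_int R h \<equiv> LBINT z. indicator (cball 0 R) z * h z"

definition moll :: "nat \<Rightarrow> 'a::euclidean_space \<Rightarrow> real" where
  "moll n = (SOME \<rho>. test_fun \<rho> \<and> (\<forall>z. \<rho> z \<ge> 0) \<and> (\<forall>z. inverse (Suc n) < norm z \<longrightarrow> \<rho> z = 0) \<and>
     (LBINT z. \<rho> z) = 1)"

lemma moll: "test_fun (moll n :: 'a \<Rightarrow> real)" "moll n z \<ge> 0" "inverse (Suc n) < norm z \<Longrightarrow> moll n z = 0"
    "integral\<^sup>L (lborel :: 'a measure) (moll n) = 1"
  for z :: "'a::euclidean_space"
proof -
  have "\<exists>\<rho> :: 'a \<Rightarrow> real. test_fun \<rho> \<and> (\<forall>z. \<rho> z \<ge> 0) \<and> (\<forall>z. inverse (Suc n) < norm z \<longrightarrow> \<rho> z = 0) \<and>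
     (LBINT z. \<rho> z) = 1"
    by (rule mollifier_exists[of "inverse (Suc n)"]) auto
  from someI_ex[OF this, folded moll_def]
  show "test_fun (moll n :: 'a \<Rightarrow> real)" "moll n z \<ge> 0" "inverse (Suc n) < norm z \<Longrightarrow> moll n z = 0"
    "integral\<^sup>L (lborel :: 'a measure) (moll n) = 1" by auto
qed

abbreviation mollify :: "nat \<Rightarrow> ('a::euclidean_space \<Rightarrow> real) \<Rightarrow> 'a \<Rightarrow> real" where
  "mollify n \<equiv> conv (moll n)"

lemma smooth_mollify: "loc_integrable f \<Longrightarrow> smooth (mollify n f)"
  by (rule smooth_conv[OF moll(1)])

text \<open>A mean with nonnegative weights of total mass 1; exceptional null sets of f disappear in
  the integral, so the bound holds at every point.\<close>

lemma mollify_bound: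
  assumes f: "loc_integrable f" and C: "AE z in lborel. \<bar>f z\<bar> \<le> C"
  shows "\<bar>mollify n f z\<bar> \<le> C"
proof -
  have i: "integrable lborel (\<lambda>y. moll n (z - y) * f y)" by (rule conv_integrable[OF moll(1) f])
  have j: "integrable lborel (\<lambda>y. moll n (z - y))" by (rule integrable_test_fun[OF test_fun_reflect[OF moll(1)]])
  have "\<bar>mollify n f z\<bar> \<le> (LBINT y. \<bar>moll n (z - y) * f y\<bar>)"
    unfolding conv_def by (rule integral_abs_bound)
  also have "\<dots> \<le> (LBINT y. moll n (z - y) * C)"
  proof (rule integral_mono_AE)
    show "AE y in lborel. \<bar>moll n (z - y) * f y\<bar> \<le> moll n (z - y) * C"
      using C by eventually_elim (auto simp: abs_mult moll(2) intro!: mult_left_mono)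
  qed (use i j in auto)
  also have "\<dots> = C"
    using conv_1[OF moll(1), of n z] by (simp add: conv_def moll(4))
  finally show ?thesis .
qed

lemma mollify_L1:
  fixes f :: "'a::euclidean_space \<Rightarrow> real"
  assumes f: "loc_integrable f"
  shows "(\<lambda>n. ball_int R (\<lambda>z. \<bar>mollify n f z - f z\<bar>)) \<longlonglongrightarrow> 0"
proof -
  \<comment> \<open>All kernels have radius at most 1, so at points of norm at most R cutting f off
    beyond R + 1 does not change the mollification. This reduces local integrability to
    integrability.\<close>
  define g where "g = (\<lambda>z. indicator (cball 0 (R + 1)) z * f z)"
  have g: "integrable lborel g" using loc_integrable_cball[OF f, of "R + 1"] by (simp add: g_def)
  have fm [measurable]: "f \<in> borel_measurable borel" using f by measurable
  have gf: "mollify n g z - g z = mollify n f z - f z" if "norm z \<le> R" for n z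
  proof -
    have "moll n (z - y) * g y = moll n (z - y) * f y" for y
    proof (cases "norm y \<le> R + 1")
      case False
      have "inverse (real (Suc n)) \<le> 1" by (simp add: divide_simps)
      moreover have "norm (z - y) > 1"
        using False that norm_triangle_ineq2[of y z] by (simp add: norm_minus_commute)
      ultimately have "moll n (z - y) = 0" by (intro moll(3)) simp
      then show ?thesis by simp
    qed (simp add: g_def)
    then have "mollify n g z = mollify n f z" unfolding conv_def by presburger
    then show ?thesis using that by (simp add: g_def)
  qed
  show ?thesis unfolding LIMSEQ_iff
  proof (intro allI impI)
    fix e :: real assume e: "e > 0"
    have "\<forall>\<^sub>F h in at 0. dist (shift_dist g h) 0 < e / 2"
      using shift_dist_tendsto[OF g] e unfolding tendsto_iff by (meson half_gt_zero)
    then obtain d where d: "d > 0" "\<And>h. h \<noteq> 0 \<Longrightarrow> norm h < d \<Longrightarrow> shift_dist g h < e / 2"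
      unfolding eventually_at by (auto simp: shift_dist_nonneg)
    have d': "shift_dist g h \<le> e / 2" if "norm h < d" for h
      using d(2)[of h] that e by (cases "h = 0") (auto simp: shift_dist_def)
    obtain N where N: "inverse (real (Suc N)) < d" using reals_Archimedean[OF d(1)] by auto
    have "norm (ball_int R (\<lambda>z. \<bar>mollify n f z - f z\<bar>) - 0) < e" if "n \<ge> N" for n
    proof -
      have "inverse (real (Suc n)) \<le> inverse (real (Suc N))" using that by (simp add: divide_simps)
      then have "(\<integral>\<^sup>+z. ennreal \<bar>mollify n g z - g z\<bar> \<partial>lborel) \<le> ennreal (e / 2)"
        using N by (intro conv_L1_estimate[where r = "inverse (real (Suc n))", OF g moll(1,2) moll(3) moll(4)] d') linarith+
      moreover have "(\<integral>\<^sup>+z. ennreal (indicator (cball 0 R) z * \<bar>mollify n f z - f z\<bar>) \<partial>lborel)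
         \<le> (\<integral>\<^sup>+z. ennreal \<bar>mollify n g z - g z\<bar> \<partial>lborel)"
        by (rule nn_integral_mono) (auto simp: gf indicator_def)
      ultimately have *: "(\<integral>\<^sup>+z. ennreal (indicator (cball 0 R) z * \<bar>mollify n f z - f z\<bar>) \<partial>lborel) \<le> ennreal (e / 2)"
        by simp
      have [measurable]: "mollify n f \<in> borel_measurable borel" using smooth_mollify[OF f] by measurable
      have "(\<lambda>z. indicator (cball 0 R) z * \<bar>mollify n f z - f z\<bar>) \<in> borel_measurable lborel"
        unfolding measurable_lborel2 by measurable
      then have "ball_int R (\<lambda>z. \<bar>mollify n f z - f z\<bar>) \<le> e / 2"
        using enn2real_leI[OF _ *] e by (subst integral_eq_nn_integral) auto
      moreover have "ball_int R (\<lambda>z. \<bar>mollify n f z - f z\<bar>) \<ge> 0" by simp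
      ultimately show ?thesis using e by simp
    qed
    then show "\<exists>no. \<forall>n\<ge>no. norm (ball_int R (\<lambda>z. \<bar>mollify n f z - f z\<bar>) - 0) < e" by blast
  qed
qed

lemma loc_integrable_smooth: "smooth f \<Longrightarrow> loc_integrable f"
  by (rule loc_integrable_continuous[OF smooth_continuous])

text \<open>Each value of a mollification is a test integral, hence zero, while the mollifications
  converge to f in the mean on every ball.\<close>

lemma AE_eq_0_if_test_zero:
  fixes f :: "'a::euclidean_space \<Rightarrow> real"
  assumes f: "loc_integrable f" and z: "\<And>\<eta>. test_fun \<eta> \<Longrightarrow> (LBINT z. \<eta> z * f z) = 0"
  shows "AE z in lborel. f z = 0"
proof -
  have "mollify n f z = 0" for n z
    unfolding conv_def by (rule z[OF test_fun_reflect[OF moll(1)]])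
  then have "ball_int R (\<lambda>z. \<bar>f z\<bar>) = 0" for R
    using mollify_L1[OF f, of R] by (simp add: LIMSEQ_const_iff)
  moreover have "integrable lborel (\<lambda>z. indicator (cball 0 R) z * \<bar>f z\<bar>)" for R
    using integrable_norm[OF loc_integrable_cball[OF f, of R]] by (simp add: abs_mult)
  ultimately have "AE z in lborel. indicator (cball 0 (real n)) z * \<bar>f z\<bar> = 0" for n
    using integral_nonneg_eq_0_iff_AE[of lborel "\<lambda>z. indicator (cball 0 (real n)) z * \<bar>f z\<bar>"] by simp
  then have "AE z in lborel. \<forall>n. indicator (cball 0 (real n)) z * \<bar>f z\<bar> = 0" by (subst AE_all_countable) simp
  then show ?thesis
  proof eventually_elim
    case (elim z)
    obtain n where "norm z \<le> real n" using real_arch_simple by blast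
    then show ?case using elim[rule_format, of n] by simp
  qed
qed

lemma AE_eq_0_if_test_zero':
  fixes f :: "'a::euclidean_space \<Rightarrow> 'b::euclidean_space"
  assumes f: "loc_integrable f" and z: "\<And>\<eta>. test_fun \<eta> \<Longrightarrow> (LBINT z. \<eta> z *\<^sub>R f z) = 0"
  shows "AE z in lborel. f z = 0"
proof -
  have "AE z in lborel. f z \<bullet> b = 0" for b
  proof (rule AE_eq_0_if_test_zero)
    show "loc_integrable (\<lambda>z. f z \<bullet> b)" by (rule loc_integrable_linear[OF bounded_linear_inner_left f])
    fix \<eta> :: "'a \<Rightarrow> real" assume \<eta>: "test_fun \<eta>"
    have "(LBINT z. \<eta> z * (f z \<bullet> b)) = (LBINT z. \<eta> z *\<^sub>R f z) \<bullet> b"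
      using integral_bounded_linear[OF bounded_linear_inner_left integrable_test[OF \<eta> f], of b] by simp
    then show "(LBINT z. \<eta> z * (f z \<bullet> b)) = 0" by (simp add: z[OF \<eta>])
  qed
  then have "AE z in lborel. \<forall>b\<in>Basis. f z \<bullet> b = 0"
    by (subst AE_finite_all) auto
  then show ?thesis by eventually_elim (simp add: euclidean_all_zero_iff)
qed

subsection \<open>Local convergence in the mean\<close>

text \<open>Local integrability is part of the definition because the integral of a non-integrable
  function is 0 by convention, so that the limit alone would say nothing.\<close>

definition L1loc :: "(nat \<Rightarrow> 'a::euclidean_space \<Rightarrow> real) \<Rightarrow> ('a \<Rightarrow> real) \<Rightarrow> bool" where
  "L1loc F f \<longleftrightarrow> (\<forall>n. loc_integrable (F n)) \<and> loc_integrable f \<and>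
     (\<forall>R. (\<lambda>n. ball_int R (\<lambda>z. \<bar>F n z - f z\<bar>)) \<longlonglongrightarrow> 0)"

lemma integrable_cball_abs:
  fixes f :: "'a::euclidean_space \<Rightarrow> real"
  assumes "loc_integrable f"
  shows "integrable lborel (\<lambda>z. indicator (cball 0 R) z * \<bar>f z\<bar>)"
  using integrable_norm[OF loc_integrable_cball[OF assms, of R]] by (simp add: abs_mult)

lemma loc_integrable_diff:
  fixes f g :: "'a::euclidean_space \<Rightarrow> 'b::euclidean_space"
  shows "loc_integrable f \<Longrightarrow> loc_integrable g \<Longrightarrow> loc_integrable (\<lambda>z. f z - g z)"
  unfolding loc_integrable_iff by (simp add: scaleR_diff_right)

lemma loc_integrable_abs:
  fixes f :: "'a::euclidean_space \<Rightarrow> real"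
  assumes "loc_integrable f" shows "loc_integrable (\<lambda>z. \<bar>f z\<bar>)"
  by (rule loc_integrable_bound[OF assms]) (use assms in measurable)

lemma L1loc_mollify: "loc_integrable f \<Longrightarrow> L1loc (\<lambda>n. mollify n f) f"
  by (simp add: L1loc_def mollify_L1 loc_integrable_smooth smooth_mollify)

lemma L1loc_dominated:
  assumes F: "\<And>n. loc_integrable (F n)" and f: "loc_integrable f"
    and D: "\<And>n. loc_integrable (D n)"
    and le: "\<And>n. AE z in lborel. \<bar>F n z - f z\<bar> \<le> D n z"
    and lim: "\<And>R. (\<lambda>n. ball_int R (\<lambda>z. D n z)) \<longlonglongrightarrow> 0"
  shows "L1loc F f"
  unfolding L1loc_def
proof (intro conjI allI F f)
  fix R
  show "(\<lambda>n. ball_int R (\<lambda>z. \<bar>F n z - f z\<bar>)) \<longlonglongrightarrow> 0"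
  proof (rule tendsto_sandwich[OF _ _ tendsto_const lim])
    show "\<forall>\<^sub>F n in sequentially. ball_int R (\<lambda>z. \<bar>F n z - f z\<bar>)
        \<le> ball_int R (\<lambda>z. D n z)"
    proof (rule always_eventually, rule allI, rule integral_mono_AE)
      show "AE z in lborel. indicator (cball 0 R) z * \<bar>F n z - f z\<bar> \<le> indicator (cball 0 R) z * D n z" for n
        using le[of n] by eventually_elim (simp add: mult_left_mono)
      show "integrable lborel (\<lambda>z. indicator (cball 0 R) z * \<bar>F n z - f z\<bar>)" for n
        by (intro integrable_cball_abs loc_integrable_diff F f)
      show "integrable lborel (\<lambda>z. indicator (cball 0 R) z * D n z)" for n
        using loc_integrable_cball[OF D] by simp
    qed
  qed simp
qed

lemma L1loc_add:
  assumes F: "L1loc F f" and G: "L1loc G g"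
  shows "L1loc (\<lambda>n z. F n z + G n z) (\<lambda>z. f z + g z)"
proof (rule L1loc_dominated[where D = "\<lambda>n z. \<bar>F n z - f z\<bar> + \<bar>G n z - g z\<bar>"])
  fix R
  have "ball_int R (\<lambda>z. (\<bar>F n z - f z\<bar> + \<bar>G n z - g z\<bar>)) =
      ball_int R (\<lambda>z. \<bar>F n z - f z\<bar>) + ball_int R (\<lambda>z. \<bar>G n z - g z\<bar>)" for n
    unfolding distrib_left using F G
    by (intro Bochner_Integration.integral_add integrable_cball_abs loc_integrable_diff) (auto simp: L1loc_def)
  then show "(\<lambda>n. ball_int R (\<lambda>z. (\<bar>F n z - f z\<bar> + \<bar>G n z - g z\<bar>))) \<longlonglongrightarrow> 0"
    using tendsto_add[of _ 0 _ _ 0] F G unfolding L1loc_def by fastforce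
qed (use F G in \<open>auto simp: L1loc_def intro!: loc_integrable_add loc_integrable_abs loc_integrable_diff\<close>)

lemma L1loc_cmult:
  assumes F: "L1loc F f"
  shows "L1loc (\<lambda>n z. c * F n z) (\<lambda>z. c * f z)"
proof (rule L1loc_dominated[where D = "\<lambda>n z. \<bar>c\<bar> * \<bar>F n z - f z\<bar>"])
  show "(\<lambda>n. ball_int R (\<lambda>z. (\<bar>c\<bar> * \<bar>F n z - f z\<bar>))) \<longlonglongrightarrow> 0" for R
    using tendsto_mult_right_zero[of "\<lambda>n. ball_int R (\<lambda>z. \<bar>F n z - f z\<bar>)" _ "\<bar>c\<bar>"] F
    unfolding L1loc_def mult.left_commute[of _ "\<bar>c\<bar>"] by simp
qed (use F in \<open>auto simp: L1loc_def abs_mult simp flip: right_diff_distrib intro!: loc_integrable_cmult loc_integrable_abs loc_integrable_diff\<close>)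

lemma L1loc_sum:
  assumes "\<And>i. i \<in> I \<Longrightarrow> L1loc (F i) (f i)"
  shows "L1loc (\<lambda>n z. \<Sum>i\<in>I. F i n z) (\<lambda>z. \<Sum>i\<in>I. f i z)"
  using assms
  by (induction I rule: infinite_finite_induct)
     (auto simp: L1loc_def[of "\<lambda>_ _. 0"] loc_integrable_const intro: L1loc_add)

text \<open>Convergence is only in the mean, so dominated convergence does not apply directly. Where
  |g| \<le> M the integrand is at most M |F n - f|; where |g| > M the bound on F n - f leaves a tail
  integral of |g|, which is small for large M uniformly in n.\<close>

lemma L1loc_bounded_tail:
  fixes F :: "nat \<Rightarrow> 'a::euclidean_space \<Rightarrow> real"
  assumes F: "L1loc F f" and B: "\<And>n. AE z in lborel. \<bar>F n z - f z\<bar> \<le> B" and g: "loc_integrable g"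
  shows "(\<lambda>n. ball_int R (\<lambda>z. (\<bar>F n z - f z\<bar> * \<bar>g z\<bar>))) \<longlonglongrightarrow> 0"
proof -
  define C where "C = \<bar>B\<bar>"
  have C: "AE z in lborel. \<bar>F n z - f z\<bar> \<le> C" for n using B[of n] by eventually_elim (simp add: C_def)
  have C0: "C \<ge> 0" by (simp add: C_def)
  define h where "h = (\<lambda>z. indicator (cball 0 R) z * \<bar>g z\<bar>)"
  have gm [measurable]: "g \<in> borel_measurable borel" using g by measurable
  have fm [measurable]: "f \<in> borel_measurable borel" "F n \<in> borel_measurable borel" for n
    using F by (auto simp: L1loc_def intro: loc_integrable_measurable)
  have hi: "integrable lborel h" unfolding h_def by (rule integrable_cball_abs[OF g])
  have h0: "h z \<ge> 0" for z by (simp add: h_def)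
  have hm [measurable]: "h \<in> borel_measurable borel" using hi by auto
  have Fi: "integrable lborel (\<lambda>z. indicator (cball 0 R) z * \<bar>F n z - f z\<bar>)" for n
    using F by (intro integrable_cball_abs loc_integrable_diff) (auto simp: L1loc_def)
  define tail where "tail = (\<lambda>M::nat. LBINT z. indicator {z. h z > real M} z * h z)"
  have tail: "tail \<longlonglongrightarrow> (\<integral>z. 0 \<partial>(lborel::'a measure))"
    unfolding tail_def
  proof (rule integral_dominated_convergence[OF _ _ hi])
    show "AE z in lborel. (\<lambda>M. indicator {z. h z > real M} z * h z) \<longlonglongrightarrow> 0"
    proof (intro AE_I2 tendsto_eventually)
      fix z
      obtain N where "h z \<le> real N" using real_arch_simple by blast
      then show "\<forall>\<^sub>F M in sequentially. indicator {z. h z > real M} z * h z = 0"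
        by (intro eventually_sequentiallyI[of N]) (auto simp: indicator_def)
    qed
    show "(\<lambda>z. indicator {z. h z > real M} z * h z) \<in> borel_measurable lborel" for M
      by measurable
  qed (use h0 in \<open>auto simp: indicator_def\<close>)
  have ti: "integrable lborel (\<lambda>z. indicator {z. h z > real M} z * h z)" for M
    by (rule Bochner_Integration.integrable_bound[OF hi]) (measurable, auto simp: indicator_def)
  have est: "ball_int R (\<lambda>z. (\<bar>F n z - f z\<bar> * \<bar>g z\<bar>)) \<le>
     real M * ball_int R (\<lambda>z. \<bar>F n z - f z\<bar>) + C * tail M" for n M
  proof -
    have "ball_int R (\<lambda>z. (\<bar>F n z - f z\<bar> * \<bar>g z\<bar>)) \<le>
       (LBINT z. real M * (indicator (cball 0 R) z * \<bar>F n z - f z\<bar>) + C * (indicator {z. h z > real M} z * h z))"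
    proof (rule integral_mono_AE')
      show "AE z in lborel. indicator (cball 0 R) z * (\<bar>F n z - f z\<bar> * \<bar>g z\<bar>) \<le>
          real M * (indicator (cball 0 R) z * \<bar>F n z - f z\<bar>) + C * (indicator {z. h z > real M} z * h z)"
        using C[of n]
      proof eventually_elim
        case (elim z)
        show ?case
        proof (cases "norm z \<le> R")
          case True
          then have hz: "h z = \<bar>g z\<bar>" by (simp add: h_def)
          show ?thesis
          proof (cases "h z > real M")
            case True
            then show ?thesis using \<open>norm z \<le> R\<close> elim hz by (auto intro!: add_increasing mult_right_mono)
          next
            case False
            then have "\<bar>F n z - f z\<bar> * \<bar>g z\<bar> \<le> \<bar>F n z - f z\<bar> * real M"
              using hz by (intro mult_left_mono) auto
            then show ?thesis using False \<open>norm z \<le> R\<close> by (simp add: mult.commute)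
          qed
        qed (use C0 h0 in auto)
      qed
    qed (use Fi ti C0 h0 in auto)
    also have "\<dots> = real M * ball_int R (\<lambda>z. \<bar>F n z - f z\<bar>) + C * tail M"
      unfolding tail_def using Fi ti by simp
    finally show ?thesis .
  qed
  show ?thesis unfolding LIMSEQ_iff
  proof (intro allI impI)
    fix e :: real assume e: "e > 0"
    \<comment> \<open>M is fixed first, from the tail alone; only afterwards is n taken
      large.\<close>
    have "(\<lambda>M. C * tail M) \<longlonglongrightarrow> C * 0" using tail by (intro tendsto_intros) simp
    then obtain M where M: "norm (C * tail M - 0) < e / 2"
      using e unfolding LIMSEQ_iff by (metis half_gt_zero mult_zero_right order_refl)
    have "(\<lambda>n. real M * ball_int R (\<lambda>z. \<bar>F n z - f z\<bar>)) \<longlonglongrightarrow> real M * 0"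
      using F by (intro tendsto_intros) (auto simp: L1loc_def)
    then obtain N where N: "\<And>n. n \<ge> N \<Longrightarrow> norm (real M * ball_int R (\<lambda>z. \<bar>F n z - f z\<bar>) - 0) < e / 2"
      using e unfolding LIMSEQ_iff by (metis half_gt_zero mult_zero_right)
    show "\<exists>no. \<forall>n\<ge>no. norm (ball_int R (\<lambda>z. (\<bar>F n z - f z\<bar> * \<bar>g z\<bar>)) - 0) < e"
    proof (intro exI[of _ N] allI impI)
      fix n assume "n \<ge> N"
      have "ball_int R (\<lambda>z. (\<bar>F n z - f z\<bar> * \<bar>g z\<bar>)) \<ge> 0"
        by simp
      then show "norm (ball_int R (\<lambda>z. (\<bar>F n z - f z\<bar> * \<bar>g z\<bar>)) - 0) < e"
        using est[of n M] M N[OF \<open>n \<ge> N\<close>] unfolding real_norm_def by linarith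
    qed
  qed
qed

text \<open>Write F G - f g = F (G - g) + (F - f) g. The first term is controlled by the bound on F,
  the second by \<open>L1loc_bounded_tail\<close>, since g need not be bounded.\<close>

lemma L1loc_mult:
  assumes F: "L1loc F f" and G: "L1loc G g"
    and C: "\<And>n. AE z in lborel. \<bar>F n z\<bar> \<le> C" "AE z in lborel. \<bar>f z\<bar> \<le> C"
  shows "L1loc (\<lambda>n z. F n z * G n z) (\<lambda>z. f z * g z)"
proof -
  have li: "loc_integrable (F n)" "loc_integrable f" "loc_integrable (G n)" "loc_integrable g" for n
    using F G by (auto simp: L1loc_def)
  note m = li[THEN loc_integrable_measurable]
  have d: "AE z in lborel. \<bar>F n z - f z\<bar> \<le> 2 * C" for n
    using C(1)[of n] C(2) by eventually_elim simp
  have dl: "loc_integrable (\<lambda>z. \<bar>F n z - f z\<bar> * \<bar>g z\<bar>)" for n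
    using li m d by (intro loc_integrable_mult_bounded loc_integrable_abs) auto
  show ?thesis
  proof (rule L1loc_dominated[where D = "\<lambda>n z. C * \<bar>G n z - g z\<bar> + \<bar>F n z - f z\<bar> * \<bar>g z\<bar>"])
    show "loc_integrable (\<lambda>z. F n z * G n z)" for n
      using loc_integrable_mult_bounded[OF li(3) m(1) C(1)] .
    show "loc_integrable (\<lambda>z. f z * g z)"
      using loc_integrable_mult_bounded[OF li(4) m(2) C(2)] .
    show "loc_integrable (\<lambda>z. C * \<bar>G n z - g z\<bar> + \<bar>F n z - f z\<bar> * \<bar>g z\<bar>)" for n
      by (intro loc_integrable_add loc_integrable_cmult loc_integrable_abs loc_integrable_diff dl li)
    show "AE z in lborel. \<bar>F n z * G n z - f z * g z\<bar> \<le> C * \<bar>G n z - g z\<bar> + \<bar>F n z - f z\<bar> * \<bar>g z\<bar>" for n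
      using C(1)[of n]
    proof eventually_elim
      case (elim z)
      have "\<bar>F n z * G n z - f z * g z\<bar> = \<bar>F n z * (G n z - g z) + (F n z - f z) * g z\<bar>"
        by (simp add: algebra_simps)
      also have "\<dots> \<le> \<bar>F n z\<bar> * \<bar>G n z - g z\<bar> + \<bar>F n z - f z\<bar> * \<bar>g z\<bar>"
        by (metis abs_mult abs_triangle_ineq)
      also have "\<dots> \<le> C * \<bar>G n z - g z\<bar> + \<bar>F n z - f z\<bar> * \<bar>g z\<bar>"
        using elim by (intro add_right_mono mult_right_mono) auto
      finally show ?case .
    qed
    fix R
    have "ball_int R (\<lambda>z. (C * \<bar>G n z - g z\<bar> + \<bar>F n z - f z\<bar> * \<bar>g z\<bar>)) =
      C * ball_int R (\<lambda>z. \<bar>G n z - g z\<bar>) +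
      ball_int R (\<lambda>z. (\<bar>F n z - f z\<bar> * \<bar>g z\<bar>))" for n
      unfolding distrib_left mult.left_commute[of _ C]
      using integrable_cball_abs[OF loc_integrable_diff[OF li(3,4)]] loc_integrable_cball[OF dl]
      by (subst Bochner_Integration.integral_add) auto
    moreover have "(\<lambda>n. C * ball_int R (\<lambda>z. \<bar>G n z - g z\<bar>) +
      ball_int R (\<lambda>z. (\<bar>F n z - f z\<bar> * \<bar>g z\<bar>))) \<longlonglongrightarrow> C * 0 + 0"
      using G by (intro tendsto_intros L1loc_bounded_tail[OF F d li(4)]) (auto simp: L1loc_def)
    ultimately show "(\<lambda>n. ball_int R (\<lambda>z. (C * \<bar>G n z - g z\<bar> + \<bar>F n z - f z\<bar> * \<bar>g z\<bar>))) \<longlonglongrightarrow> 0"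
      by simp
  qed
qed

lemma L1loc_test:
  assumes F: "L1loc F f" and \<eta>: "test_fun \<eta>"
  shows "(\<lambda>n. LBINT z. \<eta> z * F n z) \<longlonglongrightarrow> (LBINT z. \<eta> z * f z)"
proof -
  have li: "loc_integrable (F n)" "loc_integrable f" for n using F by (auto simp: L1loc_def)
  obtain M R where M: "M > 0" "\<And>z. \<bar>\<eta> z\<bar> \<le> M * indicator (cball 0 R) z"
    by (rule test_fun_bounds[OF \<eta>]) blast
  have "(\<lambda>n. LBINT z. \<eta> z * F n z - \<eta> z * f z) \<longlonglongrightarrow> 0"
  proof (rule tendsto_0_le[where K = M])
    show "(\<lambda>n. ball_int R (\<lambda>z. \<bar>F n z - f z\<bar>)) \<longlonglongrightarrow> 0"
      using F by (auto simp: L1loc_def)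
    show "\<forall>\<^sub>F n in sequentially. norm (LBINT z. \<eta> z * F n z - \<eta> z * f z) \<le>
       norm (ball_int R (\<lambda>z. \<bar>F n z - f z\<bar>)) * M"
    proof (intro always_eventually allI)
      fix n
      have "norm (LBINT z. \<eta> z * F n z - \<eta> z * f z) \<le> (LBINT z. M * (indicator (cball 0 R) z * \<bar>F n z - f z\<bar>))"
      proof (rule order_trans[OF integral_norm_bound integral_mono])
        show "norm (\<eta> z * F n z - \<eta> z * f z) \<le> M * (indicator (cball 0 R) z * \<bar>F n z - f z\<bar>)" for z
          using mult_right_mono[OF M(2)[of z] abs_ge_zero, of "F n z - f z"]
          by (simp add: abs_mult mult.assoc flip: right_diff_distrib)
      qed (use li \<eta> in \<open>auto intro!: integrable_test_real integrable_cball_abs loc_integrable_diff Bochner_Integration.integrable_abs Bochner_Integration.integrable_diff\<close>)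
      then show "norm (LBINT z. \<eta> z * F n z - \<eta> z * f z) \<le>
         norm (ball_int R (\<lambda>z. \<bar>F n z - f z\<bar>)) * M" by (simp add: mult.commute)
    qed
  qed
  moreover have "(LBINT z. \<eta> z * F n z - \<eta> z * f z) = (LBINT z. \<eta> z * F n z) - (LBINT z. \<eta> z * f z)" for n
    using integrable_test_real[OF \<eta> li(1)] integrable_test_real[OF \<eta> li(2)] by simp
  ultimately show ?thesis by (simp add: LIM_zero_iff)
qed

section \<open>Weak derivatives as limits of classical ones\<close>

lemma integral_by_parts_test:
  assumes \<eta>: "test_fun \<eta>" and w: "smooth w" and b: "b \<in> Basis"
  shows "(LBINT z. pd b \<eta> z * w z) = - (LBINT z. \<eta> z * pd b w z)"
proof -
  have "(LBINT z. pd b (\<lambda>z. \<eta> z * w z) z) = 0"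
    by (rule integral_pd_test[OF test_fun_mult[OF \<eta> w] b])
  moreover have "pd b (\<lambda>z. \<eta> z * w z) z = \<eta> z * pd b w z + pd b \<eta> z * w z" for z
    by (rule pd_mult) (intro smooth_differentiable test_fun_smooth \<eta> w)+
  moreover have "integrable lborel (\<lambda>z. \<eta> z * pd b w z)" "integrable lborel (\<lambda>z. pd b \<eta> z * w z)"
    using \<eta> w b by (auto intro!: integrable_test_fun test_fun_mult smooth_pd test_fun_pd)
  ultimately show ?thesis by simp
qed

text \<open>Integration by parts holds for each smooth member, and both sides pass to the limit
  because test functions are bounded with bounded support.\<close>

lemma has_weak_deriv_limit:
  assumes F: "L1loc F f" and G: "L1loc G g" and s: "\<And>n. smooth (F n)"
    and d: "\<And>n. pd e (F n) = G n" and e: "e \<in> Basis"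
  shows "has_weak_deriv f e g"
  unfolding has_weak_deriv_def
proof (intro conjI allI impI)
  fix \<eta> :: "'a \<Rightarrow> real" assume \<eta>: "test_fun \<eta>"
  have "(\<lambda>n. LBINT z. pd e \<eta> z * F n z) \<longlonglongrightarrow> (LBINT z. pd e \<eta> z * f z)"
    by (rule L1loc_test[OF F test_fun_pd[OF \<eta> e]])
  moreover have "(LBINT z. pd e \<eta> z * F n z) = - (LBINT z. \<eta> z * G n z)" for n
    using integral_by_parts_test[OF \<eta> s e, of n] by (simp only: fun_cong[OF d])
  moreover have "(\<lambda>n. - (LBINT z. \<eta> z * G n z)) \<longlonglongrightarrow> - (LBINT z. \<eta> z * g z)"
    by (intro tendsto_minus L1loc_test[OF G \<eta>])
  ultimately show "(LBINT z. pd e \<eta> z *\<^sub>R f z) = - (LBINT z. \<eta> z *\<^sub>R g z)"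
    using LIMSEQ_unique by fastforce
qed (use F G in \<open>auto simp: L1loc_def\<close>)

lemma has_weak_deriv_real:
  fixes f g :: "'a::euclidean_space \<Rightarrow> real"
  assumes "has_weak_deriv f e g"
  shows "loc_integrable f" "loc_integrable g"
    "test_fun \<eta> \<Longrightarrow> (LBINT z. pd e \<eta> z * f z) = - (LBINT z. \<eta> z * g z)"
  using assms by (auto simp: has_weak_deriv_def)

text \<open>The derivative falls on the kernel, where it is minus the derivative in the integration
  variable. The reflected kernel is a test function, and the sign in the weak identity cancels the
  first one.\<close>

lemma pd_mollify:
  assumes "has_weak_deriv f e g" "e \<in> Basis"
  shows "pd e (mollify n f) = mollify n g"
proof
  fix z :: 'a
  have "pd e (mollify n f) z = (LBINT y. pd e (moll n) (z - y) * f y)"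
    using fun_cong[OF pd_conv[OF moll(1) has_weak_deriv_real(1)[OF assms(1)] assms(2)]] by (simp add: conv_def)
  also have "\<dots> = - (LBINT y. pd e (\<lambda>y. moll n (z - y)) y * f y)"
    by (subst pd_reflect[OF smooth_differentiable[OF test_fun_smooth[OF moll(1)]]]) simp
  also have "\<dots> = mollify n g z"
    unfolding conv_def using has_weak_deriv_real(3)[OF assms(1) test_fun_reflect[OF moll(1)]] by simp
  finally show "pd e (mollify n f) z = mollify n g z" .
qed

text \<open>Only squares go through the mollification argument; products follow later by
  polarization.\<close>

lemma weak_deriv_mult_self:
  fixes f g :: "'a::euclidean_space \<Rightarrow> real"
  assumes f: "has_weak_deriv f e g" "e \<in> Basis" and C: "AE z in lborel. \<bar>f z\<bar> \<le> C"
  shows "has_weak_deriv (\<lambda>z. f z * f z) e (\<lambda>z. 2 * (f z * g z))"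
proof -
  note li = has_weak_deriv_real[OF f(1)]
  note s = smooth_mollify[OF li(1)]
  have B: "AE z in lborel. \<bar>mollify n f z\<bar> \<le> C" for n using mollify_bound[OF li(1) C] by simp
  show ?thesis
  proof (rule has_weak_deriv_limit[OF _ _ _ _ f(2)])
    show "L1loc (\<lambda>n z. mollify n f z * mollify n f z) (\<lambda>z. f z * f z)"
      by (rule L1loc_mult[OF L1loc_mollify L1loc_mollify B C]) (rule li)+
    show "L1loc (\<lambda>n z. 2 * (mollify n f z * mollify n g z)) (\<lambda>z. 2 * (f z * g z))"
      by (rule L1loc_cmult[OF L1loc_mult[OF L1loc_mollify L1loc_mollify B C]]) (rule li)+
    show "smooth (\<lambda>z. mollify n f z * mollify n f z)" for n by (intro smooth_mult s)
    show "pd e (\<lambda>z. mollify n f z * mollify n f z) = (\<lambda>z. 2 * (mollify n f z * mollify n g z))" for n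
      using pd_mult[OF smooth_differentiable[OF s] smooth_differentiable[OF s]]
      by (simp add: fun_cong[OF pd_mollify[OF f]] fun_eq_iff)
  qed
qed

subsection \<open>Completeness with respect to local square means\<close>

lemma integrable_cball_mult:
  fixes f :: "'a::euclidean_space \<Rightarrow> real"
  assumes "loc_integrable f"
  shows "integrable lborel (\<lambda>z. indicator (cball 0 R) z * f z)"
  using loc_integrable_cball[OF assms, of R] by simp

text \<open>Replaces the Cauchy-Schwarz inequality: the weight d stays free and is chosen to suit
  each use, as a geometric weight, as 1, or depending on the index of a sequence.\<close>

lemma abs_le_amgm:
  fixes a d :: real assumes "d > 0"
  shows "\<bar>a\<bar> \<le> d + a\<^sup>2 / d"
proof -
  have "\<bar>a\<bar> * d \<le> d * d + a\<^sup>2"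
  proof (cases "\<bar>a\<bar> \<le> d")
    case True
    then have "\<bar>a\<bar> * d \<le> d * d" using assms by (intro mult_right_mono) auto
    then show ?thesis using zero_le_power2[of a] by linarith
  next
    case False
    then have "\<bar>a\<bar> * d \<le> \<bar>a\<bar> * \<bar>a\<bar>" by (intro mult_left_mono) auto
    then show ?thesis using zero_le_square[of d] unfolding abs_mult_self_eq power2_eq_square by linarith
  qed
  then show ?thesis using assms by (simp add: field_simps power2_eq_square)
qed

text \<open>The Riesz-Fischer argument carried out on all balls at once: a rapidly converging
  subsequence has a limit almost everywhere, and Fatou's lemma turns the Cauchy property into
  convergence to that limit. Continuity makes the squared differences locally integrable.\<close>

lemma L2loc_complete:
  fixes F :: "nat \<Rightarrow> 'a::euclidean_space \<Rightarrow> real"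
  assumes c: "\<And>n. continuous_on UNIV (F n)"
    and Cauchy: "\<And>R e. e > 0 \<Longrightarrow> \<exists>N. \<forall>n\<ge>N. \<forall>m\<ge>N. ball_int R (\<lambda>z. (F n z - F m z)\<^sup>2) < e"
  shows "\<exists>G. (\<forall>n. loc_integrable (\<lambda>z. (F n z - G z)\<^sup>2)) \<and> G \<in> borel_measurable borel \<and>
     (\<forall>R. (\<lambda>n. ball_int R (\<lambda>z. (F n z - G z)\<^sup>2)) \<longlonglongrightarrow> 0)"
proof -
  let ?D = "\<lambda>R n m z. indicator (cball 0 R) z * (F n z - F m z)\<^sup>2"
  let ?E = "\<lambda>R n G z. indicator (cball 0 R) z * (F n z - G z :: real)\<^sup>2"
  have m [measurable]: "F n \<in> borel_measurable borel" for n using c by (rule borel_measurable_continuous_onI)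
  have li: "loc_integrable (\<lambda>z. (F n z - F m z)\<^sup>2)" for n m
    by (intro loc_integrable_continuous continuous_intros c)
  note ii = integrable_cball_mult[OF li]
  \<comment> \<open>The radius grows with k, so that one subsequence serves all balls. Of the rate
    \<open>(1/4)^k\<close> a summable \<open>(1/2)^k\<close> remains after multiplication by the
    weight \<open>2^k\<close> in \<open>t\<close>.\<close>
  have "\<forall>k. \<exists>N. \<forall>n\<ge>N. \<forall>m\<ge>N. integral\<^sup>L lborel (?D (real k) n m) < (1/4)^k"
    by (intro allI Cauchy) simp
  from choice[OF this] obtain N where N: "\<And>k n m. n \<ge> N k \<Longrightarrow> m \<ge> N k \<Longrightarrow>
      integral\<^sup>L lborel (?D (real k) n m) < (1/4)^k"
    by blast
  \<comment> \<open>Summing the thresholds puts both \<open>s k\<close> and \<open>s (Suc k)\<close>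
    above \<open>N k\<close>; the summand k sends the indices to infinity.\<close>
  define s where "s = (\<lambda>k. k + (\<Sum>j\<le>k. N j))"
  have sN: "s k \<ge> N k" "s (Suc k) \<ge> N k" "s k \<ge> k" for k
  proof -
    have "N k \<le> (\<Sum>j\<le>k. N j)" by (rule member_le_sum) auto
    then show "s k \<ge> N k" "s (Suc k) \<ge> N k" "s k \<ge> k" by (auto simp: s_def)
  qed
  define d where "d = (\<lambda>k z. F (s (Suc k)) z - F (s k) z)"
  have dm [measurable]: "d k \<in> borel_measurable borel" for k unfolding d_def by measurable
  have AE_conv_ball: "AE z in lborel. norm z \<le> real R \<longrightarrow> convergent (\<lambda>k. F (s k) z)" for R :: nat
  proof -
    \<comment> \<open>With weight \<open>(1/2)^k\<close>, \<open>abs_le_amgm\<close> gives |d k|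
      \<le> \<open>(1/2)^k\<close> + \<open>2^k * (d k z)\<^sup>2\<close>. Hence a finite sum of the
      \<open>t k\<close> makes the telescoping series of the \<open>d k\<close> converge
      absolutely.\<close>
    define t where "t = (\<lambda>k z. indicator (cball 0 (real R)) z * (2^k * (d k z)\<^sup>2))"
    have tm [measurable]: "t k \<in> borel_measurable borel" for k unfolding t_def by measurable
    have tn: "t k z \<ge> 0" for k z by (simp add: t_def)
    have ti: "integrable lborel (t k)" for k
      using ii[of "real R" "s (Suc k)" "s k"] unfolding t_def d_def mult.left_commute[of _ "2^k"]
      by (intro integrable_mult_right) simp
    have tb: "(LBINT z. t k z) \<le> (1/2)^k" if "k \<ge> R" for k
    proof -
      have "(LBINT z. t k z) = 2^k * ball_int (real R) (\<lambda>z. (d k z)\<^sup>2)"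
        unfolding t_def mult.left_commute[of _ "2^k"] by simp
      also have "ball_int (real R) (\<lambda>z. (d k z)\<^sup>2) \<le> ball_int (real k) (\<lambda>z. (d k z)\<^sup>2)"
        by (rule integral_mono) (use ii that in \<open>auto simp: d_def indicator_def\<close>)
      also have "ball_int (real k) (\<lambda>z. (d k z)\<^sup>2) \<le> (1/4)^k"
        using N[OF sN(2) sN(1)] unfolding d_def by (rule less_imp_le)
      also have "2^k * (1/4)^k = ((1/2)^k :: real)" by (simp flip: power_mult_distrib)
      finally show ?thesis by simp
    qed
    have "summable (\<lambda>k. LBINT z. t k z)"
      by (rule summable_comparison_test'[OF summable_geometric[of "1/2"], of R])
         (use tb tn in \<open>auto simp: integral_nonneg_AE\<close>)
    then have "(\<Sum>k. ennreal (LBINT z. t k z)) \<noteq> top"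
      by (rule ennreal_suminf_neq_top) (use tn in \<open>auto simp: integral_nonneg_AE\<close>)
    moreover have "(\<integral>\<^sup>+z. (\<Sum>k. ennreal (t k z)) \<partial>lborel) = (\<Sum>k. ennreal (LBINT z. t k z))"
      using nn_integral_eq_integral[OF ti] tn by (subst nn_integral_suminf) auto
    ultimately have "AE z in lborel. (\<Sum>k. ennreal (t k z)) \<noteq> \<infinity>"
      by (intro nn_integral_PInf_AE) auto
    then show ?thesis
    proof eventually_elim
      case (elim z)
      show ?case
      proof
        assume z: "norm z \<le> real R"
        have "summable (\<lambda>k. t k z)" using elim tn by (intro summable_suminf_not_top) auto
        then have "summable (\<lambda>k. (1/2)^k + t k z)" by (intro summable_add summable_geometric) auto
        then have "summable (\<lambda>k. \<bar>d k z\<bar>)"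
        proof (rule summable_comparison_test')
          show "norm \<bar>d k z\<bar> \<le> (1/2)^k + t k z" for k
            using abs_le_amgm[of "(1/2)^k" "d k z"] z by (simp add: t_def power_divide mult.commute)
        qed
        then have "summable (\<lambda>k. d k z)" by (rule summable_rabs_cancel)
        then have "(\<lambda>n. \<Sum>k<n. d k z) \<longlonglongrightarrow> (\<Sum>k. d k z)" by (rule summable_LIMSEQ)
        then have "(\<lambda>n. F (s 0) z + (\<Sum>k<n. d k z)) \<longlonglongrightarrow> F (s 0) z + (\<Sum>k. d k z)" by (intro tendsto_intros)
        moreover have "F (s 0) z + (\<Sum>k<n. d k z) = F (s n) z" for n
          using sum_lessThan_telescope[of "\<lambda>k. F (s k) z" n] by (simp add: d_def)
        ultimately show "convergent (\<lambda>k. F (s k) z)" by (auto simp: convergent_def)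
      qed
    qed
  qed
  have AE_conv: "AE z in lborel. convergent (\<lambda>k. F (s k) z)"
  proof -
    have "AE z in lborel. \<forall>R::nat. norm z \<le> real R \<longrightarrow> convergent (\<lambda>k. F (s k) z)"
      unfolding AE_all_countable using AE_conv_ball by blast
    then show ?thesis by eventually_elim (use real_arch_simple in blast)
  qed
  define G where "G = (\<lambda>z. lim (\<lambda>k. F (s k) z))"
  have Gm [measurable]: "G \<in> borel_measurable borel" unfolding G_def by measurable
  have GL: "AE z in lborel. (\<lambda>k. F (s k) z) \<longlonglongrightarrow> G z"
    using AE_conv by eventually_elim (simp add: G_def convergent_LIMSEQ_iff)
  \<comment> \<open>Fatou's lemma along the subsequence: a bound on the distances from F n to all
    late F k is inherited by the distance to G.\<close>
  have bd: "(\<integral>\<^sup>+z. ennreal (?E R n G z) \<partial>lborel) \<le> ennreal e"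
    if H: "\<And>k. k \<ge> M \<Longrightarrow> integral\<^sup>L lborel (?D R n k) \<le> e" for R n M e
  proof -
    have "(\<integral>\<^sup>+z. ennreal (?E R n G z) \<partial>lborel)
       = (\<integral>\<^sup>+z. liminf (\<lambda>k. ennreal (?D R n (s k) z)) \<partial>lborel)"
    proof (rule nn_integral_cong_AE)
      show "AE z in lborel. ennreal (?E R n G z) =
          liminf (\<lambda>k. ennreal (?D R n (s k) z))"
        using GL
      proof eventually_elim
        case (elim z)
        have "(\<lambda>k. ennreal (?D R n (s k) z)) \<longlonglongrightarrow>
            ennreal (?E R n G z)"
          by (intro tendsto_ennrealI tendsto_intros elim)
        then show ?case by (intro lim_imp_Liminf[symmetric]) auto
      qed
    qed
    also have "\<dots> \<le> liminf (\<lambda>k. \<integral>\<^sup>+z. ennreal (?D R n (s k) z) \<partial>lborel)"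
      by (rule nn_integral_liminf) measurable
    also have "\<dots> \<le> limsup (\<lambda>k. \<integral>\<^sup>+z. ennreal (?D R n (s k) z) \<partial>lborel)"
      by (rule Liminf_le_Limsup) simp
    also have "\<dots> \<le> ennreal e"
    proof (rule Limsup_bounded)
      show "\<forall>\<^sub>F k in sequentially. (\<integral>\<^sup>+z. ennreal (?D R n (s k) z) \<partial>lborel) \<le> ennreal e"
      proof (rule eventually_sequentiallyI[of M])
        fix k assume "M \<le> k"
        then have "s k \<ge> M" using sN(3)[of k] by simp
        from H[OF this] show "(\<integral>\<^sup>+z. ennreal (?D R n (s k) z) \<partial>lborel) \<le> ennreal e"
          by (subst nn_integral_eq_integral[OF ii]) (auto intro: ennreal_leI)
      qed
    qed
    finally show ?thesis .
  qed
  have bdi: "integrable lborel (?E R n G)"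
    "integral\<^sup>L lborel (?E R n G) \<le> e"
    if H: "\<And>k. k \<ge> M \<Longrightarrow> integral\<^sup>L lborel (?D R n k) \<le> e" and e: "e \<ge> 0" for R n M e
  proof -
    show "integrable lborel (?E R n G)"
      using order_le_less_trans[OF bd[OF H] ennreal_less_top]
      by (intro integrableI_nonneg) auto
    have "?E R n G \<in> borel_measurable lborel"
      unfolding measurable_lborel2 by measurable
    then show "integral\<^sup>L lborel (?E R n G) \<le> e"
      using enn2real_leI[OF e bd[OF H]] by (subst integral_eq_nn_integral) auto
  qed
  have lim: "(\<lambda>n. integral\<^sup>L lborel (?E R n G)) \<longlonglongrightarrow> 0" for R
    unfolding LIMSEQ_iff
  proof (intro allI impI)
    fix e :: real assume e: "e > 0"
    then obtain M where M: "\<forall>n\<ge>M. \<forall>m\<ge>M. integral\<^sup>L lborel (?D R n m) < e / 2"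
      using Cauchy[of "e / 2" R] half_gt_zero[OF e] by blast
    have "norm (integral\<^sup>L lborel (?E R n G) - 0) < e" if "n \<ge> M" for n
    proof -
      have "integral\<^sup>L lborel (?E R n G) \<le> e / 2"
        using M that e by (intro bdi(2)[of M]) (auto intro: less_imp_le)
      moreover have "integral\<^sup>L lborel (?E R n G) \<ge> 0" by simp
      ultimately show ?thesis using e by simp
    qed
    then show "\<exists>no. \<forall>n\<ge>no. norm (integral\<^sup>L lborel (?E R n G) - 0) < e" by blast
  qed
  have "loc_integrable (\<lambda>z. (F n z - G z)\<^sup>2)" for n
    unfolding loc_integrable_iff
  proof
    fix R
    obtain M where M: "\<forall>n\<ge>M. \<forall>m\<ge>M. integral\<^sup>L lborel (?D R n m) < 1"
      using Cauchy[of 1 R] zero_less_one by blast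
    have "integrable lborel (\<lambda>z. indicator (cball 0 R) z * (F M z - G z)\<^sup>2)"
      using M by (intro bdi(1)[of M _ _ 1]) (auto intro: less_imp_le)
    then have "integrable lborel (\<lambda>z. 2 * (indicator (cball 0 R) z * (F n z - F M z)\<^sup>2) + 2 * (indicator (cball 0 R) z * (F M z - G z)\<^sup>2))"
      using ii by auto
    then have "integrable lborel (?E R n G)"
    proof (rule Bochner_Integration.integrable_bound)
      have "(F n z - G z)\<^sup>2 \<le> 2 * (F n z - F M z)\<^sup>2 + 2 * (F M z - G z)\<^sup>2" for z
        using zero_le_power2[of "(F n z - F M z) - (F M z - G z)"]
        by (simp add: power2_eq_square algebra_simps)
      then show "AE z in lborel. norm (indicator (cball 0 R) z * (F n z - G z)\<^sup>2) \<le>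
          norm (2 * (indicator (cball 0 R) z * (F n z - F M z)\<^sup>2) + 2 * (indicator (cball 0 R) z * (F M z - G z)\<^sup>2))"
        by (auto simp: indicator_def)
      show "?E R n G \<in> borel_measurable lborel"
        unfolding measurable_lborel2 by measurable
    qed
    then show "integrable lborel (\<lambda>z. indicator (cball 0 R) z *\<^sub>R (F n z - G z)\<^sup>2)" by simp
  qed
  then show ?thesis using lim Gm by blast
qed

text \<open>Choosing d per index, close to the square root of the integral a of D, bounds the a/d
  term by that root, while the term d times the integral of H vanishes with d. This is
  Cauchy-Schwarz with H as the square of the second factor.\<close>

lemma L1loc_interpolate:
  fixes D :: "nat \<Rightarrow> 'a::euclidean_space \<Rightarrow> real"
  assumes X: "\<And>n. loc_integrable (X n)" "loc_integrable x" and H: "loc_integrable H"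
    and D: "\<And>n. loc_integrable (D n)" "\<And>n z. D n z \<ge> 0"
       "\<And>R. (\<lambda>n. ball_int R (\<lambda>z. D n z)) \<longlonglongrightarrow> 0"
    and le: "\<And>n z d. d > 0 \<Longrightarrow> \<bar>X n z - x z\<bar> \<le> D n z + (D n z / d + d * H z)"
  shows "L1loc X x"
  unfolding L1loc_def
proof (intro conjI allI X)
  fix R
  define a where "a = (\<lambda>n. ball_int R (\<lambda>z. D n z))"
  have a0: "a n \<ge> 0" for n unfolding a_def using D(2) by (intro integral_nonneg_AE) auto
  \<comment> \<open>The added inverse keeps d positive when a n = 0 and still tends to 0.\<close>
  define d where "d = (\<lambda>n. sqrt (a n) + inverse (real (Suc n)))"
  define h where "h = ball_int R (\<lambda>z. H z)"
  have d: "d n > 0" "a n / d n \<le> sqrt (a n)" for n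
  proof -
    show p: "d n > 0" unfolding d_def using a0[of n] by (intro add_nonneg_pos) auto
    have "a n = sqrt (a n) * sqrt (a n)" using a0 by simp
    also have "\<dots> \<le> sqrt (a n) * d n" using a0[of n] by (intro mult_left_mono) (auto simp: d_def)
    finally show "a n / d n \<le> sqrt (a n)" using p by (simp add: divide_le_eq)
  qed
  have d0: "d \<longlonglongrightarrow> 0"
    unfolding d_def using tendsto_add[OF tendsto_real_sqrt[OF D(3)[of R, folded a_def]] LIMSEQ_inverse_real_of_nat]
    by simp
  have B: "ball_int R (\<lambda>z. \<bar>X n z - x z\<bar>) \<le> a n + (sqrt (a n) + d n * h)" for n
  proof -
    note i = integrable_cball_mult[OF D(1)[of n]] integrable_cball_mult[OF H]
    have "ball_int R (\<lambda>z. \<bar>X n z - x z\<bar>) \<le>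
        (LBINT z. indicator (cball 0 R) z * D n z + (indicator (cball 0 R) z * D n z / d n + d n * (indicator (cball 0 R) z * H z)))"
    proof (rule integral_mono)
      show "integrable lborel (\<lambda>z. indicator (cball 0 R) z * \<bar>X n z - x z\<bar>)"
        by (intro integrable_cball_abs loc_integrable_diff X)
      show "indicator (cball 0 R) z * \<bar>X n z - x z\<bar> \<le>
         indicator (cball 0 R) z * D n z + (indicator (cball 0 R) z * D n z / d n + d n * (indicator (cball 0 R) z * H z))" for z
        using le[OF d(1), of n z n] by (simp add: indicator_def)
    qed (use i in auto)
    also have "\<dots> = a n + (a n / d n + d n * h)"
      unfolding a_def h_def using i by simp
    finally show ?thesis using d(2)[of n] by simp
  qed
  have "(\<lambda>n. a n + (sqrt (a n) + d n * h)) \<longlonglongrightarrow> 0 + (sqrt 0 + 0 * h)"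
    using D(3)[of R] d0 unfolding a_def by (intro tendsto_intros)
  then have lim: "(\<lambda>n. a n + (sqrt (a n) + d n * h)) \<longlonglongrightarrow> 0" by simp
  show "(\<lambda>n. ball_int R (\<lambda>z. \<bar>X n z - x z\<bar>)) \<longlonglongrightarrow> 0"
    by (rule tendsto_sandwich[OF _ _ tendsto_const lim]) (use B in simp_all)
qed

text \<open>With a = F n - G one has F n^2 - G^2 = a^2 + 2 a G, and 2 |a G| is at most a^2 / d + d
  G^2. So the interpolation applies with H = G^2 to the squares and with H = 1 to the functions
  themselves.\<close>

lemma L1loc_of_L2:
  fixes F :: "nat \<Rightarrow> 'a::euclidean_space \<Rightarrow> real"
  assumes c: "\<And>n. continuous_on UNIV (F n)" and G: "G \<in> borel_measurable borel"
    and D: "\<And>n. loc_integrable (\<lambda>z. (F n z - G z)\<^sup>2)"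
       "\<And>R. (\<lambda>n. ball_int R (\<lambda>z. (F n z - G z)\<^sup>2)) \<longlonglongrightarrow> 0"
  shows "L1loc F G" "L1loc (\<lambda>n z. (F n z)\<^sup>2) (\<lambda>z. (G z)\<^sup>2)"
proof -
  note [measurable] = G
  have lF: "loc_integrable (F n)" "loc_integrable (\<lambda>z. (F n z)\<^sup>2)" for n
    by (intro loc_integrable_continuous c continuous_intros)+
  have lG2: "loc_integrable (\<lambda>z. (G z)\<^sup>2)"
  proof (rule loc_integrable_bound)
    show "loc_integrable (\<lambda>z. 2 * (F 0 z)\<^sup>2 + 2 * (F 0 z - G z)\<^sup>2)"
      by (intro loc_integrable_add loc_integrable_cmult lF D)
    have "(G z)\<^sup>2 \<le> 2 * (F 0 z)\<^sup>2 + 2 * (F 0 z - G z)\<^sup>2" for z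
      using zero_le_power2[of "F 0 z + (F 0 z - G z)"]
      by (simp add: power2_eq_square algebra_simps)
    then show "AE z in lborel. norm ((G z)\<^sup>2) \<le> norm (2 * (F 0 z)\<^sup>2 + 2 * (F 0 z - G z)\<^sup>2)" by auto
  qed measurable
  have lG: "loc_integrable G"
  proof (rule loc_integrable_bound)
    show "loc_integrable (\<lambda>z. 1 + (G z)\<^sup>2)" by (intro loc_integrable_add loc_integrable_const lG2)
    show "AE z in lborel. norm (G z) \<le> norm (1 + (G z)\<^sup>2)" using abs_le_amgm[of 1] by auto
  qed measurable
  show "L1loc F G"
  proof (rule L1loc_interpolate[OF lF(1) lG loc_integrable_const D(1) zero_le_power2 D(2)])
    fix n z and d :: real assume "d > 0"
    then show "\<bar>F n z - G z\<bar> \<le> (F n z - G z)\<^sup>2 + ((F n z - G z)\<^sup>2 / d + d * 1)"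
      using abs_le_amgm[of d "F n z - G z"] zero_le_power2[of "F n z - G z"] by linarith
  qed
  show "L1loc (\<lambda>n z. (F n z)\<^sup>2) (\<lambda>z. (G z)\<^sup>2)"
  proof (rule L1loc_interpolate[OF lF(2) lG2 lG2 D(1) zero_le_power2 D(2)])
    fix n z and d :: real assume d: "d > 0"
    define a where "a = F n z - G z"
    have "\<bar>2 * (a * G z)\<bar> \<le> a\<^sup>2 / d + d * (G z)\<^sup>2"
    proof -
      have "0 \<le> (\<bar>a\<bar> - d * \<bar>G z\<bar>)\<^sup>2 / d" using d by simp
      also have "\<dots> = a\<^sup>2 / d + d * (G z)\<^sup>2 - 2 * (\<bar>a\<bar> * \<bar>G z\<bar>)"
        using d by (simp add: power2_eq_square field_simps)
      finally show ?thesis by (simp add: abs_mult)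
    qed
    moreover have "(F n z)\<^sup>2 - (G z)\<^sup>2 = a\<^sup>2 + 2 * (a * G z)"
      by (simp add: a_def power2_eq_square algebra_simps)
    ultimately show "\<bar>(F n z)\<^sup>2 - (G z)\<^sup>2\<bar> \<le> (F n z - G z)\<^sup>2 + ((F n z - G z)\<^sup>2 / d + d * (G z)\<^sup>2)"
      unfolding a_def[symmetric] using abs_triangle_ineq[of "a\<^sup>2" "2 * (a * G z)"] by simp
  qed
qed

subsection \<open>The gradient of a bounded function with integrable Laplacian\<close>

abbreviation pdx where "pdx i \<equiv> pd (x_dir i)"

lemma x_dir_Basis: "x_dir i \<in> Basis"
  by (simp add: x_dir_def Basis_prod_def)

lemma t_dir_Basis: "(t_dir :: real \<times> (real ^ 'n)) \<in> Basis"
  by (simp add: t_dir_def Basis_prod_def)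

lemma test_fun_laplace: "test_fun \<eta> \<Longrightarrow> test_fun (laplace_x \<eta>)"
  unfolding laplace_x_def[abs_def] by (intro test_fun_sum test_fun_pd x_dir_Basis)

lemma smooth_laplace: "smooth w \<Longrightarrow> smooth (laplace_x w)"
  unfolding laplace_x_def[abs_def] by (intro smooth_sum smooth_pd x_dir_Basis)

lemma laplace_by_parts:
  assumes \<eta>: "test_fun \<eta>" and w: "smooth w"
  shows "(LBINT z. laplace_x \<eta> z * w z) = (LBINT z. \<eta> z * laplace_x w z)"
proof -
  let ?D = "\<lambda>i w. pdx i w"
  have i: "integrable lborel (\<lambda>z. ?D i (?D i \<eta>) z * w z)" "integrable lborel (\<lambda>z. \<eta> z * ?D i (?D i w) z)" for i
    using \<eta> w by (auto intro!: integrable_test_fun test_fun_mult test_fun_pd smooth_pd x_dir_Basis)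
  have "(LBINT z. laplace_x \<eta> z * w z) = (\<Sum>i\<in>UNIV. LBINT z. ?D i (?D i \<eta>) z * w z)"
    unfolding laplace_x_def sum_distrib_right using i by (intro Bochner_Integration.integral_sum) auto
  also have "\<dots> = (\<Sum>i\<in>UNIV. LBINT z. \<eta> z * ?D i (?D i w) z)"
  proof (rule sum.cong[OF refl])
    fix i
    show "(LBINT z. ?D i (?D i \<eta>) z * w z) = (LBINT z. \<eta> z * ?D i (?D i w) z)"
      using integral_by_parts_test[OF test_fun_pd[OF \<eta> x_dir_Basis] w x_dir_Basis, of i i]
        integral_by_parts_test[OF \<eta> smooth_pd[OF w x_dir_Basis] x_dir_Basis, of i i] by linarith
  qed
  also have "\<dots> = (LBINT z. \<eta> z * laplace_x w z)"
    unfolding laplace_x_def sum_distrib_left using i by (intro Bochner_Integration.integral_sum[symmetric]) auto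
  finally show ?thesis .
qed

lemma pd_diff:
  fixes f g :: "'a::euclidean_space \<Rightarrow> real"
  assumes "f differentiable (at z)" "g differentiable (at z)"
  shows "pd b (\<lambda>z. f z - g z) z = pd b f z - pd b g z"
  by (rule pd_eq[OF has_derivative_diff[OF assms[THEN has_derivative_frechet]]])

lemma pd_diff_smooth:
  "smooth f \<Longrightarrow> smooth g \<Longrightarrow> pd b (\<lambda>z. f z - g z) z = pd b f z - pd b g z"
  by (intro pd_diff smooth_differentiable)

lemma pd_mult_smooth:
  "smooth f \<Longrightarrow> smooth g \<Longrightarrow> pd b (\<lambda>z. f z * g z) z = f z * pd b g z + pd b f z * g z"
  by (intro pd_mult smooth_differentiable)

lemma pd_add_smooth:
  "smooth f \<Longrightarrow> smooth g \<Longrightarrow> pd b (\<lambda>z. f z + g z) z = pd b f z + pd b g z"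
  by (intro pd_add smooth_differentiable)

lemma laplace_diff:
  assumes "smooth f" "smooth g"
  shows "laplace_x (\<lambda>z. f z - g z) = (\<lambda>z. laplace_x f z - laplace_x g z)"
  unfolding laplace_x_def[abs_def]
  by (simp add: pd_diff_smooth assms smooth_pd x_dir_Basis sum_subtractf)

lemma laplace_mult:
  assumes f: "smooth f" and g: "smooth g"
  shows "laplace_x (\<lambda>z. f z * g z) z = f z * laplace_x g z + laplace_x f z * g z
    + 2 * (\<Sum>i\<in>UNIV. pdx i f z * pdx i g z)"
proof -
  note s = f g smooth_pd[OF f x_dir_Basis] smooth_pd[OF g x_dir_Basis]
  have "pdx i (pdx i (\<lambda>z. f z * g z)) z =
    f z * pdx i (pdx i g) z + pdx i (pdx i f) z * g z
    + 2 * (pdx i f z * pdx i g z)" for i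
    by (simp add: pd_mult_smooth[OF f g] pd_add_smooth pd_mult_smooth smooth_mult s)
  then show ?thesis
    unfolding laplace_x_def by (simp add: sum.distrib sum_distrib_left sum_distrib_right)
qed

lemma laplace_reflect:
  assumes "smooth f"
  shows "laplace_x (\<lambda>y. f (z - y)) y = laplace_x f (z - y)"
proof -
  have "pdx i (\<lambda>y. f (z - y)) = (\<lambda>y. (-1) * pdx i f (z - y))" for i
    using pd_reflect[OF smooth_differentiable[OF assms]] by auto
  moreover have "pdx i (\<lambda>y. (-1) * pdx i f (z - y)) y = pdx i (pdx i f) (z - y)" for i
    using pd_cmult[OF smooth_differentiable[OF smooth_reflect[OF smooth_pd[OF assms x_dir_Basis]]], where c = "-1"]
      pd_reflect[OF smooth_differentiable[OF smooth_pd[OF assms x_dir_Basis]]] by simp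
  ultimately show ?thesis unfolding laplace_x_def by simp
qed

lemma has_weak_laplacian_real:
  fixes f g :: "real \<times> (real ^ 'n) \<Rightarrow> real"
  assumes "has_weak_laplacian f g"
  shows "loc_integrable f" "loc_integrable g"
    "test_fun \<eta> \<Longrightarrow> (LBINT z. laplace_x \<eta> z * f z) = (LBINT z. \<eta> z * g z)"
  using assms by (auto simp: has_weak_laplacian_def)

text \<open>Both derivatives fall on the kernel; reflection changes the sign twice, so the Laplacian
  of the reflected kernel can be tested directly.\<close>

lemma laplace_mollify:
  fixes f g :: "real \<times> (real ^ 'n) \<Rightarrow> real"
  assumes "has_weak_laplacian f g"
  shows "laplace_x (mollify n f) = mollify n g"
proof
  fix z :: "real \<times> (real ^ 'n)"
  note f = has_weak_laplacian_real[OF assms]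
  note b = x_dir_Basis
  have "laplace_x (mollify n f) z = (\<Sum>i\<in>(UNIV::'n set). conv (pdx i (pdx i (moll n))) f z)"
    unfolding laplace_x_def pd_conv[OF moll(1) f(1) b] fun_cong[OF pd_conv[OF test_fun_pd[OF moll(1) b] f(1) b]] ..
  also have "\<dots> = (LBINT y. (\<Sum>i\<in>UNIV. pdx i (pdx i (moll n)) (z - y) * f y))"
    unfolding conv_def
    by (intro Bochner_Integration.integral_sum[symmetric] conv_integrable[OF _ f(1)] test_fun_pd moll(1) b)
  also have "\<dots> = (LBINT y. laplace_x (\<lambda>y. moll n (z - y)) y * f y)"
    unfolding laplace_reflect[OF test_fun_smooth[OF moll(1)]] by (simp add: laplace_x_def sum_distrib_right)
  also have "\<dots> = mollify n g z"
    unfolding conv_def by (rule f(3)[OF test_fun_reflect[OF moll(1)]])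
  finally show "laplace_x (mollify n f) z = mollify n g z" .
qed

lemma has_weak_laplacian_limit:
  fixes f g :: "real \<times> (real ^ 'n) \<Rightarrow> real"
  assumes F: "L1loc F f" and G: "L1loc G g" and s: "\<And>n. smooth (F n)"
    and d: "\<And>n. laplace_x (F n) = G n"
  shows "has_weak_laplacian f g"
  unfolding has_weak_laplacian_def
proof (intro conjI allI impI)
  fix \<eta> :: "real \<times> (real ^ 'n) \<Rightarrow> real" assume \<eta>: "test_fun \<eta>"
  have "(\<lambda>n. LBINT z. laplace_x \<eta> z * F n z) \<longlonglongrightarrow> (LBINT z. laplace_x \<eta> z * f z)"
    by (rule L1loc_test[OF F test_fun_laplace[OF \<eta>]])
  moreover have "(LBINT z. laplace_x \<eta> z * F n z) = (LBINT z. \<eta> z * G n z)" for n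
    using laplace_by_parts[OF \<eta> s] by (simp add: d)
  moreover have "(\<lambda>n. LBINT z. \<eta> z * G n z) \<longlonglongrightarrow> (LBINT z. \<eta> z * g z)"
    by (rule L1loc_test[OF G \<eta>])
  ultimately show "(LBINT z. laplace_x \<eta> z *\<^sub>R f z) = (LBINT z. \<eta> z *\<^sub>R g z)"
    using LIMSEQ_unique by fastforce
qed (use F G in \<open>auto simp: L1loc_def\<close>)

text \<open>Integrate \<Delta>(w^2) = 2 w \<Delta>w + 2 |\<nabla>w|^2 against \<eta> and move the
  Laplacian on the left to \<eta>.\<close>

lemma energy_identity:
  assumes \<eta>: "test_fun \<eta>" and w: "smooth w"
  shows "(LBINT z. \<eta> z * (\<Sum>i\<in>UNIV. (pdx i w z)\<^sup>2)) =
    (LBINT z. laplace_x \<eta> z * (w z * w z) / 2 - \<eta> z * (w z * laplace_x w z))"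
proof -
  have i: "integrable lborel (\<lambda>z. laplace_x \<eta> z * (w z * w z))" "integrable lborel (\<lambda>z. \<eta> z * (w z * laplace_x w z))"
     "integrable lborel (\<lambda>z. \<eta> z * (\<Sum>i\<in>UNIV. (pdx i w z)\<^sup>2))"
    by (intro integrable_test_fun test_fun_mult test_fun_laplace smooth_mult smooth_laplace smooth_sum smooth_power smooth_pd x_dir_Basis \<eta> w)+
  have "(LBINT z. laplace_x \<eta> z * (w z * w z)) = (LBINT z. \<eta> z * laplace_x (\<lambda>z. w z * w z) z)"
    by (rule laplace_by_parts[OF \<eta> smooth_mult[OF w w]])
  also have "\<dots> = (LBINT z. 2 * (\<eta> z * (w z * laplace_x w z)) + 2 * (\<eta> z * (\<Sum>i\<in>UNIV. (pdx i w z)\<^sup>2)))"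
    by (simp add: laplace_mult[OF w w] algebra_simps power2_eq_square)
  also have "\<dots> = 2 * (LBINT z. \<eta> z * (w z * laplace_x w z)) + 2 * (LBINT z. \<eta> z * (\<Sum>i\<in>UNIV. (pdx i w z)\<^sup>2))"
    using i by simp
  finally show ?thesis using i by (simp add: add_divide_distrib)
qed

text \<open>A bump of radius R + 1 divided by c, its value at norm R. As \<open>flat 0\<close>
  increases on positive arguments, c is its least value on the ball of radius R.\<close>

lemma test_fun_cutoff:
  assumes "R \<ge> 0"
  obtains \<eta> :: "'a::euclidean_space \<Rightarrow> real" where "test_fun \<eta>" "\<And>z. \<eta> z \<ge> 0" "\<And>z. norm z \<le> R \<Longrightarrow> \<eta> z \<ge> 1"
proof -
  define r where "r = R + 1"
  define c where "c = flat 0 (r\<^sup>2 - R\<^sup>2)"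
  have "R\<^sup>2 < r\<^sup>2" using assms by (simp add: r_def power_strict_mono)
  then have c: "c > 0" by (simp add: c_def flat_def)
  have mono: "flat 0 x \<le> flat 0 y" if "0 < x" "x \<le> y" for x y
    using that by (auto simp: flat_def le_imp_inverse_le)
  have "test_fun (\<lambda>z::'a. flat 0 (r\<^sup>2 - (norm z)\<^sup>2) * inverse c)"
    using assms by (intro test_fun_mult test_fun_bump smooth_const) (simp add: r_def)
  moreover have "flat 0 (r\<^sup>2 - (norm z)\<^sup>2) * inverse c \<ge> 0" for z :: 'a
    using c by (simp add: flat_def)
  moreover have "flat 0 (r\<^sup>2 - (norm z)\<^sup>2) * inverse c \<ge> 1" if "norm z \<le> R" for z :: 'a
  proof -
    have "(norm z)\<^sup>2 \<le> R\<^sup>2" using that by (simp add: power_mono)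
    then have "c \<le> flat 0 (r\<^sup>2 - (norm z)\<^sup>2)" unfolding c_def using \<open>R\<^sup>2 < r\<^sup>2\<close> by (intro mono) auto
    then show ?thesis using c by (simp add: field_simps)
  qed
  ultimately show ?thesis using that by blast
qed

lemma mollify_gradient_Cauchy:
  fixes f g :: "real \<times> (real ^ 'n) \<Rightarrow> real"
  assumes fg: "has_weak_laplacian f g" and C: "AE z in lborel. \<bar>f z\<bar> \<le> C" and e: "e > 0"
  shows "\<exists>N. \<forall>n\<ge>N. \<forall>m\<ge>N. (LBINT z. indicator (cball 0 R) z *
      (pdx i (mollify n f) z - pdx i (mollify m f) z)\<^sup>2) < e"
proof -
  note f = has_weak_laplacian_real[OF fg]
  note s = smooth_mollify[OF f(1)]
  obtain \<eta> :: "real \<times> (real ^ 'n) \<Rightarrow> real" where \<eta>: "test_fun \<eta>" "\<And>z. \<eta> z \<ge> 0" "\<And>z. norm z \<le> \<bar>R\<bar> \<Longrightarrow> \<eta> z \<ge> 1"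
    by (rule test_fun_cutoff[of "\<bar>R\<bar>"]) auto
  obtain M1 R1 where M1: "M1 > 0" "\<And>z. \<bar>\<eta> z\<bar> \<le> M1 * indicator (cball 0 R1) z"
    by (rule test_fun_bounds[OF \<eta>(1)]) blast
  obtain M2 R2 where M2: "M2 > 0" "\<And>z. \<bar>laplace_x \<eta> z\<bar> \<le> M2 * indicator (cball 0 R2) z"
    by (rule test_fun_bounds[OF test_fun_laplace[OF \<eta>(1)]]) blast
  define r where "r = max R1 R2"
  define M where "M = max M1 M2"
  have M: "\<bar>\<eta> z\<bar> \<le> M * indicator (cball 0 r) z" "\<bar>laplace_x \<eta> z\<bar> \<le> M * indicator (cball 0 r) z" for z
  proof -
    have "M1 * indicator (cball 0 R1) z \<le> M * indicator (cball 0 r) z"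
      "M2 * indicator (cball 0 R2) z \<le> M * indicator (cball 0 r) z"
      using M1(1) M2(1) by (auto simp: M_def r_def indicator_def le_max_iff_disj)
    then show "\<bar>\<eta> z\<bar> \<le> M * indicator (cball 0 r) z" "\<bar>laplace_x \<eta> z\<bar> \<le> M * indicator (cball 0 r) z"
      using M1(2)[of z] M2(2)[of z] by simp_all
  qed
  \<comment> \<open>A mollification is bounded by C at every point, in particular at an arbitrary
    one, which forces C to be nonnegative.\<close>
  have C0: "C \<ge> 0" using mollify_bound[OF f(1) C, of 0 undefined] abs_ge_zero order_trans by blast
  have M0: "M \<ge> 0" using M1(1) by (simp add: M_def)
  \<comment> \<open>Here 2 C bounds |w|, a difference of two mollifications, and M bounds both
    \<eta> and its Laplacian.\<close>
  define K where "K = 2 * C * M"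
  have K0: "K \<ge> 0" using C0 M0 by (simp add: K_def)
  define A where "A = (\<lambda>n. ball_int r (\<lambda>z. \<bar>mollify n f z - f z\<bar>) +
       ball_int r (\<lambda>z. \<bar>mollify n g z - g z\<bar>))"
  have "A \<longlonglongrightarrow> 0 + 0" unfolding A_def by (intro tendsto_intros mollify_L1 f)
  then have "(\<lambda>n. K * A n) \<longlonglongrightarrow> K * (0 + 0)" by (intro tendsto_intros)
  then obtain N where N: "\<And>n. n \<ge> N \<Longrightarrow> norm (K * A n - 0) < e / 2"
    using e unfolding LIMSEQ_iff by (metis add.right_neutral half_gt_zero mult_zero_right)
  have "ball_int R (\<lambda>z. (pdx i (mollify n f) z - pdx i (mollify m f) z)\<^sup>2) < e"
    if nm: "n \<ge> N" "m \<ge> N" for n m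
  proof -
    define w where "w = (\<lambda>z. mollify n f z - mollify m f z)"
    have w: "smooth w" unfolding w_def by (intro smooth_diff s)
    have lw: "laplace_x w = (\<lambda>z. mollify n g z - mollify m g z)"
      unfolding w_def laplace_diff[OF s s] laplace_mollify[OF fg] ..
    have wb: "\<bar>w z\<bar> \<le> 2 * C" for z
      using mollify_bound[OF f(1) C, of n z] mollify_bound[OF f(1) C, of m z] by (simp add: w_def)
    have dw: "pdx i w z = pdx i (mollify n f) z - pdx i (mollify m f) z" for z i
      unfolding w_def by (rule pd_diff) (intro smooth_differentiable s)+
    note sl = smooth_laplace[OF w] smooth_pd[OF w x_dir_Basis]
    have cb: "integrable lborel (\<lambda>z. indicator (cball 0 r) z * h z)" if "loc_integrable h"
      for h :: "real \<times> (real ^ 'n) \<Rightarrow> real" and r by (rule integrable_cball_mult[OF that])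
    define T where "T = (\<lambda>n z. indicator (cball 0 r) z * \<bar>mollify n f z - f z\<bar> + indicator (cball 0 r) z * \<bar>mollify n g z - g z\<bar>)"
    have Ti: "integrable lborel (T n)" for n unfolding T_def
      by (intro Bochner_Integration.integrable_add integrable_cball_abs loc_integrable_diff loc_integrable_smooth smooth_mollify f)
    have TA: "(LBINT z. T n z) = A n" for n unfolding T_def A_def
      by (intro Bochner_Integration.integral_add integrable_cball_abs loc_integrable_diff loc_integrable_smooth smooth_mollify f)
    have "ball_int R (\<lambda>z. (pdx i w z)\<^sup>2) \<le>
        (LBINT z. \<eta> z * (\<Sum>i\<in>UNIV. (pdx i w z)\<^sup>2))"
    proof (rule integral_mono)
      show "integrable lborel (\<lambda>z. indicator (cball 0 R) z * (pdx i w z)\<^sup>2)"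
        by (intro cb loc_integrable_smooth smooth_power sl)
      show "integrable lborel (\<lambda>z. \<eta> z * (\<Sum>i\<in>UNIV. (pdx i w z)\<^sup>2))"
        by (intro integrable_test_fun test_fun_mult \<eta> smooth_sum smooth_power sl)
      fix z
      have "(pdx i w z)\<^sup>2 \<le> (\<Sum>i\<in>UNIV. (pdx i w z)\<^sup>2)"
        by (rule member_le_sum) auto
      moreover have "indicator (cball 0 R) z \<le> \<eta> z" using \<eta>(2)[of z] \<eta>(3)[of z] by (auto simp: indicator_def)
      ultimately show "indicator (cball 0 R) z * (pdx i w z)\<^sup>2 \<le> \<eta> z * (\<Sum>i\<in>UNIV. (pdx i w z)\<^sup>2)"
        using \<eta>(2) by (intro mult_mono) auto
    qed
    also have "\<dots> = (LBINT z. laplace_x \<eta> z * (w z * w z) / 2 - \<eta> z * (w z * laplace_x w z))"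
      by (rule energy_identity[OF \<eta>(1) w])
    also have "\<dots> \<le> (LBINT z. K * (T n z + T m z))"
    proof (rule integral_mono)
      show "integrable lborel (\<lambda>z. laplace_x \<eta> z * (w z * w z) / 2 - \<eta> z * (w z * laplace_x w z))"
        by (intro Bochner_Integration.integrable_diff integrable_divide integrable_test_fun test_fun_mult test_fun_laplace \<eta> smooth_mult w sl)
      show "integrable lborel (\<lambda>z. K * (T n z + T m z))" using Ti by auto
      fix z :: "real \<times> (real ^ 'n)"
      let ?I = "indicator (cball 0 r) z :: real"
      have 1: "laplace_x \<eta> z * (w z * w z) / 2 \<le> K * (indicator (cball 0 r) z * \<bar>w z\<bar>)"
      proof -
        have "laplace_x \<eta> z * (w z * w z) \<le> \<bar>laplace_x \<eta> z\<bar> * (\<bar>w z\<bar> * \<bar>w z\<bar>)"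
          by (rule order_trans[OF abs_ge_self]) (simp add: abs_mult)
        also have "\<dots> \<le> (M * indicator (cball 0 r) z) * (2 * C * \<bar>w z\<bar>)"
          using M0 C0 by (intro mult_mono M wb) auto
        also have "\<dots> = K * (indicator (cball 0 r) z * \<bar>w z\<bar>)" by (simp add: K_def mult_ac)
        finally show ?thesis using mult_nonneg_nonneg[OF K0, of "?I * \<bar>w z\<bar>"] by simp
      qed
      have 2: "- (\<eta> z * (w z * laplace_x w z)) \<le> K * (indicator (cball 0 r) z * \<bar>laplace_x w z\<bar>)"
      proof -
        have "- (\<eta> z * (w z * laplace_x w z)) \<le> \<bar>\<eta> z\<bar> * (\<bar>w z\<bar> * \<bar>laplace_x w z\<bar>)"
          by (rule order_trans[OF abs_ge_minus_self]) (simp add: abs_mult)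
        also have "\<dots> \<le> (M * indicator (cball 0 r) z) * (2 * C * \<bar>laplace_x w z\<bar>)"
          using M0 C0 by (intro mult_mono M wb) auto
        also have "\<dots> = K * (indicator (cball 0 r) z * \<bar>laplace_x w z\<bar>)" by (simp add: K_def mult_ac)
        finally show ?thesis .
      qed
      \<comment> \<open>Inserting f and g splits each difference of two mollifications into the
        errors of the two, which \<open>N\<close> controls separately.\<close>
      have "indicator (cball 0 r) z * \<bar>w z\<bar> + indicator (cball 0 r) z * \<bar>laplace_x w z\<bar> \<le> T n z + T m z"
      proof (cases "z \<in> cball 0 r")
        case True
        have "\<bar>w z\<bar> \<le> \<bar>mollify n f z - f z\<bar> + \<bar>mollify m f z - f z\<bar>" unfolding w_def by linarith
        moreover have "\<bar>laplace_x w z\<bar> \<le> \<bar>mollify n g z - g z\<bar> + \<bar>mollify m g z - g z\<bar>"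
          unfolding lw by linarith
        ultimately show ?thesis using True unfolding T_def by simp
      qed (simp add: T_def)
      from mult_left_mono[OF this K0] 1 2
      show "laplace_x \<eta> z * (w z * w z) / 2 - \<eta> z * (w z * laplace_x w z) \<le> K * (T n z + T m z)"
        unfolding distrib_left by linarith
    qed
    also have "\<dots> = K * A n + K * A m" using Ti by (simp add: TA distrib_left)
    also have "\<dots> < e" using N[OF nm(1)] N[OF nm(2)] by simp
    finally show ?thesis unfolding dw .
  qed
  then show ?thesis by blast
qed

text \<open>The second conclusion records the strong convergence of the gradients. It, and not just
  existence of G, identifies the Laplacian of the square of f.\<close>

lemma weak_gradient_exists:
  fixes f g :: "real \<times> (real ^ 'n) \<Rightarrow> real"
  assumes fg: "has_weak_laplacian f g" and C: "AE z in lborel. \<bar>f z\<bar> \<le> C"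
  obtains G where "has_weak_deriv f (x_dir i) G"
    "L1loc (\<lambda>n z. (pdx i (mollify n f) z)\<^sup>2) (\<lambda>z. (G z)\<^sup>2)"
proof -
  note f = has_weak_laplacian_real[OF fg]
  note s = smooth_mollify[OF f(1)]
  let ?F = "\<lambda>n. pdx i (mollify n f)"
  have c: "continuous_on UNIV (?F n)" for n by (rule smooth_continuous[OF smooth_pd[OF s x_dir_Basis]])
  obtain G where G: "\<And>n. loc_integrable (\<lambda>z. (?F n z - G z)\<^sup>2)" "G \<in> borel_measurable borel"
     "\<And>R. (\<lambda>n. ball_int R (\<lambda>z. (?F n z - G z)\<^sup>2)) \<longlonglongrightarrow> 0"
    using L2loc_complete[OF c mollify_gradient_Cauchy[OF fg C]] by blast
  note L = L1loc_of_L2[OF c G(2) G(1) G(3)]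
  have "has_weak_deriv f (x_dir i) G"
    by (rule has_weak_deriv_limit[OF L1loc_mollify[OF f(1)] L(1) s refl x_dir_Basis])
  with L(2) show ?thesis using that by blast
qed

text \<open>Covers distributional derivatives (\<open>P = - \<partial>\<^sub>e\<close>) and Laplacians (\<open>P = \<Delta>\<close>) at once.\<close>

definition weak_adjoint ::
  "(('a::euclidean_space \<Rightarrow> real) \<Rightarrow> 'a \<Rightarrow> real) \<Rightarrow> ('a \<Rightarrow> 'b::euclidean_space) \<Rightarrow> ('a \<Rightarrow> 'b) \<Rightarrow> bool" where
  "weak_adjoint P f g \<longleftrightarrow> loc_integrable f \<and> loc_integrable g \<and>
     (\<forall>\<eta>. test_fun \<eta> \<longrightarrow> (LBINT z. P \<eta> z *\<^sub>R f z) = (LBINT z. \<eta> z *\<^sub>R g z))"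

definition test_op :: "(('a::euclidean_space \<Rightarrow> real) \<Rightarrow> 'a \<Rightarrow> real) \<Rightarrow> bool" where
  "test_op P \<longleftrightarrow> (\<forall>\<eta>. test_fun \<eta> \<longrightarrow> test_fun (P \<eta>))"

lemma has_weak_deriv_iff:
  fixes f :: "'a::euclidean_space \<Rightarrow> 'b::euclidean_space"
  shows "has_weak_deriv f e g \<longleftrightarrow> weak_adjoint (\<lambda>\<eta> z. - pd e \<eta> z) f g"
proof -
  have "a = - b \<longleftrightarrow> - a = b" for a b :: 'b by auto
  then show ?thesis unfolding has_weak_deriv_def weak_adjoint_def by simp
qed

lemma has_weak_laplacian_iff: "has_weak_laplacian f g \<longleftrightarrow> weak_adjoint laplace_x f g"
  unfolding has_weak_laplacian_def weak_adjoint_def ..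

lemma test_op_laplace: "test_op laplace_x" by (simp add: test_op_def test_fun_laplace)

lemma test_op_pd:
  assumes "e \<in> Basis" shows "test_op (\<lambda>\<eta> z. - pd e \<eta> z)"
  using test_fun_mult[OF test_fun_pd[OF _ assms] smooth_const[of "-1"]] by (simp add: test_op_def)

lemma weak_adjoint_unique:
  fixes f :: "'a::euclidean_space \<Rightarrow> 'b::euclidean_space"
  assumes "weak_adjoint P f g" "weak_adjoint P f h"
  shows "AE z in lborel. g z = h z"
proof -
  have li: "loc_integrable g" "loc_integrable h" using assms by (auto simp: weak_adjoint_def)
  have "AE z in lborel. g z - h z = 0"
  proof (rule AE_eq_0_if_test_zero')
    show "loc_integrable (\<lambda>z. g z - h z)" by (intro loc_integrable_diff li)
    fix \<eta> :: "'a \<Rightarrow> real" assume \<eta>: "test_fun \<eta>"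
    have "(LBINT z. \<eta> z *\<^sub>R g z) = (LBINT z. \<eta> z *\<^sub>R h z)"
      using assms \<eta> unfolding weak_adjoint_def by simp
    then show "(LBINT z. \<eta> z *\<^sub>R (g z - h z)) = 0"
      using integrable_test[OF \<eta> li(1)] integrable_test[OF \<eta> li(2)] by (simp add: scaleR_diff_right)
  qed
  then show ?thesis by simp
qed

lemma weak_adjoint_cong_AE:
  fixes f :: "'a::euclidean_space \<Rightarrow> 'b::euclidean_space"
  assumes fg: "weak_adjoint P f g" and P: "test_op P"
    and AE: "AE z in lborel. f z = f' z" "AE z in lborel. g z = g' z"
    and m: "f' \<in> borel_measurable borel" "g' \<in> borel_measurable borel"
  shows "weak_adjoint P f' g'"
  unfolding weak_adjoint_def
proof (intro conjI allI impI)
  have li: "loc_integrable f" "loc_integrable g" using fg by (auto simp: weak_adjoint_def)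
  show "loc_integrable f'" by (rule loc_integrable_cong_AE[OF li(1) m(1)]) (use AE in auto)
  show "loc_integrable g'" by (rule loc_integrable_cong_AE[OF li(2) m(2)]) (use AE in auto)
  fix \<eta> :: "'a \<Rightarrow> real" assume \<eta>: "test_fun \<eta>"
  then have "test_fun (P \<eta>)" using P by (simp add: test_op_def)
  note [measurable] = m li[THEN loc_integrable_measurable] test_fun_measurable[OF \<eta>] test_fun_measurable[OF this]
  have "(LBINT z. P \<eta> z *\<^sub>R f' z) = (LBINT z. P \<eta> z *\<^sub>R f z)"
    by (rule integral_cong_AE) (use AE in \<open>auto\<close>)
  also have "\<dots> = (LBINT z. \<eta> z *\<^sub>R g z)" using fg \<eta> by (auto simp: weak_adjoint_def)
  also have "\<dots> = (LBINT z. \<eta> z *\<^sub>R g' z)"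
    by (rule integral_cong_AE) (use AE in \<open>auto\<close>)
  finally show "(LBINT z. P \<eta> z *\<^sub>R f' z) = (LBINT z. \<eta> z *\<^sub>R g' z)" .
qed

lemma weak_adjoint_add:
  assumes fg: "weak_adjoint P f g" "weak_adjoint P f' g'" and P: "test_op P"
  shows "weak_adjoint P (\<lambda>z. f z + f' z) (\<lambda>z. g z + g' z)"
  unfolding weak_adjoint_def
proof (intro conjI allI impI)
  have li: "loc_integrable f" "loc_integrable g" "loc_integrable f'" "loc_integrable g'"
    using fg by (auto simp: weak_adjoint_def)
  show "loc_integrable (\<lambda>z. f z + f' z)" "loc_integrable (\<lambda>z. g z + g' z)"
    by (intro loc_integrable_add li)+
  fix \<eta> :: "'a \<Rightarrow> real" assume \<eta>: "test_fun \<eta>"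
  then have P\<eta>: "test_fun (P \<eta>)" using P by (simp add: test_op_def)
  show "(LBINT z. P \<eta> z *\<^sub>R (f z + f' z)) = (LBINT z. \<eta> z *\<^sub>R (g z + g' z))"
    using fg \<eta> integrable_test[OF \<eta> li(2)] integrable_test[OF \<eta> li(4)]
      integrable_test[OF P\<eta> li(1)] integrable_test[OF P\<eta> li(3)]
    by (simp add: scaleR_add_right weak_adjoint_def)
qed

lemma weak_adjoint_linear:
  fixes f g :: "'a::euclidean_space \<Rightarrow> 'b::euclidean_space" and L :: "'b \<Rightarrow> 'c::euclidean_space"
  assumes fg: "weak_adjoint P f g" and P: "test_op P" and L: "bounded_linear L"
  shows "weak_adjoint P (\<lambda>z. L (f z)) (\<lambda>z. L (g z))"
  unfolding weak_adjoint_def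
proof (intro conjI allI impI)
  interpret bounded_linear L by fact
  have li: "loc_integrable f" "loc_integrable g" using fg by (auto simp: weak_adjoint_def)
  show "loc_integrable (\<lambda>z. L (f z))" "loc_integrable (\<lambda>z. L (g z))"
    by (rule loc_integrable_linear[OF L li(1)], rule loc_integrable_linear[OF L li(2)])
  fix \<eta> :: "'a \<Rightarrow> real" assume \<eta>: "test_fun \<eta>"
  then have P\<eta>: "test_fun (P \<eta>)" using P by (simp add: test_op_def)
  have "(LBINT z. P \<eta> z *\<^sub>R L (f z)) = L (LBINT z. P \<eta> z *\<^sub>R f z)"
    using integral_bounded_linear[OF L integrable_test[OF P\<eta> li(1)]] by (simp add: scaleR)
  also have "\<dots> = L (LBINT z. \<eta> z *\<^sub>R g z)" using fg \<eta> by (simp add: weak_adjoint_def)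
  also have "\<dots> = (LBINT z. \<eta> z *\<^sub>R L (g z))"
    using integral_bounded_linear[OF L integrable_test[OF \<eta> li(2)]] by (simp add: scaleR)
  finally show "(LBINT z. P \<eta> z *\<^sub>R L (f z)) = (LBINT z. \<eta> z *\<^sub>R L (g z))" .
qed

lemmas has_weak_deriv_unique = weak_adjoint_unique[where P = "\<lambda>\<eta> z. - pd e \<eta> z" for e, folded has_weak_deriv_iff]
  and has_weak_laplacian_unique = weak_adjoint_unique[where P = laplace_x, folded has_weak_laplacian_iff]

text \<open>From f g = ((f + g)^2 - f^2 - g^2) / 2. The same reduction to squares serves for first
  derivatives and for the Laplacian.\<close>

lemma weak_adjoint_polarize:
  fixes f g f' g' f2 g2 fg2 :: "'a::euclidean_space \<Rightarrow> real"
  assumes P: "test_op P"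
    and "weak_adjoint P (\<lambda>z. f z * f z) f2" "weak_adjoint P (\<lambda>z. g z * g z) g2"
    and "weak_adjoint P (\<lambda>z. (f z + g z) * (f z + g z)) fg2"
  shows "weak_adjoint P (\<lambda>z. f z * g z) (\<lambda>z. (fg2 z - f2 z - g2 z) / 2)"
proof -
  have "weak_adjoint P
      (\<lambda>z. 1/2 * ((f z + g z) * (f z + g z)) + ((-1/2) * (f z * f z) + (-1/2) * (g z * g z)))
      (\<lambda>z. 1/2 * fg2 z + ((-1/2) * f2 z + (-1/2) * g2 z))"
    by (rule weak_adjoint_add weak_adjoint_linear[OF _ _ bounded_linear_mult_right] assms)+
  also have "(\<lambda>z. 1/2 * ((f z + g z) * (f z + g z)) + ((-1/2) * (f z * f z) + (-1/2) * (g z * g z)))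
    = (\<lambda>z. f z * g z)" by (rule ext) (simp add: field_simps)
  also have "(\<lambda>z. 1/2 * fg2 z + ((-1/2) * f2 z + (-1/2) * g2 z)) = (\<lambda>z. (fg2 z - f2 z - g2 z) / 2)"
    by (rule ext) (simp add: field_simps)
  finally show ?thesis .
qed

text \<open>The classical formula for the squared mollifications converges term by term: f \<Delta>f
  by boundedness of f, the squared gradient by strong convergence. The limit gradient G is then
  replaced by the given h, which agrees with it almost everywhere.\<close>

lemma weak_laplacian_mult_self:
  fixes f g :: "real \<times> (real ^ 'n) \<Rightarrow> real"
  assumes fg: "has_weak_laplacian f g" and C: "AE z in lborel. \<bar>f z\<bar> \<le> C"
    and h: "\<And>i. has_weak_deriv f (x_dir i) (h i)"
  shows "loc_integrable (\<lambda>z. (h i z)\<^sup>2)"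
    "has_weak_laplacian (\<lambda>z. f z * f z) (\<lambda>z. 2 * (f z * g z) + 2 * (\<Sum>i\<in>UNIV. (h i z)\<^sup>2))"
proof -
  note f = has_weak_laplacian_real[OF fg]
  note s = smooth_mollify[OF f(1)]
  have "\<exists>G. has_weak_deriv f (x_dir i) G \<and> L1loc (\<lambda>n z. (pdx i (mollify n f) z)\<^sup>2) (\<lambda>z. (G z)\<^sup>2)" for i
    using weak_gradient_exists[OF fg C, of i] by blast
  then obtain G where G: "\<And>i. has_weak_deriv f (x_dir i) (G i)"
      "\<And>i. L1loc (\<lambda>n z. (pdx i (mollify n f) z)\<^sup>2) (\<lambda>z. (G i z)\<^sup>2)" by metis
  have hG: "AE z in lborel. G i z = h i z" for i by (rule has_weak_deriv_unique[OF G(1) h])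
  have hm [measurable]: "h i \<in> borel_measurable borel" for i
    using h[of i] by (auto simp: has_weak_deriv_def intro: loc_integrable_measurable)
  have fm [measurable]: "f \<in> borel_measurable borel" "g \<in> borel_measurable borel"
    using f by (auto intro: loc_integrable_measurable)
  show "loc_integrable (\<lambda>z. (h i z)\<^sup>2)"
  proof (rule loc_integrable_cong_AE)
    show "loc_integrable (\<lambda>z. (G i z)\<^sup>2)" using G(2)[of i] by (simp add: L1loc_def)
    show "AE z in lborel. (h i z)\<^sup>2 = (G i z)\<^sup>2" using hG[of i] by eventually_elim simp
  qed measurable
  have B: "AE z in lborel. \<bar>mollify n f z\<bar> \<le> C" for n using mollify_bound[OF f(1) C] by simp
  have "has_weak_laplacian (\<lambda>z. f z * f z) (\<lambda>z. 2 * (f z * g z) + 2 * (\<Sum>i\<in>UNIV. (G i z)\<^sup>2))"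
  proof (rule has_weak_laplacian_limit)
    show "L1loc (\<lambda>n z. mollify n f z * mollify n f z) (\<lambda>z. f z * f z)"
      by (rule L1loc_mult[OF L1loc_mollify L1loc_mollify B C]) (rule f)+
    show "L1loc (\<lambda>n z. 2 * (mollify n f z * mollify n g z) + 2 * (\<Sum>i\<in>UNIV. (pdx i (mollify n f) z)\<^sup>2))
      (\<lambda>z. 2 * (f z * g z) + 2 * (\<Sum>i\<in>UNIV. (G i z)\<^sup>2))"
      by (intro L1loc_add L1loc_cmult L1loc_sum L1loc_mult[OF L1loc_mollify L1loc_mollify B C] G(2) f)
    show "smooth (\<lambda>z. mollify n f z * mollify n f z)" for n by (intro smooth_mult s)
    show "laplace_x (\<lambda>z. mollify n f z * mollify n f z) =
       (\<lambda>z. 2 * (mollify n f z * mollify n g z) + 2 * (\<Sum>i\<in>UNIV. (pdx i (mollify n f) z)\<^sup>2))" for n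
      by (simp add: laplace_mult[OF s s] laplace_mollify[OF fg] fun_eq_iff power2_eq_square)
  qed
  then show "has_weak_laplacian (\<lambda>z. f z * f z) (\<lambda>z. 2 * (f z * g z) + 2 * (\<Sum>i\<in>UNIV. (h i z)\<^sup>2))"
    unfolding has_weak_laplacian_iff
  proof (rule weak_adjoint_cong_AE[OF _ test_op_laplace])
    have "AE z in lborel. \<forall>i. G i z = h i z" unfolding AE_all_countable using hG by blast
    then show "AE z in lborel. 2 * (f z * g z) + 2 * (\<Sum>i\<in>UNIV. (G i z)\<^sup>2) = 2 * (f z * g z) + 2 * (\<Sum>i\<in>UNIV. (h i z)\<^sup>2)"
      by eventually_elim simp
  qed (simp, measurable)
qed

subsection \<open>Product rules\<close>

text \<open>Product rules produce explicit formulas, which agree with the chosen representatives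
  only almost everywhere; hence the derivatives are arguments here. The bound is included because
  the product rules depend on it.\<close>

definition has_jet ::
  "(real \<times> (real ^ 'n) \<Rightarrow> 'b::euclidean_space) \<Rightarrow> (real \<times> (real ^ 'n) \<Rightarrow> 'b) \<Rightarrow>
   ('n \<Rightarrow> real \<times> (real ^ 'n) \<Rightarrow> 'b) \<Rightarrow> (real \<times> (real ^ 'n) \<Rightarrow> 'b) \<Rightarrow> bool" where
  "has_jet f ft fx fl \<longleftrightarrow> (\<exists>C. AE z in lborel. norm (f z) \<le> C) \<and> has_weak_deriv f t_dir ft \<and>
     (\<forall>i. has_weak_deriv f (x_dir i) (fx i)) \<and> has_weak_laplacian f fl"

lemma has_jet_loc_integrable:
  assumes "has_jet f ft fx fl"
  shows "loc_integrable f" "loc_integrable ft" "loc_integrable (fx i)" "loc_integrable fl"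
  using assms by (auto simp: has_jet_def has_weak_deriv_def has_weak_laplacian_def)

lemma has_jet_measurable:
  assumes "has_jet f ft fx fl"
  shows "f \<in> borel_measurable borel" "ft \<in> borel_measurable borel" "fx i \<in> borel_measurable borel" "fl \<in> borel_measurable borel"
  by (intro loc_integrable_measurable has_jet_loc_integrable[OF assms])+

lemma has_jet_cong_AE:
  assumes j: "has_jet f ft fx fl" and AE: "AE z in lborel. f z = g z"
    and m: "g \<in> borel_measurable borel"
  shows "has_jet g ft fx fl"
proof -
  obtain C where "AE z in lborel. norm (f z) \<le> C" using j by (auto simp: has_jet_def)
  then have "AE z in lborel. norm (g z) \<le> C" using AE by eventually_elim simp
  then show ?thesis
    using j has_jet_measurable[OF j] unfolding has_jet_def has_weak_deriv_iff has_weak_laplacian_iff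
    by (auto intro!: weak_adjoint_cong_AE[OF _ _ AE] m test_op_pd test_op_laplace t_dir_Basis x_dir_Basis)
qed

lemma has_jet_unique:
  assumes "has_jet f ft fx fl" "has_jet f gt gx gl"
  shows "AE z in lborel. ft z = gt z" "AE z in lborel. \<forall>i. fx i z = gx i z" "AE z in lborel. fl z = gl z"
  using assms has_weak_deriv_unique has_weak_laplacian_unique unfolding has_jet_def AE_all_countable
  by blast+

lemma has_jet_linear:
  assumes j: "has_jet f ft fx fl" and L: "bounded_linear L"
  shows "has_jet (\<lambda>z. L (f z)) (\<lambda>z. L (ft z)) (\<lambda>i z. L (fx i z)) (\<lambda>z. L (fl z))"
proof -
  obtain C where C: "AE z in lborel. norm (f z) \<le> C" using j by (auto simp: has_jet_def)
  obtain K where K: "K > 0" "\<And>x. norm (L x) \<le> norm x * K" using bounded_linear.pos_bounded[OF L] by blast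
  have "AE z in lborel. norm (L (f z)) \<le> C * K" using C
  proof eventually_elim
    case (elim z)
    have "norm (f z) * K \<le> C * K" using elim K(1) by (simp add: mult_right_mono)
    then show ?case using K(2)[of "f z"] by simp
  qed
  then show ?thesis
    using j unfolding has_jet_def has_weak_deriv_iff has_weak_laplacian_iff
    by (auto intro!: weak_adjoint_linear[OF _ _ L] test_op_pd test_op_laplace t_dir_Basis x_dir_Basis)
qed

lemma has_jet_add:
  assumes f: "has_jet f ft fx fl" and g: "has_jet g gt gx gl"
  shows "has_jet (\<lambda>z. f z + g z) (\<lambda>z. ft z + gt z) (\<lambda>i z. fx i z + gx i z) (\<lambda>z. fl z + gl z)"
proof -
  obtain C D where C: "AE z in lborel. norm (f z) \<le> C" "AE z in lborel. norm (g z) \<le> D"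
    using f g by (auto simp: has_jet_def)
  have "AE z in lborel. norm (f z + g z) \<le> C + D"
    using C by eventually_elim (rule norm_triangle_mono)
  then show ?thesis
    using f g unfolding has_jet_def has_weak_deriv_iff has_weak_laplacian_iff
    by (auto intro!: weak_adjoint_add test_op_pd test_op_laplace t_dir_Basis x_dir_Basis)
qed

lemma has_jet_0: "has_jet (\<lambda>z. 0) (\<lambda>z. 0) (\<lambda>i z. 0) (\<lambda>z. 0)"
  by (auto simp: has_jet_def has_weak_deriv_def has_weak_laplacian_def loc_integrable_const)

text \<open>Compared with the jet of <u, u> by uniqueness, this yields the identities for maps into
  the sphere.\<close>

lemma has_jet_const: "has_jet (\<lambda>z. c) (\<lambda>z. 0) (\<lambda>i z. 0) (\<lambda>z. 0)"
proof -
  have 1: "has_weak_deriv (\<lambda>z. c) e (\<lambda>z. 0)" if "e \<in> Basis" for e :: "real \<times> (real ^ 'a)"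
    using integral_pd_test[OF _ that] test_fun_pd[OF _ that]
    by (auto simp: has_weak_deriv_def loc_integrable_const integrable_test_fun)
  have 2: "(LBINT z. laplace_x \<eta> z) = 0" if "test_fun \<eta>" for \<eta> :: "real \<times> (real ^ 'a) \<Rightarrow> real"
    unfolding laplace_x_def
    by (subst Bochner_Integration.integral_sum)
       (use that in \<open>auto intro!: integral_pd_test integrable_test_fun test_fun_pd x_dir_Basis sum.neutral\<close>)
  have 3: "(LBINT z. laplace_x \<eta> z *\<^sub>R c) = 0" if "test_fun \<eta>" for \<eta> :: "real \<times> (real ^ 'a) \<Rightarrow> real"
    using integral_scaleR_left[OF integrable_test_fun[OF test_fun_laplace[OF that]], of c] 2[OF that] by simp
  show ?thesis
    using 3
    by (auto simp: has_jet_def has_weak_laplacian_def loc_integrable_const intro!: 1 t_dir_Basis x_dir_Basis exI[of _ "norm c"])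
qed

lemma has_jet_sum:
  assumes "\<And>i. i \<in> I \<Longrightarrow> has_jet (f i) (ft i) (fx i) (fl i)"
  shows "has_jet (\<lambda>z. \<Sum>i\<in>I. f i z) (\<lambda>z. \<Sum>i\<in>I. ft i z) (\<lambda>j z. \<Sum>i\<in>I. fx i j z) (\<lambda>z. \<Sum>i\<in>I. fl i z)"
  using assms by (induction I rule: infinite_finite_induct) (auto intro: has_jet_0 has_jet_add)

text \<open>Polarization of the square rules for f, g and f + g; boundedness and the jet of the sum
  come from \<open>has_jet_add\<close>.\<close>

lemma has_jet_mult:
  fixes f g :: "real \<times> (real ^ 'n) \<Rightarrow> real"
  assumes f: "has_jet f ft fx fl" and g: "has_jet g gt gx gl"
  shows "has_jet (\<lambda>z. f z * g z) (\<lambda>z. f z * gt z + ft z * g z) (\<lambda>i z. f z * gx i z + fx i z * g z)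
    (\<lambda>z. f z * gl z + fl z * g z + 2 * (\<Sum>i\<in>UNIV. fx i z * gx i z))"
proof -
  note fg = has_jet_add[OF f g]
  obtain C D E where C: "AE z in lborel. \<bar>f z\<bar> \<le> C" "AE z in lborel. \<bar>g z\<bar> \<le> D" "AE z in lborel. \<bar>f z + g z\<bar> \<le> E"
    using f g fg by (auto simp: has_jet_def)
  have "AE z in lborel. norm (f z * g z) \<le> C * D"
    using C(1,2) by eventually_elim (auto simp: abs_mult intro!: mult_mono)
  moreover have "has_weak_deriv (\<lambda>z. f z * g z) e (\<lambda>z. f z * dg z + df z * g z)"
    if e: "e \<in> Basis" and d: "has_weak_deriv f e df" "has_weak_deriv g e dg" "has_weak_deriv (\<lambda>z. f z + g z) e (\<lambda>z. df z + dg z)"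
    for e df dg
  proof -
    have "weak_adjoint (\<lambda>\<eta> z. - pd e \<eta> z) (\<lambda>z. f z * g z)
       (\<lambda>z. (2 * ((f z + g z) * (df z + dg z)) - 2 * (f z * df z) - 2 * (g z * dg z)) / 2)"
      by (rule weak_adjoint_polarize[OF test_op_pd[OF e]])
         (fold has_weak_deriv_iff, (rule weak_deriv_mult_self[OF _ e] d C)+)
    then show ?thesis unfolding has_weak_deriv_iff
      by (rule back_subst[of "weak_adjoint _ _"]) (auto simp: fun_eq_iff algebra_simps)
  qed
  moreover have "has_weak_laplacian (\<lambda>z. f z * g z) (\<lambda>z. f z * gl z + fl z * g z + 2 * (\<Sum>i\<in>UNIV. fx i z * gx i z))"
  proof -
    have "weak_adjoint laplace_x (\<lambda>z. f z * g z)
       (\<lambda>z. ((2 * ((f z + g z) * (fl z + gl z)) + 2 * (\<Sum>i\<in>UNIV. (fx i z + gx i z)\<^sup>2))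
         - (2 * (f z * fl z) + 2 * (\<Sum>i\<in>UNIV. (fx i z)\<^sup>2)) - (2 * (g z * gl z) + 2 * (\<Sum>i\<in>UNIV. (gx i z)\<^sup>2))) / 2)"
      using f g fg unfolding has_jet_def
      by (intro weak_adjoint_polarize[OF test_op_laplace]; fold has_weak_laplacian_iff)
         (auto intro!: weak_laplacian_mult_self(2) C)
    then show ?thesis unfolding has_weak_laplacian_iff
      by (rule back_subst[of "weak_adjoint _ _"])
         (auto simp: fun_eq_iff algebra_simps power2_eq_square sum.distrib sum_distrib_left)
  qed
  ultimately show ?thesis
    using f g fg unfolding has_jet_def by (blast intro: t_dir_Basis x_dir_Basis)
qed

lemma bilinear_expand:
  fixes B :: "'b::euclidean_space \<Rightarrow> 'c::euclidean_space \<Rightarrow> 'd::euclidean_space"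
  assumes "bounded_bilinear B"
  shows "B x y = (\<Sum>b\<in>Basis. \<Sum>c\<in>Basis. ((x \<bullet> b) * (y \<bullet> c)) *\<^sub>R B b c)"
proof -
  interpret bounded_bilinear B by fact
  have "B x y = B (\<Sum>b\<in>Basis. (x \<bullet> b) *\<^sub>R b) (\<Sum>c\<in>Basis. (y \<bullet> c) *\<^sub>R c)"
    by (simp only: euclidean_representation)
  also have "\<dots> = (\<Sum>b\<in>Basis. \<Sum>c\<in>Basis. ((x \<bullet> b) * (y \<bullet> c)) *\<^sub>R B b c)"
    unfolding sum_left scaleR_left unfolding sum_right scaleR_right by (simp add: scaleR_sum_right)
  finally show ?thesis .
qed

text \<open>One rule for the inner product, scalar multiplication, products of components and the
  map \<phi> \<Lambda> u. Expansion in coordinates reduces it to products of scalar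
  functions.\<close>

lemma has_jet_bilinear:
  fixes B :: "'b::euclidean_space \<Rightarrow> 'c::euclidean_space \<Rightarrow> 'd::euclidean_space"
  assumes B: "bounded_bilinear B" and f: "has_jet f ft fx fl" and g: "has_jet g gt gx gl"
  shows "has_jet (\<lambda>z. B (f z) (g z)) (\<lambda>z. B (f z) (gt z) + B (ft z) (g z))
    (\<lambda>i z. B (f z) (gx i z) + B (fx i z) (g z))
    (\<lambda>z. B (f z) (gl z) + B (fl z) (g z) + 2 *\<^sub>R (\<Sum>i\<in>UNIV. B (fx i z) (gx i z)))"
proof -
  note comp = has_jet_mult[OF has_jet_linear[OF f bounded_linear_inner_left] has_jet_linear[OF g bounded_linear_inner_left]]
  have J: "has_jet (\<lambda>z. \<Sum>b\<in>Basis. \<Sum>c\<in>Basis. ((f z \<bullet> b) * (g z \<bullet> c)) *\<^sub>R B b c)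
     (\<lambda>z. \<Sum>b\<in>Basis. \<Sum>c\<in>Basis. ((f z \<bullet> b) * (gt z \<bullet> c) + (ft z \<bullet> b) * (g z \<bullet> c)) *\<^sub>R B b c)
     (\<lambda>i z. \<Sum>b\<in>Basis. \<Sum>c\<in>Basis. ((f z \<bullet> b) * (gx i z \<bullet> c) + (fx i z \<bullet> b) * (g z \<bullet> c)) *\<^sub>R B b c)
     (\<lambda>z. \<Sum>b\<in>Basis. \<Sum>c\<in>Basis. ((f z \<bullet> b) * (gl z \<bullet> c) + (fl z \<bullet> b) * (g z \<bullet> c)
        + 2 * (\<Sum>i\<in>UNIV. (fx i z \<bullet> b) * (gx i z \<bullet> c))) *\<^sub>R B b c)"
    by (rule has_jet_sum, rule has_jet_sum, rule has_jet_linear[OF comp bounded_linear_scaleR_left])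
  have e: "(\<Sum>b\<in>Basis. \<Sum>c\<in>Basis. ((x \<bullet> b) * (y' \<bullet> c) + (x' \<bullet> b) * (y \<bullet> c)) *\<^sub>R B b c) = B x y' + B x' y" for x y x' y'
    unfolding bilinear_expand[OF B, of x] bilinear_expand[OF B, of x'] by (simp add: scaleR_add_left sum.distrib)
  have s: "(\<Sum>b\<in>Basis. \<Sum>c\<in>Basis. (2 * (\<Sum>i\<in>UNIV. (X i \<bullet> b) * (Y i \<bullet> c))) *\<^sub>R B b c) = 2 *\<^sub>R (\<Sum>i\<in>UNIV. B (X i) (Y i))"
    for X :: "'a \<Rightarrow> 'b" and Y
  proof -
    have "(\<Sum>i\<in>UNIV. B (X i) (Y i)) = (\<Sum>i\<in>UNIV. \<Sum>b\<in>Basis. \<Sum>c\<in>Basis. ((X i \<bullet> b) * (Y i \<bullet> c)) *\<^sub>R B b c)"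
      by (intro sum.cong refl bilinear_expand[OF B])
    also have "\<dots> = (\<Sum>b\<in>Basis. \<Sum>i\<in>UNIV. \<Sum>c\<in>Basis. ((X i \<bullet> b) * (Y i \<bullet> c)) *\<^sub>R B b c)"
      by (rule sum.swap)
    also have "\<dots> = (\<Sum>b\<in>Basis. \<Sum>c\<in>Basis. \<Sum>i\<in>UNIV. ((X i \<bullet> b) * (Y i \<bullet> c)) *\<^sub>R B b c)"
      by (intro sum.cong refl sum.swap)
    finally show ?thesis
      by (simp add: scaleR_sum_left scaleR_sum_right sum_distrib_left)
  qed
  show ?thesis
    using J unfolding e bilinear_expand[OF B, symmetric]
      scaleR_add_left[of "_ + _" "2 * _"] sum.distrib s by simp
qed

text \<open>Supplies the spatial gradient that the definition of Z leaves out. The energy argument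
  is scalar, so it is applied to each coordinate.\<close>

lemma has_jet_exists:
  assumes C: "AE z in lborel. norm (f z) \<le> C" and t: "has_weak_deriv f t_dir ft" and l: "has_weak_laplacian f fl"
  obtains fx where "has_jet f ft fx fl"
proof -
  have "\<exists>G. has_weak_deriv f (x_dir i) G" for i
  proof -
    have "\<exists>G. has_weak_deriv (\<lambda>z. f z \<bullet> b) (x_dir i) G" if "b \<in> Basis" for b
    proof -
      have "weak_adjoint laplace_x (\<lambda>z. f z \<bullet> b) (\<lambda>z. fl z \<bullet> b)"
        by (rule weak_adjoint_linear[OF l[unfolded has_weak_laplacian_iff] test_op_laplace bounded_linear_inner_left])
      moreover have "AE z in lborel. \<bar>f z \<bullet> b\<bar> \<le> C"
        using C by eventually_elim (use Basis_le_norm[OF that] order_trans in blast)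
      ultimately show ?thesis
        using weak_gradient_exists[of "\<lambda>z. f z \<bullet> b"] unfolding has_weak_laplacian_iff by metis
    qed
    then obtain G where G: "\<And>b. b \<in> Basis \<Longrightarrow> has_weak_deriv (\<lambda>z. f z \<bullet> b) (x_dir i) (G b)" by metis
    \<comment> \<open>The coordinate derivatives are put together by adding one basis direction at a
      time.\<close>
    have ind: "weak_adjoint (\<lambda>\<eta> z. - pdx i \<eta> z) (\<lambda>z. \<Sum>b\<in>S. (f z \<bullet> b) *\<^sub>R b) (\<lambda>z. \<Sum>b\<in>S. G b z *\<^sub>R b)"
      if "finite S" "S \<subseteq> Basis" for S
      using that
    proof (induction S rule: finite_induct)
      case empty
      then show ?case by (simp add: weak_adjoint_def loc_integrable_const)
    next
      case (insert b S)
      have "weak_adjoint (\<lambda>\<eta> z. - pdx i \<eta> z) (\<lambda>z. (f z \<bullet> b) *\<^sub>R b) (\<lambda>z. G b z *\<^sub>R b)"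
        using insert G by (intro weak_adjoint_linear[OF _ test_op_pd[OF x_dir_Basis] bounded_linear_scaleR_left])
          (simp add: has_weak_deriv_iff)
      then show ?case using insert by (simp add: weak_adjoint_add test_op_pd x_dir_Basis)
    qed
    show ?thesis
      using ind[OF finite_Basis order_refl] unfolding euclidean_representation has_weak_deriv_iff by blast
  qed
  then obtain fx where "\<And>i. has_weak_deriv f (x_dir i) (fx i)" by metis
  then show ?thesis using that assms by (auto simp: has_jet_def)
qed

lemma has_jet_chosen:
  assumes "has_jet f ft fx fl"
  shows "has_jet f (dt f) (\<lambda>i. dx i f) (lap f)"
proof -
  have "has_weak_deriv f e (weak_deriv e f)" if "has_weak_deriv f e g" for e g
    unfolding weak_deriv_def by (rule someI[of "has_weak_deriv f e"]) (rule that)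
  moreover have "has_weak_laplacian f (lap f)" if "has_weak_laplacian f g" for g
    unfolding weak_laplacian_def by (rule someI[of "has_weak_laplacian f"]) (rule that)
  ultimately show ?thesis using assms unfolding has_jet_def by blast
qed

lemmas has_jet_chosen_eq = has_jet_unique[OF has_jet_chosen]

subsection \<open>Integrability in time\<close>

lemma cylinder_measurable: "compact (K :: real set) \<Longrightarrow> K \<times> (UNIV :: (real ^ 'n) set) \<in> sets borel"
  by (rule borel_closed[OF closed_Times[OF compact_imp_closed closed_UNIV]])

lemma L2_loc_t_bound:
  assumes g: "g \<in> L2_loc_t" and f: "f \<in> borel_measurable borel"
    and le: "AE z in lborel. norm (f z) \<le> norm (g z)"
  shows "f \<in> L2_loc_t"
  unfolding L2_loc_t_def
proof (intro CollectI conjI allI impI)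
  show "f \<in> borel_measurable lborel" using f by simp
  fix K :: "real set" assume K: "compact K"
  have [measurable]: "f \<in> borel_measurable borel" "K \<times> (UNIV :: (real ^ 'a) set) \<in> sets borel"
    using f cylinder_measurable[OF K] by auto
  have "set_integrable lborel (K \<times> UNIV) (\<lambda>z. (norm (g z))\<^sup>2)" using g K by (auto simp: L2_loc_t_def)
  then show "set_integrable lborel (K \<times> UNIV) (\<lambda>z. (norm (f z))\<^sup>2)"
    unfolding set_integrable_def
  proof (rule Bochner_Integration.integrable_bound)
    show "AE z in lborel. norm (indicator (K \<times> UNIV) z *\<^sub>R (norm (f z))\<^sup>2) \<le> norm (indicator (K \<times> UNIV) z *\<^sub>R (norm (g z))\<^sup>2)"
      using le by eventually_elim (auto simp: indicator_def intro: power_mono)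
    show "(\<lambda>z. indicator (K \<times> UNIV) z *\<^sub>R (norm (f z))\<^sup>2) \<in> borel_measurable lborel"
      unfolding measurable_lborel2 by measurable
  qed
qed

lemma L2_loc_t_measurable: "f \<in> L2_loc_t \<Longrightarrow> f \<in> borel_measurable borel"
  by (simp add: L2_loc_t_def)

lemma L2_loc_t_cong:
  "g \<in> L2_loc_t \<Longrightarrow> f \<in> borel_measurable borel \<Longrightarrow> AE z in lborel. f z = g z \<Longrightarrow> f \<in> L2_loc_t"
  by (rule L2_loc_t_bound) auto

lemma norm_add_sq_le:
  fixes x y :: "'a::real_normed_vector"
  shows "(norm (x + y))\<^sup>2 \<le> 2 * (norm x)\<^sup>2 + 2 * (norm y)\<^sup>2"
proof -
  have "(norm (x + y))\<^sup>2 \<le> (norm x + norm y)\<^sup>2" by (intro power_mono norm_triangle_ineq) auto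
  also have "\<dots> \<le> 2 * (norm x)\<^sup>2 + 2 * (norm y)\<^sup>2"
    using zero_le_power2[of "norm x - norm y"] by (simp add: power2_eq_square algebra_simps)
  finally show ?thesis .
qed

lemma L2_loc_t_add:
  assumes f: "f \<in> L2_loc_t" and g: "g \<in> L2_loc_t"
  shows "(\<lambda>z. f z + g z) \<in> L2_loc_t"
  unfolding L2_loc_t_def
proof (intro CollectI conjI allI impI)
  note [measurable] = f[THEN L2_loc_t_measurable] g[THEN L2_loc_t_measurable]
  show "(\<lambda>z. f z + g z) \<in> borel_measurable lborel" by simp
  fix K :: "real set" assume K: "compact K"
  note [measurable] = cylinder_measurable[OF K]
  have "integrable lborel (\<lambda>z. indicator (K \<times> UNIV) z *\<^sub>R (norm (f z))\<^sup>2)"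
    "integrable lborel (\<lambda>z. indicator (K \<times> UNIV) z *\<^sub>R (norm (g z))\<^sup>2)"
    using f g K by (auto simp: L2_loc_t_def set_integrable_def)
  then have "integrable lborel (\<lambda>z. 2 * (indicator (K \<times> UNIV) z *\<^sub>R (norm (f z))\<^sup>2) + 2 * (indicator (K \<times> UNIV) z *\<^sub>R (norm (g z))\<^sup>2))"
    by auto
  then show "set_integrable lborel (K \<times> UNIV) (\<lambda>z. (norm (f z + g z))\<^sup>2)"
    unfolding set_integrable_def
  proof (rule Bochner_Integration.integrable_bound)
    show "AE z in lborel. norm (indicator (K \<times> UNIV) z *\<^sub>R (norm (f z + g z))\<^sup>2) \<le>
      norm (2 * (indicator (K \<times> UNIV) z *\<^sub>R (norm (f z))\<^sup>2) + 2 * (indicator (K \<times> UNIV) z *\<^sub>R (norm (g z))\<^sup>2))"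
      using norm_add_sq_le[of "f _" "g _"] by (auto simp: indicator_def)
    show "(\<lambda>z. indicator (K \<times> UNIV) z *\<^sub>R (norm (f z + g z))\<^sup>2) \<in> borel_measurable lborel"
      unfolding measurable_lborel2 by measurable
  qed
qed

lemma L2_loc_t_cmult:
  fixes g :: "real \<times> (real ^ 'n) \<Rightarrow> real"
  assumes "g \<in> L2_loc_t" shows "(\<lambda>z. c * g z) \<in> L2_loc_t"
proof -
  have m: "g \<in> borel_measurable borel" by (rule L2_loc_t_measurable[OF assms])
  have "set_integrable lborel (K \<times> UNIV) (\<lambda>z. (norm (c * g z))\<^sup>2)" if "compact K" for K
  proof -
    have "set_integrable lborel (K \<times> UNIV) (\<lambda>z. c\<^sup>2 * (norm (g z))\<^sup>2)"
      using assms that by (intro set_integrable_mult_right) (auto simp: L2_loc_t_def)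
    then show ?thesis by (simp add: power_mult_distrib)
  qed
  then show ?thesis using m by (simp add: L2_loc_t_def)
qed

lemma L2_loc_t_norm: "f \<in> L2_loc_t \<Longrightarrow> (\<lambda>z. norm (f z)) \<in> L2_loc_t"
  by (rule L2_loc_t_bound) (auto dest: L2_loc_t_measurable)

lemma L2_loc_t_dominated:
  fixes g h :: "real \<times> (real ^ 'n) \<Rightarrow> real"
  assumes "g \<in> L2_loc_t" "h \<in> L2_loc_t" "f \<in> borel_measurable borel"
    and "AE z in lborel. norm (f z) \<le> c * g z + d * h z"
  shows "f \<in> L2_loc_t"
proof (rule L2_loc_t_bound)
  show "(\<lambda>z. c * g z + d * h z) \<in> L2_loc_t" by (intro L2_loc_t_add L2_loc_t_cmult assms)
  show "AE z in lborel. norm (f z) \<le> norm (c * g z + d * h z)"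
    using assms(4) by eventually_elim simp
qed (rule assms)

lemma L2_loc_t_sum:
  fixes f :: "'i \<Rightarrow> real \<times> (real ^ 'n) \<Rightarrow> 'b::euclidean_space"
  assumes "\<And>i. i \<in> I \<Longrightarrow> f i \<in> L2_loc_t" shows "(\<lambda>z. \<Sum>i\<in>I. f i z) \<in> L2_loc_t"
proof -
  have "(\<lambda>z. 0 :: 'b) \<in> (L2_loc_t :: (real \<times> (real ^ 'n) \<Rightarrow> 'b) set)" by (simp add: L2_loc_t_def set_integrable_def)
  then show ?thesis using assms
    by (induction I rule: infinite_finite_induct) (auto intro: L2_loc_t_add)
qed

lemma bilinear_measurable:
  fixes B :: "'b::euclidean_space \<Rightarrow> 'c::euclidean_space \<Rightarrow> 'd::euclidean_space"
  assumes B: "bounded_bilinear B" and [measurable]: "f \<in> borel_measurable borel" "g \<in> borel_measurable borel"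
  shows "(\<lambda>z. B (f z) (g z)) \<in> borel_measurable borel"
  by (subst bilinear_expand[OF B]) measurable

lemma bilinear_AE_bound:
  fixes B :: "'b::euclidean_space \<Rightarrow> 'c::euclidean_space \<Rightarrow> 'd::euclidean_space"
  assumes B: "bounded_bilinear B" and f: "AE z in M. norm (f z) \<le> C"
  obtains D where "AE z in M. norm (B (f z) (g z)) \<le> D * norm (g z)"
proof -
  obtain K where K: "K > 0" "\<And>a b. norm (B a b) \<le> norm a * norm b * K"
    using bounded_bilinear.pos_bounded[OF B] by blast
  have "AE z in M. norm (B (f z) (g z)) \<le> (C * K) * norm (g z)"
    using f
  proof eventually_elim
    case (elim z)
    have "norm (f z) * norm (g z) * K \<le> C * norm (g z) * K"
      using elim K(1) by (intro mult_right_mono) auto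
    then show ?case using K(2)[of "f z" "g z"] by (simp add: mult_ac)
  qed
  then show ?thesis by (rule that)
qed

lemma L2_loc_t_bilinear:
  fixes B :: "'b::euclidean_space \<Rightarrow> 'c::euclidean_space \<Rightarrow> 'd::euclidean_space"
  assumes B: "bounded_bilinear B" and g: "g \<in> L2_loc_t"
    and f: "f \<in> borel_measurable borel" "AE z in lborel. norm (f z) \<le> C"
  shows "(\<lambda>z. B (f z) (g z)) \<in> L2_loc_t"
proof -
  obtain D where D: "AE z in lborel. norm (B (f z) (g z)) \<le> D * norm (g z)" by (rule bilinear_AE_bound[OF B f(2)])
  show ?thesis
    by (rule L2_loc_t_dominated[OF L2_loc_t_norm[OF g] L2_loc_t_norm[OF g], of _ D 0])
      (use D bilinear_measurable[OF B f(1) L2_loc_t_measurable[OF g]] in auto)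
qed

text \<open>What u in Z and test functions in W have in common. The gradient condition is an L4
  condition: it is what makes the cross term in the Laplacian of a product square
  integrable.\<close>

definition tame :: "(real \<times> (real ^ 'n) \<Rightarrow> 'b::euclidean_space) \<Rightarrow> bool" where
  "tame f \<longleftrightarrow> has_jet f (dt f) (\<lambda>i. dx i f) (lap f) \<and> dt f \<in> L2_loc_t \<and> lap f \<in> L2_loc_t \<and>
     (\<forall>i. (\<lambda>z. (norm (dx i f z))\<^sup>2) \<in> L2_loc_t)"

lemma tame_jet: "tame f \<Longrightarrow> has_jet f (dt f) (\<lambda>i. dx i f) (lap f)"
  by (simp add: tame_def)

text \<open>The representatives agree with any jet almost everywhere, and \<open>L2_loc_t\<close>
  respects such changes, so the conditions may be checked on convenient formulas.\<close>

lemma tame_intro: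
  assumes j: "has_jet f ft fx fl" and L: "ft \<in> L2_loc_t" "fl \<in> L2_loc_t" "\<And>i. (\<lambda>z. (norm (fx i z))\<^sup>2) \<in> L2_loc_t"
  shows "tame f"
proof -
  note e = has_jet_chosen_eq[OF j j]
  note [measurable] = has_jet_measurable[OF has_jet_chosen[OF j]]
  have "(\<lambda>z. (norm (dx i f z))\<^sup>2) \<in> L2_loc_t" for i
  proof (rule L2_loc_t_cong[OF L(3)])
    show "AE z in lborel. (norm (dx i f z))\<^sup>2 = (norm (fx i z))\<^sup>2" using e(2) by eventually_elim simp
  qed measurable
  then show ?thesis
    unfolding tame_def using has_jet_chosen[OF j] L2_loc_t_cong[OF L(1) _ e(1)] L2_loc_t_cong[OF L(2) _ e(3)] by simp
qed

lemma tame_grad_sq_bound: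
  fixes f g :: "real \<times> (real ^ 'n) \<Rightarrow> 'b::euclidean_space"
  assumes "(\<lambda>z. (norm (f z))\<^sup>2) \<in> L2_loc_t" "(\<lambda>z. (norm (g z))\<^sup>2) \<in> L2_loc_t"
    "f \<in> borel_measurable borel" "g \<in> borel_measurable borel"
  shows "(\<lambda>z. (norm (f z + g z))\<^sup>2) \<in> L2_loc_t"
  by (rule L2_loc_t_dominated[OF assms(1,2), where c = 2 and d = 2])
     (use assms(3,4) norm_add_sq_le[of "f _" "g _"] in auto)

lemma tame_add:
  assumes f: "tame f" and g: "tame g"
  shows "tame (\<lambda>z. f z + g z)"
proof (rule tame_intro[OF has_jet_add[OF tame_jet[OF f] tame_jet[OF g]]])
  show "(\<lambda>z. (norm (dx i f z + dx i g z))\<^sup>2) \<in> L2_loc_t" for i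
    using f g has_jet_measurable[OF tame_jet[OF f]] has_jet_measurable[OF tame_jet[OF g]]
    by (intro tame_grad_sq_bound) (auto simp: tame_def)
qed (use f g in \<open>auto simp: tame_def intro: L2_loc_t_add\<close>)

lemma grad_sq_bilinear:
  fixes B :: "'b::euclidean_space \<Rightarrow> 'c::euclidean_space \<Rightarrow> 'd::euclidean_space"
  assumes B: "bounded_bilinear B" and f: "has_jet f ft fx fl" and g: "(\<lambda>z. (norm (g z))\<^sup>2) \<in> L2_loc_t" "g \<in> borel_measurable borel"
  shows "(\<lambda>z. (norm (B (f z) (g z)))\<^sup>2) \<in> L2_loc_t" "(\<lambda>z. B (f z) (g z)) \<in> borel_measurable borel"
proof -
  obtain C where C: "AE z in lborel. norm (f z) \<le> C" using f by (auto simp: has_jet_def)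
  obtain D where D: "AE z in lborel. norm (B (f z) (g z)) \<le> D * norm (g z)" by (rule bilinear_AE_bound[OF B C])
  show [measurable]: "(\<lambda>z. B (f z) (g z)) \<in> borel_measurable borel"
    by (rule bilinear_measurable[OF B has_jet_measurable(1)[OF f] g(2)])
  show "(\<lambda>z. (norm (B (f z) (g z)))\<^sup>2) \<in> L2_loc_t"
  proof (rule L2_loc_t_dominated[OF g(1) g(1)])
    show "AE z in lborel. norm ((norm (B (f z) (g z)))\<^sup>2) \<le> D\<^sup>2 * (norm (g z))\<^sup>2 + 0 * (norm (g z))\<^sup>2"
      using D
    proof eventually_elim
      case (elim z)
      then have "(norm (B (f z) (g z)))\<^sup>2 \<le> (D * norm (g z))\<^sup>2" by (intro power_mono) auto
      then show ?case by (simp add: power_mult_distrib)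
    qed
  qed measurable
qed

text \<open>Time derivative and Laplacian get multiplied by bounded functions only. The cross term
  is bounded by a multiple of the sum of the two squared gradients, which is square integrable
  locally in time.\<close>

lemma tame_bilinear:
  fixes B :: "'b::euclidean_space \<Rightarrow> 'c::euclidean_space \<Rightarrow> 'd::euclidean_space"
  assumes B: "bounded_bilinear B" and f: "tame f" and g: "tame g"
  shows "tame (\<lambda>z. B (f z) (g z))"
    "AE z in lborel. dt (\<lambda>z. B (f z) (g z)) z = B (f z) (dt g z) + B (dt f z) (g z)"
    "AE z in lborel. \<forall>i. dx i (\<lambda>z. B (f z) (g z)) z = B (f z) (dx i g z) + B (dx i f z) (g z)"
    "AE z in lborel. lap (\<lambda>z. B (f z) (g z)) z = B (f z) (lap g z) + B (lap f z) (g z) + 2 *\<^sub>R (\<Sum>i\<in>UNIV. B (dx i f z) (dx i g z))"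
proof -
  interpret bounded_bilinear B by fact
  \<comment> \<open>Estimates with a bounded first argument are also applied to the flipped map,
    where g is the bounded factor.\<close>
  have B': "bounded_bilinear (\<lambda>x y. B y x)" by (rule bounded_bilinear.flip[OF B])
  note jf = tame_jet[OF f] and jg = tame_jet[OF g]
  note j = has_jet_bilinear[OF B jf jg]
  note mf = has_jet_measurable[OF jf] and mg = has_jet_measurable[OF jg]
  obtain C D where C: "AE z in lborel. norm (f z) \<le> C" "AE z in lborel. norm (g z) \<le> D"
    using jf jg by (auto simp: has_jet_def)
  obtain K where K: "K > 0" "\<And>a b. norm (B a b) \<le> norm a * norm b * K" using pos_bounded by blast
  note bf = L2_loc_t_bilinear[OF B _ mf(1) C(1)] and bg = L2_loc_t_bilinear[OF B' _ mg(1) C(2)]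
  note sf = grad_sq_bilinear[OF B jf] and sg = grad_sq_bilinear[OF B' jg]
  have L: "dt f \<in> L2_loc_t" "lap f \<in> L2_loc_t" "(\<lambda>z. (norm (dx i f z))\<^sup>2) \<in> L2_loc_t"
    "dt g \<in> L2_loc_t" "lap g \<in> L2_loc_t" "(\<lambda>z. (norm (dx i g z))\<^sup>2) \<in> L2_loc_t" for i
    using f g by (auto simp: tame_def)
  have cross: "(\<lambda>z. B (dx i f z) (dx i g z)) \<in> L2_loc_t" for i
  proof (rule L2_loc_t_dominated[OF L(3,6)])
    have "norm (B a b) \<le> K * (norm a)\<^sup>2 + K * (norm b)\<^sup>2" for a b
    proof -
      have "norm a * norm b \<le> (norm a)\<^sup>2 + (norm b)\<^sup>2"
        using sum_squares_bound[of "norm a" "norm b"] mult_nonneg_nonneg[OF norm_ge_zero[of a] norm_ge_zero[of b]] by linarith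
      then have "norm a * norm b * K \<le> ((norm a)\<^sup>2 + (norm b)\<^sup>2) * K" using K(1) by (intro mult_right_mono) auto
      then show ?thesis using K(2)[of a b] by (simp add: algebra_simps)
    qed
    then show "AE z in lborel. norm (B (dx i f z) (dx i g z)) \<le> K * (norm (dx i f z))\<^sup>2 + K * (norm (dx i g z))\<^sup>2" by simp
    show "(\<lambda>z. B (dx i f z) (dx i g z)) \<in> borel_measurable borel"
      by (rule bilinear_measurable[OF B mf(3) mg(3)])
  qed
  show "tame (\<lambda>z. B (f z) (g z))"
  proof (rule tame_intro[OF j])
    show "(\<lambda>z. B (f z) (dt g z) + B (dt f z) (g z)) \<in> L2_loc_t"
      by (intro L2_loc_t_add bf bg L)
    have "(\<lambda>z. (\<Sum>i\<in>UNIV. B (dx i f z) (dx i g z)) + (\<Sum>i\<in>UNIV. B (dx i f z) (dx i g z))) \<in> L2_loc_t"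
      by (intro L2_loc_t_add L2_loc_t_sum cross)
    then show "(\<lambda>z. B (f z) (lap g z) + B (lap f z) (g z) + 2 *\<^sub>R (\<Sum>i\<in>UNIV. B (dx i f z) (dx i g z))) \<in> L2_loc_t"
      unfolding scaleR_2 by (intro L2_loc_t_add[OF L2_loc_t_add] bf bg L)
    show "(\<lambda>z. (norm (B (f z) (dx i g z) + B (dx i f z) (g z)))\<^sup>2) \<in> L2_loc_t" for i
      by (intro tame_grad_sq_bound sf sg L mf mg)
  qed
  show "AE z in lborel. dt (\<lambda>z. B (f z) (g z)) z = B (f z) (dt g z) + B (dt f z) (g z)"
    "AE z in lborel. \<forall>i. dx i (\<lambda>z. B (f z) (g z)) z = B (f z) (dx i g z) + B (dx i f z) (g z)"
    "AE z in lborel. lap (\<lambda>z. B (f z) (g z)) z = B (f z) (lap g z) + B (lap f z) (g z) + 2 *\<^sub>R (\<Sum>i\<in>UNIV. B (dx i f z) (dx i g z))"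
    by (rule has_jet_chosen_eq[OF j j])+
qed

section \<open>Compact support in time\<close>

abbreviation zero_beyond :: "real \<Rightarrow> (real \<times> (real ^ 'n) \<Rightarrow> 'b::euclidean_space) \<Rightarrow> bool" where
  "zero_beyond T f \<equiv> AE z in lborel. T < \<bar>fst z\<bar> \<longrightarrow> f z = 0"

text \<open>The complement of \<open>supp_t v\<close> is a union of possibly uncountably many open
  sets, each with its own null set. By the Lindelof property countably many of them suffice, and the
  null sets add up to a null set.\<close>

lemma vanish_outside:
  assumes "compact (supp_t v)"
  obtains T where "T > 0" "zero_beyond T v"
proof -
  let ?F = "{U. open U \<and> (AE z in lborel. fst z \<in> U \<longrightarrow> v z = 0)}"
  obtain F where F: "F \<subseteq> ?F" "countable F" "\<Union>F = \<Union>?F"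
    using Lindelof[of ?F] by auto
  have "AE z in lborel. \<forall>U\<in>F. fst z \<in> U \<longrightarrow> v z = 0"
    using F(1,2) by (subst AE_ball_countable) auto
  moreover obtain T where T: "T > 0" "\<And>t. t \<in> supp_t v \<Longrightarrow> \<bar>t\<bar> \<le> T"
    using compact_imp_bounded[OF assms] unfolding bounded_pos by auto
  ultimately have "zero_beyond T v"
  proof (elim eventually_mono, intro impI)
    fix z assume z: "\<forall>U\<in>F. fst z \<in> U \<longrightarrow> v z = 0" "T < \<bar>fst z\<bar>"
    then have "fst z \<notin> supp_t v" using T(2) by fastforce
    then have "fst z \<in> \<Union>F" unfolding F(3) supp_t_def by blast
    then show "v z = 0" using z(1) by blast
  qed
  with T(1) show ?thesis using that by blast
qed

lemma compact_supp_t_mono: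
  assumes c: "compact (supp_t w)" and z: "AE z in lborel. w z = 0 \<longrightarrow> v z = 0"
  shows "compact (supp_t v)"
proof -
  have "supp_t v \<subseteq> supp_t w"
    unfolding supp_t_def
  proof (intro Compl_anti_mono Union_mono subsetI CollectI)
    fix U assume "U \<in> {U. open U \<and> (AE z in lborel. fst z \<in> U \<longrightarrow> w z = 0)}"
    then have U: "open U" "AE z in lborel. fst z \<in> U \<longrightarrow> w z = 0" by auto
    from U(2) z have "AE z in lborel. fst z \<in> U \<longrightarrow> v z = 0" by eventually_elim simp
    with U(1) show "open U \<and> (AE z in lborel. fst z \<in> U \<longrightarrow> v z = 0)" by simp
  qed
  moreover have "closed (supp_t v)" unfolding supp_t_def by (intro closed_Compl open_Union) auto
  ultimately show ?thesis using c by (metis compact_Int_closed inf.absorb_iff2)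
qed

lemma compact_supp_t_add:
  assumes c: "compact (supp_t v)" "compact (supp_t w)"
  shows "compact (supp_t (\<lambda>z. v z + w z))"
proof -
  have "supp_t (\<lambda>z. v z + w z) \<subseteq> supp_t v \<union> supp_t w"
  proof
    fix t assume t: "t \<in> supp_t (\<lambda>z. v z + w z)"
    show "t \<in> supp_t v \<union> supp_t w"
    proof (rule ccontr)
      assume "t \<notin> supp_t v \<union> supp_t w"
      then obtain U U' where U: "open U" "open U'" "t \<in> U" "t \<in> U'"
        "AE z in lborel. fst z \<in> U \<longrightarrow> v z = 0" "AE z in lborel. fst z \<in> U' \<longrightarrow> w z = 0"
        by (auto simp: supp_t_def)
      have "AE z in lborel. fst z \<in> U \<inter> U' \<longrightarrow> v z + w z = 0"
        using U(5,6) by eventually_elim auto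
      then have "t \<notin> supp_t (\<lambda>z. v z + w z)"
        using U(1-4) open_Int[OF U(1,2)] unfolding supp_t_def by blast
      with t show False by simp
    qed
  qed
  moreover have "closed (supp_t (\<lambda>z. v z + w z))" unfolding supp_t_def by (intro closed_Compl open_Union) auto
  ultimately show ?thesis using compact_Un[OF c] by (metis compact_Int_closed inf.absorb_iff2)
qed

text \<open>A derivative of \<open>v\<close> vanishes wherever \<open>v\<close> does: test with \<open>\<eta>\<zeta>\<close>, where the smooth
  function \<open>\<zeta>\<close> of time is positive exactly for times beyond \<open>T\<close>.\<close>

lemma derivs_vanish_outside:
  fixes v :: "real \<times> (real ^ 'n) \<Rightarrow> 'b::euclidean_space"
  assumes j: "has_jet v vt vx vl" and v: "zero_beyond T v" and T: "T > 0"
  shows "zero_beyond T vt"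
    "AE z in lborel. T < \<bar>fst z\<bar> \<longrightarrow> vx i z = 0"
    "zero_beyond T vl"
proof -
  define p where "p = (\<lambda>z::real \<times> (real ^ 'n). (z \<bullet> t_dir)\<^sup>2 - T\<^sup>2)"
  define \<zeta> where "\<zeta> = (\<lambda>z. flat 0 (p z))"
  have fst: "z \<bullet> t_dir = fst z" for z :: "real \<times> (real ^ 'n)" by (simp add: t_dir_def inner_prod_def)
  have sp: "smooth p" unfolding p_def by (intro smooth_diff smooth_power smooth_inner smooth_const)
  then have s: "smooth \<zeta>" unfolding \<zeta>_def by (rule smooth_flat)
  have pp: "p z > 0 \<longleftrightarrow> T < \<bar>fst z\<bar>" for z
    using T power2_less_imp_less[of T "\<bar>fst z\<bar>"] power_strict_mono[of T "\<bar>fst z\<bar>" 2]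
    by (auto simp: p_def fst)
  have \<zeta>0: "\<zeta> z \<noteq> 0 \<longleftrightarrow> T < \<bar>fst z\<bar>" for z using pp[of z] by (auto simp: \<zeta>_def flat_def)
  have D: "pd b \<zeta> z = flat 2 (p z) * (2 * (z \<bullet> t_dir) * (b \<bullet> t_dir))" for b z
  proof -
    have 1: "(p has_derivative (\<lambda>h. 2 * (z \<bullet> t_dir) * (h \<bullet> t_dir))) (at z)"
      unfolding p_def by (auto intro!: derivative_eq_intros)
    have 2: "(flat 0 has_derivative (\<lambda>h. flat 2 (p z) * h)) (at (p z))"
      using flat_has_deriv[of 0 "p z"] by (simp add: has_field_derivative_def numeral_2_eq_2)
    show ?thesis unfolding \<zeta>_def by (rule pd_eq[OF has_derivative_compose[OF 1 2]])
  qed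
  have Dx: "pdx i \<zeta> = (\<lambda>z. 0)" for i by (rule ext) (simp add: D x_dir_def t_dir_def inner_prod_def)
  have D0: "pd b \<zeta> z = 0" if "\<not> T < \<bar>fst z\<bar>" for b z
    using that pp[of z] by (simp add: D flat_def)
  \<comment> \<open>Where |t| \<le> T the operator applied to \<eta>\<zeta> vanishes, elsewhere v
    does; so the test integral is zero for every \<eta>, and with it \<zeta> g.\<close>
  have main: "zero_beyond T g"
    if w: "weak_adjoint P v g" and P: "\<And>\<eta> z. test_fun \<eta> \<Longrightarrow> \<not> T < \<bar>fst z\<bar> \<Longrightarrow> P (\<lambda>z. \<eta> z * \<zeta> z) z = 0" for P g
  proof -
    have lg: "loc_integrable g" using w by (simp add: weak_adjoint_def)
    note [measurable] = loc_integrable_measurable[OF lg] smooth_measurable[OF s]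
    have "AE z in lborel. \<zeta> z *\<^sub>R g z = 0"
    proof (rule AE_eq_0_if_test_zero')
      show "loc_integrable (\<lambda>z. \<zeta> z *\<^sub>R g z)" unfolding loc_integrable_iff
      proof
        fix R
        obtain M where M: "\<forall>x\<in>cball 0 R. \<bar>\<zeta> x\<bar> \<le> M"
          using compact_imp_bounded[OF compact_continuous_image[OF smooth_continuous[OF s] compact_cball]]
          unfolding bounded_iff by fastforce
        show "integrable lborel (\<lambda>z. indicator (cball 0 R) z *\<^sub>R \<zeta> z *\<^sub>R g z)"
        proof (rule Bochner_Integration.integrable_bound)
          show "integrable lborel (\<lambda>z. M *\<^sub>R (indicator (cball 0 R) z *\<^sub>R g z))"
            by (intro integrable_scaleR_right loc_integrable_cball lg)
          show "AE z in lborel. norm (indicator (cball 0 R) z *\<^sub>R \<zeta> z *\<^sub>R g z) \<le> norm (M *\<^sub>R (indicator (cball 0 R) z *\<^sub>R g z))"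
          proof (intro AE_I2)
            fix z
            show "norm (indicator (cball 0 R) z *\<^sub>R \<zeta> z *\<^sub>R g z) \<le> norm (M *\<^sub>R (indicator (cball 0 R) z *\<^sub>R g z))"
            proof (cases "z \<in> cball 0 R")
              case True
              then have "\<bar>\<zeta> z\<bar> \<le> \<bar>M\<bar>" using M abs_ge_self[of M] by (meson order_trans)
              then show ?thesis using True by (simp add: mult_right_mono)
            qed simp
          qed
          show "(\<lambda>z. indicator (cball 0 R) z *\<^sub>R \<zeta> z *\<^sub>R g z) \<in> borel_measurable lborel"
            unfolding measurable_lborel2 by measurable
        qed
      qed
      fix \<eta> :: "real \<times> (real ^ 'n) \<Rightarrow> real" assume \<eta>: "test_fun \<eta>"
      have "(LBINT z. \<eta> z *\<^sub>R \<zeta> z *\<^sub>R g z) = (LBINT z. P (\<lambda>z. \<eta> z * \<zeta> z) z *\<^sub>R v z)"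
        using w test_fun_mult[OF \<eta> s] by (simp add: weak_adjoint_def)
      also have "\<dots> = 0"
      proof (rule integral_eq_zero_AE)
        show "AE z in lborel. P (\<lambda>z. \<eta> z * \<zeta> z) z *\<^sub>R v z = 0"
          using v by eventually_elim (use P[OF \<eta>] in fastforce)
      qed
      finally show "(LBINT z. \<eta> z *\<^sub>R \<zeta> z *\<^sub>R g z) = 0" .
    qed
    then show ?thesis by eventually_elim (use \<zeta>0 in auto)
  qed
  have pd0: "- pd b (\<lambda>z. \<eta> z * \<zeta> z) z = 0" if "test_fun \<eta>" "\<not> T < \<bar>fst z\<bar>" for b \<eta> z
    using D0[OF that(2)] \<zeta>0[of z] that by (simp add: pd_mult_smooth[OF test_fun_smooth[OF that(1)] s])
  have l0: "laplace_x (\<lambda>z. \<eta> z * \<zeta> z) z = 0" if "test_fun \<eta>" "\<not> T < \<bar>fst z\<bar>" for \<eta> z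
    unfolding laplace_mult[OF test_fun_smooth[OF that(1)] s]
    using \<zeta>0[of z] that by (simp add: laplace_x_def Dx fun_cong[OF Dx])
  have w: "weak_adjoint (\<lambda>\<eta> z. - pd t_dir \<eta> z) v vt" "weak_adjoint (\<lambda>\<eta> z. - pdx i \<eta> z) v (vx i)"
    "weak_adjoint laplace_x v vl"
    using j by (simp_all add: has_jet_def has_weak_deriv_iff has_weak_laplacian_iff)
  show "zero_beyond T vt"
    by (rule main[OF w(1)]) (rule pd0)
  show "AE z in lborel. T < \<bar>fst z\<bar> \<longrightarrow> vx i z = 0"
    by (rule main[OF w(2)]) (rule pd0)
  show "zero_beyond T vl"
    by (rule main[OF w(3)]) (rule l0)
qed

lemma L2_imp_L2_loc_t: "f \<in> L2 \<Longrightarrow> f \<in> L2_loc_t"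
  unfolding L2_def L2_loc_t_def set_integrable_def
  using cylinder_measurable by (auto intro!: integrable_mult_indicator[of _ lborel "\<lambda>z. (norm (f z))\<^sup>2", simplified])

lemma L2_if_vanish_outside:
  assumes f: "f \<in> L2_loc_t" and v: "zero_beyond T f"
  shows "f \<in> L2"
proof -
  note [measurable] = L2_loc_t_measurable[OF f] cylinder_measurable[of "{-T..T}"]
  have "integrable lborel (\<lambda>z. indicator ({-T..T} \<times> UNIV) z *\<^sub>R (norm (f z))\<^sup>2)"
    using f by (auto simp: L2_loc_t_def set_integrable_def)
  then have "integrable lborel (\<lambda>z. (norm (f z))\<^sup>2)"
  proof (rule integrable_cong_AE_imp)
    show "AE z in lborel. indicator ({-T..T} \<times> UNIV) z *\<^sub>R (norm (f z))\<^sup>2 = (norm (f z))\<^sup>2"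
      using v
    proof eventually_elim
      case (elim z)
      then show ?case by (cases z) (auto simp: indicator_def)
    qed
  qed simp
  then show ?thesis using L2_loc_t_measurable[OF f] by (simp add: L2_def)
qed

text \<open>The derivatives of v inherit its bounded time support, and on a bounded time interval
  the local condition in time is the global one. Afterwards W is handled through the closure
  properties of \<open>tame\<close>.\<close>

lemma W_space_iff: "v \<in> W_space \<longleftrightarrow> tame v \<and> compact (supp_t v)"
proof
  assume v: "v \<in> W_space"
  then have j: "has_jet v (dt v) (\<lambda>i. dx i v) (lap v)"
    by (auto simp: W_space_def Linf_def has_jet_def)
  note [measurable] = has_jet_measurable[OF j]
  have "(\<lambda>z. (norm (dx i v z))\<^sup>2) \<in> L2_loc_t" for i
  proof (rule L2_loc_t_bound)
    show "norm_grad_sq v \<in> L2_loc_t" using v by (auto simp: W_space_def intro: L2_imp_L2_loc_t)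
    have "(norm (dx i v z))\<^sup>2 \<le> norm_grad_sq v z" for z
      unfolding norm_grad_sq_def by (rule member_le_sum) auto
    then show "AE z in lborel. norm ((norm (dx i v z))\<^sup>2) \<le> norm (norm_grad_sq v z)"
      by (intro AE_I2) (simp add: order_trans[OF _ abs_ge_self])
  qed measurable
  with j v show "tame v \<and> compact (supp_t v)"
    by (auto simp: W_space_def tame_def intro: L2_imp_L2_loc_t)
next
  assume v: "tame v \<and> compact (supp_t v)"
  then have j: "has_jet v (dt v) (\<lambda>i. dx i v) (lap v)" by (simp add: tame_def)
  obtain T where T: "T > 0" "zero_beyond T v" using v vanish_outside by blast
  note D = derivs_vanish_outside[OF j T(2,1)]
  have "norm_grad_sq v \<in> L2"
  proof (rule L2_if_vanish_outside)
    show "norm_grad_sq v \<in> L2_loc_t" unfolding norm_grad_sq_def[abs_def]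
      using v by (intro L2_loc_t_sum) (auto simp: tame_def)
    have "AE z in lborel. \<forall>i. T < \<bar>fst z\<bar> \<longrightarrow> dx i v z = 0" unfolding AE_all_countable using D(2) by blast
    then show "AE z in lborel. T < \<bar>fst z\<bar> \<longrightarrow> norm_grad_sq v z = 0"
      by eventually_elim (simp add: norm_grad_sq_def)
  qed
  then show "v \<in> W_space"
    using v j D L2_if_vanish_outside has_jet_measurable(1)[OF j]
    by (auto simp: W_space_def Linf_def has_jet_def tame_def)
qed

subsection \<open>The equivalences\<close>

definition weak_form :: "(real \<times> (real ^ 'n) \<Rightarrow> real ^ 'm) \<Rightarrow> (real \<times> (real ^ 'n) \<Rightarrow> real ^ 'm) \<Rightarrow> real \<times> (real ^ 'n) \<Rightarrow> real" where
  "weak_form u v z = - (dt u z \<bullet> dt v z) + lap u z \<bullet> lap v z"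

abbreviation biharm_form where
  "biharm_form u \<psi> z \<equiv> ((norm (lap u z))\<^sup>2 - (norm (dt u z))\<^sup>2) * \<psi> z - norm_grad_sq u z * lap \<psi> z
    + 2 * (\<Sum>i\<in>UNIV. (lap u z \<bullet> dx i u z) * dx i \<psi> z)"

abbreviation cons_form where
  "cons_form \<Lambda> u \<phi> z \<equiv> - dt \<phi> z * (dt u z \<bullet> (\<Lambda> *v u z)) + lap \<phi> z * (lap u z \<bullet> (\<Lambda> *v u z))
    + 2 * (\<Sum>i\<in>UNIV. dx i \<phi> z * (lap u z \<bullet> (\<Lambda> *v dx i u z)))"

lemma inner_le_sq:
  fixes a b :: "'a::real_inner"
  shows "\<bar>a \<bullet> b\<bar> \<le> (norm a)\<^sup>2 + (norm b)\<^sup>2"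
proof -
  have "\<bar>a \<bullet> b\<bar> \<le> norm a * norm b" by (rule Cauchy_Schwarz_ineq2)
  also have "\<dots> \<le> (norm a)\<^sup>2 + (norm b)\<^sup>2"
    using sum_squares_bound[of "norm a" "norm b"] mult_nonneg_nonneg[OF norm_ge_zero[of a] norm_ge_zero[of b]] by linarith
  finally show ?thesis .
qed

text \<open>The factor g confines the product to a slab of bounded times, on which both functions
  are square integrable.\<close>

lemma integrable_inner_L2_loc_t:
  fixes f g :: "real \<times> (real ^ 'n) \<Rightarrow> 'b::euclidean_space"
  assumes f: "f \<in> L2_loc_t" and g: "g \<in> L2_loc_t" and z: "zero_beyond T g"
  shows "integrable lborel (\<lambda>z. f z \<bullet> g z)"
proof -
  note [measurable] = L2_loc_t_measurable[OF f] L2_loc_t_measurable[OF g]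
  have "integrable lborel (\<lambda>z. indicator ({-T..T} \<times> UNIV) z *\<^sub>R (norm (f z))\<^sup>2)"
    "integrable lborel (\<lambda>z. indicator ({-T..T} \<times> UNIV) z *\<^sub>R (norm (g z))\<^sup>2)"
    using f g by (auto simp: L2_loc_t_def set_integrable_def)
  then have "integrable lborel (\<lambda>z. indicator ({-T..T} \<times> UNIV) z *\<^sub>R (norm (f z))\<^sup>2 +
     indicator ({-T..T} \<times> UNIV) z *\<^sub>R (norm (g z))\<^sup>2)" by (rule Bochner_Integration.integrable_add)
  then show ?thesis
  proof (rule Bochner_Integration.integrable_bound)
    show "(\<lambda>z. f z \<bullet> g z) \<in> borel_measurable lborel" unfolding measurable_lborel2 by measurable
    show "AE z in lborel. norm (f z \<bullet> g z) \<le> norm (indicator ({-T..T} \<times> UNIV) z *\<^sub>R (norm (f z))\<^sup>2 +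
     indicator ({-T..T} \<times> UNIV) z *\<^sub>R (norm (g z))\<^sup>2)"
      using z
    proof eventually_elim
      case (elim z)
      show ?case
      proof (cases "T < \<bar>fst z\<bar>")
        case False
        then have "z \<in> {-T..T} \<times> UNIV" by (cases z) auto
        then show ?thesis using inner_le_sq[of "f z" "g z"] by simp
      qed (use elim in simp)
    qed
  qed
qed

lemma weak_form_integrable:
  assumes u: "tame u" and w: "w \<in> W_space"
  shows "integrable lborel (weak_form u w)"
proof -
  have t: "tame w" and c: "compact (supp_t w)" using w by (auto simp: W_space_iff)
  obtain T where T: "T > 0" "zero_beyond T w" using vanish_outside[OF c] by blast
  note D = derivs_vanish_outside[OF tame_jet[OF t] T(2,1)]
  have "integrable lborel (\<lambda>z. dt u z \<bullet> dt w z)" "integrable lborel (\<lambda>z. lap u z \<bullet> lap w z)"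
    using u t by (auto simp: tame_def intro!: integrable_inner_L2_loc_t[OF _ _ D(1)] integrable_inner_L2_loc_t[OF _ _ D(3)])
  then show ?thesis unfolding weak_form_def[abs_def] by auto
qed

text \<open>The form sees its second argument through chosen derivatives, so even a change on a null
  set has to be justified by uniqueness of jets.\<close>

lemma weak_form_cong:
  assumes v: "tame v" "w \<in> borel_measurable borel" and e: "AE z in lborel. v z = w z"
  shows "AE z in lborel. weak_form u v z = weak_form u w z"
proof -

  note j = has_jet_cong_AE[OF tame_jet[OF v(1)] e v(2)]
  note q = has_jet_chosen_eq[OF j j]
  show ?thesis using q(1,3) by eventually_elim (simp add: weak_form_def)
qed

lemma W_space_add:
  assumes "v \<in> W_space" "w \<in> W_space"
  shows "(\<lambda>z. v z + w z) \<in> W_space"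
    "AE z in lborel. weak_form u (\<lambda>z. v z + w z) z = weak_form u v z + weak_form u w z"
proof -
  have t: "tame v" "tame w" using assms by (auto simp: W_space_iff)
  show "(\<lambda>z. v z + w z) \<in> W_space" using assms by (auto simp: W_space_iff intro: tame_add compact_supp_t_add)
  note j = has_jet_add[OF tame_jet[OF t(1)] tame_jet[OF t(2)]]
  note q = has_jet_chosen_eq[OF j j]
  show "AE z in lborel. weak_form u (\<lambda>z. v z + w z) z = weak_form u v z + weak_form u w z"
    using q(1,3) by eventually_elim (simp add: weak_form_def inner_add_right)
qed

lemma W_space_0:
  fixes u :: "real \<times> (real ^ 'n) \<Rightarrow> real ^ 'm"
  shows "(\<lambda>z::real \<times> (real ^ 'n). 0 :: real ^ 'm) \<in> W_space" "AE z in lborel. weak_form u (\<lambda>z. 0) z = 0"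
proof -
  let ?o = "\<lambda>z::real \<times> (real ^ 'n). 0 :: real ^ 'm"
  have q: "AE z in lborel. dt ?o z = 0" "AE z in lborel. lap ?o z = 0"
    by (rule has_jet_chosen_eq[OF has_jet_0 has_jet_0])+
  have "supp_t ?o = {}" unfolding supp_t_def by auto
  moreover have "tame ?o"
    by (rule tame_intro[OF has_jet_0]) (auto simp: L2_loc_t_def set_integrable_def)
  ultimately show "?o \<in> W_space" by (simp add: W_space_iff)
  show "AE z in lborel. weak_form u (\<lambda>z. 0) z = 0"
    using q by eventually_elim (simp add: weak_form_def)
qed

lemma W_space_sum:
  assumes u: "tame u" and w: "\<And>k. k \<in> I \<Longrightarrow> w k \<in> W_space"
  shows "(\<lambda>z. \<Sum>k\<in>I. w k z) \<in> W_space \<and>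
    (LBINT z. weak_form u (\<lambda>z. \<Sum>k\<in>I. w k z) z) = (\<Sum>k\<in>I. LBINT z. weak_form u (w k) z)"
  using w
proof (induction I rule: infinite_finite_induct)
  case (insert k I)
  have IH: "(\<lambda>z. \<Sum>k\<in>I. w k z) \<in> W_space"
    "(LBINT z. weak_form u (\<lambda>z. \<Sum>k\<in>I. w k z) z) = (\<Sum>k\<in>I. LBINT z. weak_form u (w k) z)"
    using insert by auto
  have k: "w k \<in> W_space" using insert by simp
  note a = W_space_add[OF k IH(1)]
  have "(LBINT z. weak_form u (\<lambda>z. w k z + (\<Sum>k\<in>I. w k z)) z) = (LBINT z. weak_form u (w k) z + weak_form u (\<lambda>z. \<Sum>k\<in>I. w k z) z)"
    using weak_form_integrable[OF u a(1)] weak_form_integrable[OF u k] weak_form_integrable[OF u IH(1)] a(2)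
    by (intro integral_cong_AE) auto
  also have "\<dots> = (LBINT z. weak_form u (w k) z) + (LBINT z. weak_form u (\<lambda>z. \<Sum>k\<in>I. w k z) z)"
    by (intro Bochner_Integration.integral_add weak_form_integrable u k IH)
  finally show ?case using a(1) IH(2) insert(1,2) by simp
qed (use W_space_0 in \<open>auto intro!: integral_eq_zero_AE\<close>)

text \<open>The test function in the first slot passes its time support on to the product, since the
  bilinear map vanishes wherever it does. This places \<psi> u and \<phi> \<Lambda> u in W.\<close>

lemma W_space_bilinear:
  fixes B :: "'b::euclidean_space \<Rightarrow> 'c::euclidean_space \<Rightarrow> 'd::euclidean_space"
  assumes B: "bounded_bilinear B" and f: "f \<in> W_space" and g: "tame g"
  shows "(\<lambda>z. B (f z) (g z)) \<in> W_space"
proof -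
  interpret bounded_bilinear B by fact
  have "tame f" "compact (supp_t f)" using f by (auto simp: W_space_iff)
  then show ?thesis
    using tame_bilinear(1)[OF B _ g] by (auto simp: W_space_iff zero_left intro: compact_supp_t_mono)
qed

text \<open>The product rule gives one jet of <u, u>, the constant 1 another. Besides the
  orthogonality relations this gives |\<nabla>u|^2 \<le> |\<Delta>u|, and thereby the gradient
  condition of \<open>tame\<close>.\<close>

lemma Z_space_identities:
  assumes "u \<in> Z_space"
  shows "tame u" "AE z in lborel. u z \<bullet> u z = 1" "AE z in lborel. dt u z \<bullet> u z = 0"
    "AE z in lborel. lap u z \<bullet> u z = - norm_grad_sq u z"
proof -
  have s: "AE z in lborel. norm (u z) = 1" and t: "has_weak_deriv u t_dir (dt u)" "dt u \<in> L2_loc_t"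
    and l: "has_weak_laplacian u (lap u)" "lap u \<in> L2_loc_t"
    using assms by (auto simp: Z_space_def)
  have "AE z in lborel. norm (u z) \<le> 1" using s by eventually_elim simp
  then obtain ux where "has_jet u (dt u) ux (lap u)" using has_jet_exists[OF _ t(1) l(1)] by blast
  note j = has_jet_chosen[OF this]
  note [measurable] = has_jet_measurable[OF j]
  show uu: "AE z in lborel. u z \<bullet> u z = 1" using s by eventually_elim (simp add: dot_square_norm)
  have "has_jet (\<lambda>z. 1) (\<lambda>z. u z \<bullet> dt u z + dt u z \<bullet> u z) (\<lambda>i z. u z \<bullet> dx i u z + dx i u z \<bullet> u z)
     (\<lambda>z. u z \<bullet> lap u z + lap u z \<bullet> u z + 2 *\<^sub>R (\<Sum>i\<in>UNIV. dx i u z \<bullet> dx i u z))"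
    by (rule has_jet_cong_AE[OF has_jet_bilinear[OF bounded_bilinear_inner j j] uu]) simp
  note q = has_jet_unique[OF this has_jet_const]
  show "AE z in lborel. dt u z \<bullet> u z = 0"
    using q(1) by eventually_elim (simp add: inner_commute)
  show lu: "AE z in lborel. lap u z \<bullet> u z = - norm_grad_sq u z"
    using q(3) by eventually_elim (simp add: inner_commute norm_grad_sq_def dot_square_norm)
  have "(\<lambda>z. (norm (dx i u z))\<^sup>2) \<in> L2_loc_t" for i
  proof (rule L2_loc_t_bound[OF l(2)])
    show "AE z in lborel. norm ((norm (dx i u z))\<^sup>2) \<le> norm (lap u z)"
      using lu s
    proof eventually_elim
      case (elim z)
      have "(norm (dx i u z))\<^sup>2 \<le> norm_grad_sq u z"
        unfolding norm_grad_sq_def by (rule member_le_sum) auto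
      also have "\<dots> \<le> norm (lap u z)"
        using Cauchy_Schwarz_ineq2[of "lap u z" "u z"] elim by simp
      finally show ?case by simp
    qed
  qed measurable
  then show "tame u" using j t l by (simp add: tame_def)
qed

text \<open>The term of the time derivative that differentiates \<psi> is a multiple of u, hence
  orthogonal to the time derivative of u; in the Laplacian, the term \<Delta>\<psi> u contributes -
  |\<nabla>u|^2 \<Delta>\<psi>.\<close>

lemma weak_form_radial:
  assumes u: "u \<in> Z_space" and \<psi>: "tame \<psi>"
  shows "AE z in lborel. weak_form u (\<lambda>z. \<psi> z *\<^sub>R u z) z =
     biharm_form u \<psi> z"
proof -
  note Z = Z_space_identities[OF u]
  note b = tame_bilinear[OF bounded_bilinear_scaleR \<psi> Z(1)]
  show ?thesis using Z(3,4) b(2,4)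
    by eventually_elim
      (simp add: weak_form_def inner_add_right inner_sum_right dot_square_norm algebra_simps)
qed

section \<open>Tangential test maps from skew-symmetric matrices\<close>

lemma bounded_bilinear_scaleR_matrix:
  "bounded_bilinear (\<lambda>(x::real) y. x *\<^sub>R ((\<Lambda> :: real ^ 'm ^ 'k) *v y))"
  by (rule bounded_bilinear.comp[OF bounded_bilinear_scaleR bounded_linear_ident matrix_vector_mul_bounded_linear])

lemma skew_inner:
  fixes \<Lambda> :: "real ^ 'm ^ 'm"
  assumes "transpose \<Lambda> = - \<Lambda>"
  shows "x \<bullet> (\<Lambda> *v x) = 0"
proof -
  have "x \<bullet> (\<Lambda> *v x) = (transpose \<Lambda> *v x) \<bullet> x"
    by (simp only: transpose_matrix_vector dot_lmul_matrix)
  also have "\<dots> = - (x \<bullet> (\<Lambda> *v x))"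
    using matrix_vector_mult_diff_rdistrib[of 0 \<Lambda> x] by (simp add: assms inner_commute)
  finally show ?thesis by simp
qed

text \<open>Skew symmetry removes exactly the terms in which \<phi> is not differentiated: there
  \<Lambda> stands between two copies of the same derivative of u.\<close>

lemma weak_form_skew:
  fixes \<Lambda> :: "real ^ 'm ^ 'm"
  assumes u: "tame u" and \<phi>: "tame \<phi>" and \<Lambda>: "transpose \<Lambda> = - \<Lambda>"
  shows "AE z in lborel. weak_form u (\<lambda>z. \<phi> z *\<^sub>R (\<Lambda> *v u z)) z =
     cons_form \<Lambda> u \<phi> z"
proof -
  note b = tame_bilinear[OF bounded_bilinear_scaleR_matrix \<phi> u, of \<Lambda>]
  show ?thesis using b(2,4)
    by eventually_elim
      (simp add: weak_form_def inner_add_right inner_sum_right skew_inner[OF \<Lambda>] algebra_simps)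
qed

text \<open>For \<open>y\<close> tangent to the sphere at \<open>x\<close> the matrices \<open>y\<^sub>i x\<^sub>j (e\<^sub>i e\<^sub>j\<^sup>T - e\<^sub>j e\<^sub>i\<^sup>T)\<close> sum up to
  \<open>y x\<^sup>T - x y\<^sup>T\<close>, which maps \<open>x\<close> to \<open>y\<close>.\<close>

definition skew_unit :: "'m \<Rightarrow> 'm \<Rightarrow> real ^ 'm ^ 'm" where
  "skew_unit i j = (\<chi> a b. (if a = i \<and> b = j then 1 else 0) - (if a = j \<and> b = i then 1 else 0))"

lemma transpose_skew_unit: "transpose (skew_unit i j) = - skew_unit i j"
proof -
  have "transpose (skew_unit i j) $ a $ b = (- skew_unit i j) $ a $ b" for a b
    by (simp add: skew_unit_def transpose_def conj_commute)
  then show ?thesis unfolding vec_eq_iff by blast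
qed

lemma skew_unit_mult: "skew_unit i j *v x = x $ j *\<^sub>R axis i 1 - x $ i *\<^sub>R axis j 1"
proof -
  have "(\<Sum>b\<in>UNIV. (if a = i \<and> b = j then 1 else 0) * x $ b) = (if a = i then x $ j else 0)" for a i j :: 'a
  proof -
    have "(\<Sum>b\<in>UNIV. (if a = i \<and> b = j then 1 else 0) * x $ b) =
        (\<Sum>b\<in>UNIV. if b = j then (if a = i then x $ j else 0) else 0)"
      by (rule sum.cong) auto
    then show ?thesis by simp
  qed
  then show ?thesis
    by (simp add: skew_unit_def matrix_vector_mult_def vec_eq_iff axis_def left_diff_distrib sum_subtractf)
qed

lemma sum_skew_unit:
  fixes x y :: "real ^ 'm"
  assumes "x \<bullet> x = 1" "y \<bullet> x = 0"
  shows "(\<Sum>p\<in>UNIV. (y $ fst p * x $ snd p) *\<^sub>R (skew_unit (fst p) (snd p) *v x)) = y"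
proof -
  have e: "(\<Sum>i\<in>UNIV. y $ i *\<^sub>R axis i 1) = y" for y :: "real ^ 'm"
    using basis_expansion[of y] by (simp add: scalar_mult_eq_scaleR)
  have "(\<Sum>p\<in>UNIV. (y $ fst p * x $ snd p) *\<^sub>R (skew_unit (fst p) (snd p) *v x)) =
     (\<Sum>i\<in>UNIV. \<Sum>j\<in>UNIV. (y $ i * x $ j) *\<^sub>R (skew_unit i j *v x))"
    unfolding UNIV_Times_UNIV[symmetric] by (subst sum.cartesian_product) (simp add: case_prod_beta)
  also have "\<dots> = (\<Sum>i\<in>UNIV. \<Sum>j\<in>UNIV. (x $ j * x $ j) *\<^sub>R (y $ i *\<^sub>R axis i 1))
      - (\<Sum>i\<in>UNIV. \<Sum>j\<in>UNIV. (y $ i * x $ i) *\<^sub>R (x $ j *\<^sub>R axis j 1))"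
    by (simp add: skew_unit_mult scaleR_diff_right sum_subtractf mult_ac)
  also have "\<dots> = (x \<bullet> x) *\<^sub>R y - (y \<bullet> x) *\<^sub>R x"
    unfolding scaleR_sum_left[symmetric] scaleR_sum_right[symmetric] e
    by (simp add: inner_vec_def)
  finally show ?thesis using assms by simp
qed

theorem lemma2p1:
  fixes u :: "real \<times> (real ^ 'n) \<Rightarrow> real ^ 'm"
  assumes "u \<in> Z_space"
  shows "(weak_sol_perp u \<longleftrightarrow> weak_sol_biharm u) \<and>
         (weak_sol_biharm u \<longleftrightarrow>
            (\<forall>\<Lambda> :: real ^ 'm ^ 'm. transpose \<Lambda> = - \<Lambda> \<longrightarrow> weak_sol_conservation \<Lambda> u))"
proof -
  note Z = Z_space_identities[OF assms]
  have perp_def: "weak_sol_perp u \<longleftrightarrow> (\<forall>v\<in>V_space u. (LBINT z. weak_form u v z) = 0)"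
    by (simp add: weak_sol_perp_def weak_form_def)
  have tame_inner: "tame (\<lambda>z. u z \<bullet> \<phi> z)" if "\<phi> \<in> W_space" for \<phi>
    using that tame_bilinear(1)[OF bounded_bilinear_inner Z(1)] by (simp add: W_space_iff)
  have meas [measurable]: "u \<in> borel_measurable borel" by (rule has_jet_measurable[OF tame_jet[OF Z(1)]])
  have perp_iff: "weak_sol_perp u \<longleftrightarrow> weak_sol_biharm u"
  proof
    assume perp: "weak_sol_perp u"
    show "weak_sol_biharm u" unfolding weak_sol_biharm_def
    proof
      fix \<phi> :: "real \<times> (real ^ 'n) \<Rightarrow> real ^ 'm" assume \<phi>: "\<phi> \<in> W_space"
      define \<psi> where "\<psi> = (\<lambda>z. u z \<bullet> \<phi> z)"
      define w where "w = (\<lambda>z. \<psi> z *\<^sub>R u z)"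
      define v where "v = (\<lambda>z. \<phi> z + (- \<psi> z) *\<^sub>R u z)"
      have \<psi>: "\<psi> \<in> W_space"
        using W_space_bilinear[OF bounded_bilinear_inner \<phi> Z(1)] by (simp add: \<psi>_def inner_commute)
      have w: "w \<in> W_space" unfolding w_def by (rule W_space_bilinear[OF bounded_bilinear_scaleR \<psi> Z(1)])
      have "bounded_bilinear (\<lambda>(x::real) (y::real^'m). (- x) *\<^sub>R y)"
        by (rule bounded_bilinear.comp[OF bounded_bilinear_scaleR bounded_linear_minus[OF bounded_linear_ident] bounded_linear_ident])
      from W_space_bilinear[OF this \<psi> Z(1)] have v: "v \<in> W_space"
        unfolding v_def by (rule W_space_add(1)[OF \<phi>])
      have "AE z in lborel. v z \<in> tangent_sphere (u z)"
        using Z(2) by eventually_elim (simp add: v_def \<psi>_def tangent_sphere_def inner_diff_left inner_diff_right inner_commute)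
      then have "(LBINT z. weak_form u v z) = 0" using perp v by (auto simp: perp_def V_space_def)
      moreover have "\<phi> = (\<lambda>z. v z + w z)" by (auto simp: v_def w_def)
      moreover note W_space_add(2)[OF v w, of u]
      ultimately have "(LBINT z. weak_form u \<phi> z) = (LBINT z. weak_form u w z)"
        using weak_form_integrable[OF Z(1) \<phi>] weak_form_integrable[OF Z(1) v] weak_form_integrable[OF Z(1) w]
        by (subst integral_cong_AE[where g = "\<lambda>z. weak_form u v z + weak_form u w z"]) auto
      also have "\<dots> = (LBINT z. biharm_form u \<psi> z)"
      proof (rule integral_cong_AE)
        have "tame \<psi>" using \<psi> by (simp add: W_space_iff)
        note [measurable] = has_jet_measurable[OF tame_jet[OF this]] has_jet_measurable[OF tame_jet[OF Z(1)]]
        show "(\<lambda>z. biharm_form u \<psi> z) \<in> borel_measurable lborel"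
          unfolding measurable_lborel2 norm_grad_sq_def by measurable
        show "AE z in lborel. weak_form u w z = biharm_form u \<psi> z"
          unfolding w_def by (rule weak_form_radial[OF assms \<open>tame \<psi>\<close>])
      qed (use weak_form_integrable[OF Z(1) w] in auto)
      finally show "(LBINT z. - (dt u z \<bullet> dt \<phi> z) + lap u z \<bullet> lap \<phi> z) =
        (LBINT z. ((norm (lap u z))\<^sup>2 - (norm (dt u z))\<^sup>2) * (u z \<bullet> \<phi> z)
           - norm_grad_sq u z * lap (\<lambda>y. u y \<bullet> \<phi> y) z
           + 2 * (\<Sum>i\<in>UNIV. (lap u z \<bullet> dx i u z) * dx i (\<lambda>y. u y \<bullet> \<phi> y) z))"
        unfolding weak_form_def \<psi>_def .
    qed
  next
    assume bih: "weak_sol_biharm u"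
    show "weak_sol_perp u" unfolding perp_def
    proof
      fix v assume "v \<in> V_space u"
      then have v: "v \<in> W_space" and tv: "AE z in lborel. v z \<bullet> u z = 0"
        by (auto simp: V_space_def tangent_sphere_def)
      define \<psi> where "\<psi> = (\<lambda>z. u z \<bullet> v z)"
      have "AE z in lborel. \<psi> z = 0" using tv by eventually_elim (simp add: \<psi>_def inner_commute)
      \<comment> \<open>\<open>dx i \<psi>\<close> and \<open>lap \<psi>\<close> are chosen for a
        function that is zero only almost everywhere. Its jet is transported to the zero function,
        where uniqueness makes these derivatives vanish.\<close>
      from has_jet_cong_AE[OF tame_jet[OF tame_inner[OF v, folded \<psi>_def]] this]
      have "has_jet (\<lambda>z. 0) (dt \<psi>) (\<lambda>i. dx i \<psi>) (lap \<psi>)" by simp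
      note q = has_jet_unique[OF this has_jet_0]
      have "(LBINT z. weak_form u v z) = (LBINT z. biharm_form u \<psi> z)"
        using bih v unfolding weak_sol_biharm_def weak_form_def \<psi>_def by blast
      also have "\<dots> = 0"
      proof (rule integral_eq_zero_AE)
        show "AE z in lborel. biharm_form u \<psi> z = 0"
          using \<open>AE z in lborel. \<psi> z = 0\<close> q(2,3) by eventually_elim simp
      qed
      finally show "(LBINT z. weak_form u v z) = 0" .
    qed
  qed
  have cons_iff: "weak_sol_conservation \<Lambda> u \<longleftrightarrow>
      (\<forall>\<phi>\<in>W_space. (LBINT z. weak_form u (\<lambda>z. \<phi> z *\<^sub>R (\<Lambda> *v u z)) z) = 0)"
    if \<Lambda>: "transpose \<Lambda> = - \<Lambda>" for \<Lambda> :: "real ^ 'm ^ 'm"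
  proof -
    have "(LBINT z. weak_form u (\<lambda>z. \<phi> z *\<^sub>R (\<Lambda> *v u z)) z) =
       (LBINT z. cons_form \<Lambda> u \<phi> z)"
      if \<phi>: "\<phi> \<in> W_space" for \<phi>
    proof (rule integral_cong_AE)
      have t: "tame \<phi>" using \<phi> by (simp add: W_space_iff)
      show "weak_form u (\<lambda>z. \<phi> z *\<^sub>R (\<Lambda> *v u z)) \<in> borel_measurable lborel"
        using weak_form_integrable[OF Z(1) W_space_bilinear[OF bounded_bilinear_scaleR_matrix \<phi> Z(1)]] by auto
      have L: "(\<lambda>z. \<Lambda> *v f z) \<in> borel_measurable borel" if "f \<in> borel_measurable borel"
        for f :: "real \<times> (real ^ 'n) \<Rightarrow> real ^ 'm"
        using that borel_measurable_continuous_onI[OF linear_continuous_on[OF matrix_vector_mul_bounded_linear]]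
        by (rule measurable_compose)
      note m = has_jet_measurable[OF tame_jet[OF Z(1)]]
      note [measurable] = has_jet_measurable[OF tame_jet[OF t]] m L[OF m(1)] L[OF m(3)]
      show "(\<lambda>z. cons_form \<Lambda> u \<phi> z) \<in> borel_measurable lborel"
        unfolding measurable_lborel2 by measurable
      show "AE z in lborel. weak_form u (\<lambda>z. \<phi> z *\<^sub>R (\<Lambda> *v u z)) z = cons_form \<Lambda> u \<phi> z"
        by (rule weak_form_skew[OF Z(1) t \<Lambda>])
    qed
    then show ?thesis unfolding weak_sol_conservation_def Ws_space_def by simp
  qed
  \<comment> \<open>Assertion (3) is compared with (1), since by \<open>cons_iff\<close> both are
    conditions on integrals of \<open>weak_form\<close>.\<close>
  have "weak_sol_perp u \<longleftrightarrow> (\<forall>\<Lambda> :: real ^ 'm ^ 'm. transpose \<Lambda> = - \<Lambda> \<longrightarrow> weak_sol_conservation \<Lambda> u)"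
  proof
    assume perp: "weak_sol_perp u"
    show "\<forall>\<Lambda> :: real ^ 'm ^ 'm. transpose \<Lambda> = - \<Lambda> \<longrightarrow> weak_sol_conservation \<Lambda> u"
    proof (intro allI impI)
      fix \<Lambda> :: "real ^ 'm ^ 'm" assume \<Lambda>: "transpose \<Lambda> = - \<Lambda>"
      show "weak_sol_conservation \<Lambda> u" unfolding cons_iff[OF \<Lambda>]
      proof
        fix \<phi> :: "real \<times> (real ^ 'n) \<Rightarrow> real" assume "\<phi> \<in> W_space"
        then have "(\<lambda>z. \<phi> z *\<^sub>R (\<Lambda> *v u z)) \<in> V_space u"
          using W_space_bilinear[OF bounded_bilinear_scaleR_matrix _ Z(1)] skew_inner[OF \<Lambda>]
          by (simp add: V_space_def tangent_sphere_def inner_commute)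
        then show "(LBINT z. weak_form u (\<lambda>z. \<phi> z *\<^sub>R (\<Lambda> *v u z)) z) = 0"
          using perp by (simp add: perp_def)
      qed
    qed
  next
    assume cons: "\<forall>\<Lambda> :: real ^ 'm ^ 'm. transpose \<Lambda> = - \<Lambda> \<longrightarrow> weak_sol_conservation \<Lambda> u"
    show "weak_sol_perp u" unfolding perp_def
    proof
      fix v assume "v \<in> V_space u"
      then have v: "v \<in> W_space" and tv: "AE z in lborel. v z \<bullet> u z = 0"
        by (auto simp: V_space_def tangent_sphere_def)
      \<comment> \<open>The coefficients in \<open>sum_skew_unit\<close> with y = v and x = u. They
        lie in W because v does and u is tame, so each is admissible in (3) for its own skew
        matrix.\<close>
      define \<phi> where "\<phi> = (\<lambda>(p :: 'm \<times> 'm) z. v z $ fst p * u z $ snd p)"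
      define w where "w = (\<lambda>p z. \<phi> p z *\<^sub>R (skew_unit (fst p) (snd p) *v u z))"
      have \<phi>: "\<phi> p \<in> W_space" for p
      proof -
        have "bounded_bilinear (\<lambda>x y. x $ fst p * y $ snd p :: real)"
          by (rule bounded_bilinear.comp[OF bounded_bilinear_mult bounded_linear_vec_nth bounded_linear_vec_nth])
        from W_space_bilinear[OF this v Z(1)] show ?thesis by (simp add: \<phi>_def)
      qed
      have w: "w p \<in> W_space" for p
        unfolding w_def by (rule W_space_bilinear[OF bounded_bilinear_scaleR_matrix \<phi> Z(1)])
      have "(LBINT z. weak_form u (w p) z) = 0" for p
        using cons transpose_skew_unit[of "fst p" "snd p"] cons_iff[OF transpose_skew_unit[of "fst p" "snd p"]] \<phi>[of p]
        unfolding w_def by blast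
      with W_space_sum[OF Z(1), of UNIV w] w
      have S: "(\<lambda>z. \<Sum>p\<in>UNIV. w p z) \<in> W_space" "(LBINT z. weak_form u (\<lambda>z. \<Sum>p\<in>UNIV. w p z) z) = 0" by auto
      have tvm: "tame v" using v by (simp add: W_space_iff)
      have Sm: "(\<lambda>z. \<Sum>p\<in>UNIV. w p z) \<in> borel_measurable borel"
        using S(1) has_jet_measurable(1) by (auto simp: W_space_iff tame_def)
      have "AE z in lborel. v z = (\<Sum>p\<in>UNIV. w p z)"
        using Z(2) tv by eventually_elim (simp add: w_def \<phi>_def sum_skew_unit)
      from weak_form_cong[OF tvm Sm this, of u]
      have "(LBINT z. weak_form u v z) = (LBINT z. weak_form u (\<lambda>z. \<Sum>p\<in>UNIV. w p z) z)"
        using weak_form_integrable[OF Z(1) v] weak_form_integrable[OF Z(1) S(1)]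
        by (intro integral_cong_AE) auto
      then show "(LBINT z. weak_form u v z) = 0" using S(2) by simp
    qed
  qed
  with perp_iff show ?thesis by blast
qed

end
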